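(* Let $(\Sigma,D)$ be an affine surface, let $\hat f\in C^\infty(\Sigma)$ with $d\hat f$ nowhere zero, let $\pi:T^*\Sigma\to\Sigma$ be the natural projection, and let $f=\pi^*\hat f$. (1) Let $\Phi$ be an arbitrary symmetric $(0,2)$-tensor field on $\Sigma$. Suppose that $\hat f$ satisfies $$\operatorname{Hes}^D_{\hat f}+2\rho^D_s-\mu\,d\hat f\otimes d\hat f=0\quad\text{for some }\mu\in\mathbb{R}.$$ Then $(T^*\Sigma,g_{D,\Phi},f,\mu)$ is a self-dual isotropic quasi-Einstein Walker manifold with $\lambda=0$. (2) Let $\mu\in\mathbb{R}$ and $0\neq C\in\mathbb{R}$, let $\Phi=\frac{2}{C}e^{\hat f}\left(\operatorname{Hes}^D_{\hat f}+2\rho^D_s-\mu\,d\hat f\otimes d\hat f\right)$ and let $T=Ce^{-\hat f}\operatorname{Id}$. Then $(T^*\Sigma,g_{D,\Phi,T,\operatorname{Id}},f,\mu)$ is a self-dual isotropic generalized quasi-Einstein Walker manifold with $\lambda=\frac32Ce^{-f}$.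
   Context: An affine surface $(\Sigma,D)$ is a smooth surface $\Sigma$ with a torsion-free connection $D$. Its curvature operator is $\mathcal{R}(X,Y)Z=D_{[X,Y]}Z-[D_X,D_Y]Z$, its Ricci tensor is $\rho^D(X,Y)=\operatorname{Tr}\{Z\mapsto\mathcal{R}(X,Z)Y\}$, and $\rho^D_s(X,Y)=\frac12\{\rho^D(X,Y)+\rho^D(Y,X)\}$. The Hessian is $\operatorname{Hes}^D_{\hat f}(X,Y)=XY(\hat f)-(D_XY)(\hat f)$. Local coordinates $(x^1,x^2)$ on $\Sigma$ induce coordinates $(x^1,x^2,x_{1'},x_{2'})$ on $T^*\Sigma$ by writing a 1-form as $\omega=x_{1'}dx^1+x_{2'}dx^2$. Let ${}^D\Gamma_{ij}{}^k$ be the Christoffel symbols of $D$, $\Phi$ a symmetric $(0,2)$-tensor field on $\Sigma$, and $T=(T_i^j)$, $S=(S_i^j)$ endomorphisms of $T\Sigma$ ($T\partial_{x^i}=T_i^j\partial_{x^j}$). The deformed Riemannian extension and the modified Riemannian extension are the neutral signature metrics on $T^*\Sigma$ (which are coordinate independent) $$g_{D,\Phi}=2\,dx^i\circ dx_{i'}+\{-2x_{k'}{}^D\Gamma_{ij}{}^k+\Phi_{ij}\}dx^i\circ dx^j,$$ $$g_{D,\Phi,T,S}=2\,dx^i\circ dx_{i'}+\left\{\tfrac12x_{r'}x_{s'}(T^r_iS^s_j+T^r_jS^s_i)-2x_{k'}{}^D\Gamma_{ij}{}^k+\Phi_{ij}\right\}dx^i\circ dx^j,$$ where repeated indices are summed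 and $\alpha\circ\beta=\frac12(\alpha\otimes\beta+\beta\otimes\alpha)$. A quadruple $(M,g,f,\mu)$ ($g$ pseudo-Riemannian, $f\in C^\infty(M)$, $\mu\in\mathbb{R}$) is a generalized quasi-Einstein manifold if $\operatorname{Hes}_f+\rho-\mu\,df\otimes df=\lambda g$ for some $\lambda\in C^\infty(M)$, where $\operatorname{Hes}_f$ and $\rho$ are the Hessian and Ricci tensor for the Levi-Civita connection; it is quasi-Einstein if $\lambda$ is constant. It is isotropic if $g(\nabla f,\nabla f)=0$ and $\nabla f\neq0$. A (here, 4-dimensional) Walker manifold is a pseudo-Riemannian manifold of signature $(2,2)$ admitting a 2-dimensional null parallel distribution $\mathfrak{D}$; for the metrics above $\mathfrak{D}=\operatorname{span}\{\partial_{x_{1'}},\partial_{x_{2'}}\}=\ker\pi_*$. The manifold is given the canonical orientation for which $\mathfrak{D}$ is self-dual, i.e. $\star(\partial_{x_{1'}}\wedge\partial_{x_{2'}})=\partial_{x_{1'}}\wedge\partial_{x_{2'}}$ with $\star$ the Hodge operator. Self-dual means that the anti-self-dual part $W^-$ of the Weyl tensor vanishes. *)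

theory Defs
  imports "HOL-Analysis.Analysis"
begin

section \<open>Smooth functions on open subsets of Euclidean space\<close>

definition partial :: "'n::finite \<Rightarrow> (real^'n \<Rightarrow> real) \<Rightarrow> real^'n \<Rightarrow> real" where
  "partial i F x = frechet_derivative F (at x) (axis i 1)"

primrec Ck_on :: "nat \<Rightarrow> (real^'n::finite) set \<Rightarrow> (real^'n \<Rightarrow> real) \<Rightarrow> bool" where
  "Ck_on 0 W F = continuous_on W F"
| "Ck_on (Suc k) W F = ((\<forall>x\<in>W. F differentiable (at x)) \<and> (\<forall>i. Ck_on k W (partial i F)))"

text \<open>Only meaningful for open \<open>W\<close>; it is only applied to open sets.\<close>

definition smooth_on :: "(real^'n::finite) set \<Rightarrow> (real^'n \<Rightarrow> real) \<Rightarrow> bool" where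
  "smooth_on W F \<longleftrightarrow> (\<forall>k. Ck_on k W F)"

definition smooth_field_on :: "(real^'n::finite) set \<Rightarrow> (real^'n \<Rightarrow> real^'n) \<Rightarrow> bool" where
  "smooth_field_on W X \<longleftrightarrow> (\<forall>k. smooth_on W (\<lambda>x. X x $ k))"


section \<open>Smooth manifolds\<close>

text \<open>
  A manifold is given by an atlas, i.e. an indexed family of charts: for an index \<open>a\<close> in \<open>Idx M\<close>,
  the chart with that index is the restriction of \<open>Chart M a\<close> to \<open>Dom M a\<close>. The underlying
  set is the union of the chart domains, and its topology is the one that makes all charts
  homeomorphisms onto open sets. The atlas need not be maximal.
\<close>

record ('i, 'a, 'n) atlas =
  Idx :: "'i set"
  Dom :: "'i \<Rightarrow> 'a set"
  Chart :: "'i \<Rightarrow> 'a \<Rightarrow> real^'n"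

definition points :: "('i, 'a, 'n::finite) atlas \<Rightarrow> 'a set" where
  "points M = (\<Union>a\<in>Idx M. Dom M a)"

definition img :: "('i, 'a, 'n::finite) atlas \<Rightarrow> 'i \<Rightarrow> (real^'n) set" where
  "img M a = Chart M a ` Dom M a"

definition param :: "('i, 'a, 'n::finite) atlas \<Rightarrow> 'i \<Rightarrow> real^'n \<Rightarrow> 'a" where
  "param M a = inv_into (Dom M a) (Chart M a)"

definition overlap :: "('i, 'a, 'n::finite) atlas \<Rightarrow> 'i \<Rightarrow> 'i \<Rightarrow> (real^'n) set" where
  "overlap M a b = Chart M a ` (Dom M a \<inter> Dom M b)"

definition trans_map :: "('i, 'a, 'n::finite) atlas \<Rightarrow> 'i \<Rightarrow> 'i \<Rightarrow> real^'n \<Rightarrow> real^'n" where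
  "trans_map M a b = Chart M b \<circ> param M a"

text \<open>\<open>jac M a b i k x\<close> is \<open>\<partial>y\<^sup>k/\<partial>x\<^sup>i\<close>, where \<open>x\<close> and \<open>y\<close> are the
  coordinates of the charts \<open>a\<close> and \<open>b\<close>.\<close>

definition jac :: "('i, 'a, 'n::finite) atlas \<Rightarrow> 'i \<Rightarrow> 'i \<Rightarrow> 'n \<Rightarrow> 'n \<Rightarrow> real^'n \<Rightarrow> real" where
  "jac M a b i k = partial i (\<lambda>x. trans_map M a b x $ k)"

definition atlas_topology :: "('i, 'a, 'n::finite) atlas \<Rightarrow> 'a topology" where
  "atlas_topology M =
     topology (\<lambda>W. W \<subseteq> points M \<and> (\<forall>a\<in>Idx M. open (Chart M a ` (Dom M a \<inter> W))))"

definition smooth_manifold :: "('i, 'a, 'n::finite) atlas \<Rightarrow> bool" where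
  "smooth_manifold M \<longleftrightarrow>
     (\<forall>a\<in>Idx M. inj_on (Chart M a) (Dom M a) \<and> open (img M a)) \<and>
     (\<forall>a\<in>Idx M. \<forall>b\<in>Idx M. open (overlap M a b) \<and>
        (\<forall>k. smooth_on (overlap M a b) (\<lambda>x. trans_map M a b x $ k))) \<and>
     Hausdorff_space (atlas_topology M) \<and> second_countable (atlas_topology M)"

definition local_rep :: "('i, 'a, 'n::finite) atlas \<Rightarrow> ('a \<Rightarrow> real) \<Rightarrow> 'i \<Rightarrow> real^'n \<Rightarrow> real" where
  "local_rep M f a = f \<circ> param M a"

definition smooth_fun :: "('i, 'a, 'n::finite) atlas \<Rightarrow> ('a \<Rightarrow> real) \<Rightarrow> bool" where
  "smooth_fun M f \<longleftrightarrow> (\<forall>a\<in>Idx M. smooth_on (img M a) (local_rep M f a))"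

definition differential :: "('i, 'a, 'n::finite) atlas \<Rightarrow> ('a \<Rightarrow> real) \<Rightarrow> 'i \<Rightarrow> 'n \<Rightarrow> real^'n \<Rightarrow> real" where
  "differential M f a i = partial i (local_rep M f a)"

definition differential_nowhere_zero :: "('i, 'a, 'n::finite) atlas \<Rightarrow> ('a \<Rightarrow> real) \<Rightarrow> bool" where
  "differential_nowhere_zero M f \<longleftrightarrow>
     (\<forall>a\<in>Idx M. \<forall>x\<in>img M a. \<exists>i. differential M f a i x \<noteq> 0)"


section \<open>Tensors and connections\<close>

text \<open>
  Tensor fields and connections are families of component functions, one for each chart and
  depending on the chart coordinates, subject to the respective transformation law:
  \<open>\<Phi> a i j x\<close> is \<open>\<Phi>\<^sub>i\<^sub>j\<close>, \<open>T a i j x\<close> is the component \<open>T\<^sub>i\<^sup>j\<close> in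
  \<open>T \<partial>\<^sub>i = T\<^sub>i\<^sup>j \<partial>\<^sub>j\<close>, and \<open>\<Gamma> a i j k x\<close> is the Christoffel symbol
  \<open>\<Gamma>\<^sub>i\<^sub>j\<^sup>k\<close> in \<open>D\<^bsub>\<partial>\<^sub>i\<^esub> \<partial>\<^sub>j = \<Gamma>\<^sub>i\<^sub>j\<^sup>k \<partial>\<^sub>k\<close>.
\<close>

type_synonym ('i, 'n) tensor2 = "'i \<Rightarrow> 'n \<Rightarrow> 'n \<Rightarrow> real^'n \<Rightarrow> real"
type_synonym 'n christoffel = "'n \<Rightarrow> 'n \<Rightarrow> 'n \<Rightarrow> real^'n \<Rightarrow> real"

definition sym_tensor02 :: "('i, 'a, 'n::finite) atlas \<Rightarrow> ('i, 'n) tensor2 \<Rightarrow> bool" where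
  "sym_tensor02 M \<Phi> \<longleftrightarrow>
     (\<forall>a\<in>Idx M. \<forall>i j. smooth_on (img M a) (\<Phi> a i j) \<and> (\<forall>x\<in>img M a. \<Phi> a i j x = \<Phi> a j i x)) \<and>
     (\<forall>a\<in>Idx M. \<forall>b\<in>Idx M. \<forall>x\<in>overlap M a b. \<forall>i j.
        \<Phi> a i j x = (\<Sum>k\<in>UNIV. \<Sum>l\<in>UNIV.
          jac M a b i k x * jac M a b j l x * \<Phi> b k l (trans_map M a b x)))"

definition connection :: "('i, 'a, 'n::finite) atlas \<Rightarrow> ('i \<Rightarrow> 'n christoffel) \<Rightarrow> bool" where
  "connection M \<Gamma> \<longleftrightarrow>
     (\<forall>a\<in>Idx M. \<forall>i j k. smooth_on (img M a) (\<Gamma> a i j k)) \<and>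
     (\<forall>a\<in>Idx M. \<forall>b\<in>Idx M. \<forall>x\<in>overlap M a b. \<forall>i j r.
        (\<Sum>k\<in>UNIV. \<Gamma> a i j k x * jac M a b k r x) =
        partial i (jac M a b j r) x +
        (\<Sum>k\<in>UNIV. \<Sum>l\<in>UNIV.
          jac M a b i k x * jac M a b j l x * \<Gamma> b k l r (trans_map M a b x)))"

definition dir_deriv :: "(real^'n \<Rightarrow> real^'n::finite) \<Rightarrow> (real^'n \<Rightarrow> real) \<Rightarrow> real^'n \<Rightarrow> real" where
  "dir_deriv X F x = (\<Sum>i\<in>UNIV. X x $ i * partial i F x)"

definition bracket :: "(real^'n \<Rightarrow> real^'n::finite) \<Rightarrow> (real^'n \<Rightarrow> real^'n) \<Rightarrow> real^'n \<Rightarrow> real^'n" where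
  "bracket X Y x = (\<chi> k. dir_deriv X (\<lambda>z. Y z $ k) x - dir_deriv Y (\<lambda>z. X z $ k) x)"

definition cov_deriv ::
  "'n::finite christoffel \<Rightarrow> (real^'n \<Rightarrow> real^'n) \<Rightarrow> (real^'n \<Rightarrow> real^'n) \<Rightarrow> real^'n \<Rightarrow> real^'n" where
  "cov_deriv G X Y x =
     (\<chi> k. dir_deriv X (\<lambda>z. Y z $ k) x + (\<Sum>i\<in>UNIV. \<Sum>j\<in>UNIV. X x $ i * Y x $ j * G i j k x))"

definition torsion_free :: "('i, 'a, 'n::finite) atlas \<Rightarrow> ('i \<Rightarrow> 'n christoffel) \<Rightarrow> bool" where
  "torsion_free M \<Gamma> \<longleftrightarrow>
     (\<forall>a\<in>Idx M. \<forall>X Y. smooth_field_on (img M a) X \<longrightarrow> smooth_field_on (img M a) Y \<longrightarrow>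
        (\<forall>x\<in>img M a. cov_deriv (\<Gamma> a) X Y x - cov_deriv (\<Gamma> a) Y X x = bracket X Y x))"

definition affine_surface :: "('i, 'a, 2) atlas \<Rightarrow> ('i \<Rightarrow> 2 christoffel) \<Rightarrow> bool" where
  "affine_surface M \<Gamma> \<longleftrightarrow> smooth_manifold M \<and> connection M \<Gamma> \<and> torsion_free M \<Gamma>"

definition coord_field :: "'n::finite \<Rightarrow> real^'n \<Rightarrow> real^'n" where
  "coord_field i x = axis i 1"

text \<open>The sign convention is \<open>R(X,Y) = D\<^bsub>[X,Y]\<^esub> - [D\<^sub>X, D\<^sub>Y]\<close>.\<close>

definition curvature_op ::
  "'n::finite christoffel \<Rightarrow> (real^'n \<Rightarrow> real^'n) \<Rightarrow> (real^'n \<Rightarrow> real^'n) \<Rightarrow> (real^'n \<Rightarrow> real^'n) \<Rightarrow> real^'n \<Rightarrow> real^'n" where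
  "curvature_op G X Y Z x =
     cov_deriv G (bracket X Y) Z x -
     (cov_deriv G X (cov_deriv G Y Z) x - cov_deriv G Y (cov_deriv G X Z) x)"

definition ricci_op :: "'n::finite christoffel \<Rightarrow> (real^'n \<Rightarrow> real^'n) \<Rightarrow> (real^'n \<Rightarrow> real^'n) \<Rightarrow> real^'n \<Rightarrow> real" where
  "ricci_op G X Y x = (\<Sum>k\<in>UNIV. curvature_op G X (coord_field k) Y x $ k)"

definition hessian_op ::
  "'n::finite christoffel \<Rightarrow> (real^'n \<Rightarrow> real) \<Rightarrow> (real^'n \<Rightarrow> real^'n) \<Rightarrow> (real^'n \<Rightarrow> real^'n) \<Rightarrow> real^'n \<Rightarrow> real" where
  "hessian_op G F X Y x = dir_deriv X (dir_deriv Y F) x - dir_deriv (cov_deriv G X Y) F x"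

definition ricci :: "('i \<Rightarrow> 'n::finite christoffel) \<Rightarrow> ('i, 'n) tensor2" where
  "ricci \<Gamma> a i j = ricci_op (\<Gamma> a) (coord_field i) (coord_field j)"

definition ricci_sym :: "('i \<Rightarrow> 'n::finite christoffel) \<Rightarrow> ('i, 'n) tensor2" where
  "ricci_sym \<Gamma> a i j x = (ricci \<Gamma> a i j x + ricci \<Gamma> a j i x) / 2"

definition hessian ::
  "('i, 'a, 'n::finite) atlas \<Rightarrow> ('i \<Rightarrow> 'n christoffel) \<Rightarrow> ('a \<Rightarrow> real) \<Rightarrow> ('i, 'n) tensor2" where
  "hessian M \<Gamma> f a i j = hessian_op (\<Gamma> a) (local_rep M f a) (coord_field i) (coord_field j)"


section \<open>Pseudo-Riemannian metrics\<close>

definition gram :: "('i, 'n::finite) tensor2 \<Rightarrow> 'i \<Rightarrow> real^'n \<Rightarrow> real^'n^'n" where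
  "gram g a x = (\<chi> i j. g a i j x)"

definition inner_at :: "('i, 'n::finite) tensor2 \<Rightarrow> 'i \<Rightarrow> real^'n \<Rightarrow> real^'n \<Rightarrow> real^'n \<Rightarrow> real" where
  "inner_at g a x u v = (\<Sum>i\<in>UNIV. \<Sum>j\<in>UNIV. g a i j x * u $ i * v $ j)"

definition pseudo_riemannian :: "('i, 'a, 'n::finite) atlas \<Rightarrow> ('i, 'n) tensor2 \<Rightarrow> bool" where
  "pseudo_riemannian M g \<longleftrightarrow> smooth_manifold M \<and> sym_tensor02 M g \<and>
     (\<forall>a\<in>Idx M. \<forall>x\<in>img M a. invertible (gram g a x))"

definition has_signature ::
  "('i, 'a, 'n::finite) atlas \<Rightarrow> ('i, 'n) tensor2 \<Rightarrow> nat \<Rightarrow> nat \<Rightarrow> bool" where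
  "has_signature M g p q \<longleftrightarrow> p + q = CARD('n) \<and>
     (\<forall>a\<in>Idx M. \<forall>x\<in>img M a. \<exists>P N. subspace P \<and> subspace N \<and> dim P = p \<and> dim N = q \<and>
        (\<forall>v\<in>P. v \<noteq> 0 \<longrightarrow> inner_at g a x v v > 0) \<and>
        (\<forall>v\<in>N. v \<noteq> 0 \<longrightarrow> inner_at g a x v v < 0))"

definition metric_connection ::
  "('i, 'a, 'n::finite) atlas \<Rightarrow> ('i, 'n) tensor2 \<Rightarrow> ('i \<Rightarrow> 'n christoffel) \<Rightarrow> bool" where
  "metric_connection M g \<Gamma> \<longleftrightarrow>
     (\<forall>a\<in>Idx M. \<forall>X Y Z. smooth_field_on (img M a) X \<longrightarrow> smooth_field_on (img M a) Y \<longrightarrow>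
        smooth_field_on (img M a) Z \<longrightarrow>
        (\<forall>x\<in>img M a. dir_deriv X (\<lambda>z. inner_at g a z (Y z) (Z z)) x =
           inner_at g a x (cov_deriv (\<Gamma> a) X Y x) (Z x) +
           inner_at g a x (Y x) (cov_deriv (\<Gamma> a) X Z x)))"

definition is_levi_civita ::
  "('i, 'a, 'n::finite) atlas \<Rightarrow> ('i, 'n) tensor2 \<Rightarrow> ('i \<Rightarrow> 'n christoffel) \<Rightarrow> bool" where
  "is_levi_civita M g \<Gamma> \<longleftrightarrow> connection M \<Gamma> \<and> torsion_free M \<Gamma> \<and> metric_connection M g \<Gamma>"

text \<open>
  On a pseudo-Riemannian manifold the choice is unique, except for irrelevant values at indices
  that are not in \<open>Idx M\<close> and at arguments outside \<open>img M a\<close>.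
\<close>

definition levi_civita :: "('i, 'a, 'n::finite) atlas \<Rightarrow> ('i, 'n) tensor2 \<Rightarrow> ('i \<Rightarrow> 'n christoffel)" where
  "levi_civita M g = (SOME \<Gamma>. is_levi_civita M g \<Gamma>)"

definition gradient ::
  "('i, 'a, 'n::finite) atlas \<Rightarrow> ('i, 'n) tensor2 \<Rightarrow> ('a \<Rightarrow> real) \<Rightarrow> 'i \<Rightarrow> real^'n \<Rightarrow> real^'n" where
  "gradient M g f a x = matrix_inv (gram g a x) *v (\<chi> i. differential M f a i x)"

definition generalized_quasi_einstein ::
  "('i, 'a, 'n::finite) atlas \<Rightarrow> ('i, 'n) tensor2 \<Rightarrow> ('a \<Rightarrow> real) \<Rightarrow> real \<Rightarrow> ('a \<Rightarrow> real) \<Rightarrow> bool" where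
  "generalized_quasi_einstein M g f \<mu> lam \<longleftrightarrow>
     pseudo_riemannian M g \<and> smooth_fun M f \<and> smooth_fun M lam \<and>
     (\<forall>a\<in>Idx M. \<forall>x\<in>img M a. \<forall>i j.
        hessian M (levi_civita M g) f a i j x + ricci (levi_civita M g) a i j x
          - \<mu> * (differential M f a i x * differential M f a j x)
        = local_rep M lam a x * g a i j x)"

definition quasi_einstein ::
  "('i, 'a, 'n::finite) atlas \<Rightarrow> ('i, 'n) tensor2 \<Rightarrow> ('a \<Rightarrow> real) \<Rightarrow> real \<Rightarrow> real \<Rightarrow> bool" where
  "quasi_einstein M g f \<mu> c \<longleftrightarrow> generalized_quasi_einstein M g f \<mu> (\<lambda>_. c)"

definition isotropic ::
  "('i, 'a, 'n::finite) atlas \<Rightarrow> ('i, 'n) tensor2 \<Rightarrow> ('a \<Rightarrow> real) \<Rightarrow> bool" where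
  "isotropic M g f \<longleftrightarrow> (\<forall>a\<in>Idx M. \<forall>x\<in>img M a.
     inner_at g a x (gradient M g f a x) (gradient M g f a x) = 0 \<and> gradient M g f a x \<noteq> 0)"


section \<open>Walker manifolds\<close>

type_synonym ('i, 'n) dist = "'i \<Rightarrow> real^'n \<Rightarrow> (real^'n) set"

definition distribution :: "('i, 'a, 'n::finite) atlas \<Rightarrow> nat \<Rightarrow> ('i, 'n) dist \<Rightarrow> bool" where
  "distribution M r V \<longleftrightarrow>
     (\<forall>a\<in>Idx M. \<forall>x\<in>img M a. subspace (V a x) \<and> dim (V a x) = r \<and>
        (\<exists>W E. open W \<and> x \<in> W \<and> W \<subseteq> img M a \<and> (\<forall>m<r. smooth_field_on W (E m)) \<and>
           (\<forall>y\<in>W. V a y = span ((\<lambda>m. E m y) ` {..<r})))) \<and>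
     (\<forall>a\<in>Idx M. \<forall>b\<in>Idx M. \<forall>x\<in>overlap M a b.
        V b (trans_map M a b x) = (\<lambda>v. \<chi> k. \<Sum>i\<in>UNIV. jac M a b i k x * v $ i) ` V a x)"

definition null_distribution ::
  "('i, 'a, 'n::finite) atlas \<Rightarrow> ('i, 'n) tensor2 \<Rightarrow> ('i, 'n) dist \<Rightarrow> bool" where
  "null_distribution M g V \<longleftrightarrow>
     (\<forall>a\<in>Idx M. \<forall>x\<in>img M a. \<forall>u\<in>V a x. \<forall>v\<in>V a x. inner_at g a x u v = 0)"

definition parallel_distribution ::
  "('i, 'a, 'n::finite) atlas \<Rightarrow> ('i \<Rightarrow> 'n christoffel) \<Rightarrow> ('i, 'n) dist \<Rightarrow> bool" where
  "parallel_distribution M \<Gamma> V \<longleftrightarrow>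
     (\<forall>a\<in>Idx M. \<forall>W X Y. open W \<longrightarrow> W \<subseteq> img M a \<longrightarrow> smooth_field_on W X \<longrightarrow> smooth_field_on W Y \<longrightarrow>
        (\<forall>y\<in>W. Y y \<in> V a y) \<longrightarrow> (\<forall>y\<in>W. cov_deriv (\<Gamma> a) X Y y \<in> V a y))"

definition walker ::
  "('i, 'a, 4) atlas \<Rightarrow> ('i, 4) tensor2 \<Rightarrow> ('i, 4) dist \<Rightarrow> bool" where
  "walker M g V \<longleftrightarrow> pseudo_riemannian M g \<and> has_signature M g 2 2 \<and>
     distribution M 2 V \<and> null_distribution M g V \<and> parallel_distribution M (levi_civita M g) V"


section \<open>Self-duality in dimension four\<close>

text \<open>\<open>orn a x = 1\<close> means that the coordinate frame of the chart \<open>a\<close> at \<open>x\<close> is positively oriented.\<close>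

definition orientation :: "('i, 'a, 'n::finite) atlas \<Rightarrow> ('i \<Rightarrow> real^'n \<Rightarrow> real) \<Rightarrow> bool" where
  "orientation M orn \<longleftrightarrow>
     (\<forall>a\<in>Idx M. (\<forall>x\<in>img M a. orn a x \<in> {-1, 1}) \<and> continuous_on (img M a) (orn a)) \<and>
     (\<forall>a\<in>Idx M. \<forall>b\<in>Idx M. \<forall>x\<in>overlap M a b.
        orn a x = sgn (det (\<chi> i k. jac M a b i k x)) * orn b (trans_map M a b x))"

definition vol ::
  "('i, 4) tensor2 \<Rightarrow> ('i \<Rightarrow> real^4 \<Rightarrow> real) \<Rightarrow> 'i \<Rightarrow> real^4 \<Rightarrow> 4 \<Rightarrow> 4 \<Rightarrow> 4 \<Rightarrow> 4 \<Rightarrow> real" where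
  "vol g orn a x i j k l = orn a x * sqrt \<bar>det (gram g a x)\<bar> *
     det (vector [axis i 1, axis j 1, axis k 1, axis l 1] :: real^4^4)"

text \<open>
  A bivector \<open>\<beta>\<close> is given by its components \<open>\<beta>\<^sup>i\<^sup>j\<close>, as an antisymmetric matrix. Its Hodge dual,
  with lower indices, is \<open>(\<star>\<beta>)\<^sub>c\<^sub>d = (1/2) \<beta>\<^sup>i\<^sup>j vol\<^sub>i\<^sub>j\<^sub>c\<^sub>d\<close>, which corresponds to the convention
  \<open>\<alpha> \<and> \<star>\<beta> = \<langle>\<alpha>,\<beta>\<rangle> vol\<close>; both indices are then raised.
\<close>

definition hodge ::
  "('i, 4) tensor2 \<Rightarrow> ('i \<Rightarrow> real^4 \<Rightarrow> real) \<Rightarrow> 'i \<Rightarrow> real^4 \<Rightarrow> real^4^4 \<Rightarrow> real^4^4" where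
  "hodge g orn a x \<beta> = (\<chi> k l. \<Sum>c\<in>UNIV. \<Sum>d\<in>UNIV.
     matrix_inv (gram g a x) $ k $ c * matrix_inv (gram g a x) $ l $ d *
     ((\<Sum>i\<in>UNIV. \<Sum>j\<in>UNIV. \<beta> $ i $ j * vol g orn a x i j c d) / 2))"

definition wedge :: "real^'n::finite \<Rightarrow> real^'n \<Rightarrow> real^'n^'n" where
  "wedge u v = (\<chi> i j. u $ i * v $ j - u $ j * v $ i)"

definition self_dual_distribution ::
  "('i, 'a, 4) atlas \<Rightarrow> ('i, 4) tensor2 \<Rightarrow> ('i \<Rightarrow> real^4 \<Rightarrow> real) \<Rightarrow> ('i, 4) dist \<Rightarrow> bool" where
  "self_dual_distribution M g orn V \<longleftrightarrow>
     (\<forall>a\<in>Idx M. \<forall>x\<in>img M a. \<forall>u\<in>V a x. \<forall>v\<in>V a x. hodge g orn a x (wedge u v) = wedge u v)"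

definition riemann ::
  "('i, 'a, 'n::finite) atlas \<Rightarrow> ('i, 'n) tensor2 \<Rightarrow> 'i \<Rightarrow> real^'n \<Rightarrow> 'n \<Rightarrow> 'n \<Rightarrow> 'n \<Rightarrow> 'n \<Rightarrow> real" where
  "riemann M g a x i j k l = inner_at g a x
     (curvature_op (levi_civita M g a) (coord_field i) (coord_field j) (coord_field k) x) (axis l 1)"

definition scalar_curv ::
  "('i, 'a, 'n::finite) atlas \<Rightarrow> ('i, 'n) tensor2 \<Rightarrow> 'i \<Rightarrow> real^'n \<Rightarrow> real" where
  "scalar_curv M g a x =
     (\<Sum>i\<in>UNIV. \<Sum>j\<in>UNIV. matrix_inv (gram g a x) $ i $ j * ricci (levi_civita M g) a i j x)"

text \<open>
  With the present sign convention, constant sectional curvature \<open>\<kappa>\<close> means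
  \<open>R\<^sub>i\<^sub>j\<^sub>k\<^sub>l = \<kappa> (g\<^sub>i\<^sub>k g\<^sub>j\<^sub>l - g\<^sub>i\<^sub>l g\<^sub>j\<^sub>k)\<close>, whence the signs below.
\<close>

definition weyl ::
  "('i, 'a, 'n::finite) atlas \<Rightarrow> ('i, 'n) tensor2 \<Rightarrow> 'i \<Rightarrow> real^'n \<Rightarrow> 'n \<Rightarrow> 'n \<Rightarrow> 'n \<Rightarrow> 'n \<Rightarrow> real" where
  "weyl M g a x i j k l =
     (let n = real CARD('n); \<rho> = (\<lambda>i j. ricci (levi_civita M g) a i j x); h = (\<lambda>i j. g a i j x) in
      riemann M g a x i j k l
      - (\<rho> i k * h j l - \<rho> i l * h j k + \<rho> j l * h i k - \<rho> j k * h i l) / (n - 2)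
      + scalar_curv M g a x / ((n - 1) * (n - 2)) * (h i k * h j l - h i l * h j k))"

text \<open>\<open>W\<^sup>-\<close> is the Weyl operator on bivectors, precomposed with the projection
  \<open>(1/2) (id - \<star>)\<close> onto the anti-self-dual bivectors.\<close>

definition weyl_minus ::
  "('i, 'a, 4) atlas \<Rightarrow> ('i, 4) tensor2 \<Rightarrow> ('i \<Rightarrow> real^4 \<Rightarrow> real) \<Rightarrow> 'i \<Rightarrow> real^4 \<Rightarrow> real^4^4 \<Rightarrow> real^4^4" where
  "weyl_minus M g orn a x \<beta> = (\<chi> i j. (\<Sum>k\<in>UNIV. \<Sum>l\<in>UNIV.
     weyl M g a x i j k l * ((\<beta> $ k $ l - hodge g orn a x \<beta> $ k $ l) / 2)) / 2)"

definition self_dual ::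
  "('i, 'a, 4) atlas \<Rightarrow> ('i, 4) tensor2 \<Rightarrow> ('i \<Rightarrow> real^4 \<Rightarrow> real) \<Rightarrow> bool" where
  "self_dual M g orn \<longleftrightarrow> (\<forall>a\<in>Idx M. \<forall>x\<in>img M a. \<forall>\<beta>.
     transpose \<beta> = - \<beta> \<longrightarrow> weyl_minus M g orn a x \<beta> = 0)"

text \<open>
  A totally null plane field is self-dual for exactly one of the two local orientations, so \<open>orn\<close> below is
  determined by \<open>V\<close>.
\<close>

definition self_dual_walker ::
  "('i, 'a, 4) atlas \<Rightarrow> ('i, 4) tensor2 \<Rightarrow> ('i, 4) dist \<Rightarrow> bool" where
  "self_dual_walker M g V \<longleftrightarrow> walker M g V \<and>
     (\<exists>orn. orientation M orn \<and> self_dual_distribution M g orn V \<and> self_dual M g orn)"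


section \<open>The cotangent bundle of a surface and its metrics\<close>

text \<open>
  A covector at \<open>p\<close> is the family of its components in the charts around \<open>p\<close>; the value at all other
  indices is fixed to be \<open>0\<close>, so that the family is determined by the covector.
\<close>

definition covectors :: "('i, 'a, 'n::finite) atlas \<Rightarrow> 'a \<Rightarrow> ('i \<Rightarrow> real^'n) set" where
  "covectors M p = {\<omega>.
     (\<forall>a. \<not> (a \<in> Idx M \<and> p \<in> Dom M a) \<longrightarrow> \<omega> a = 0) \<and>
     (\<forall>a\<in>Idx M. \<forall>b\<in>Idx M. p \<in> Dom M a \<longrightarrow> p \<in> Dom M b \<longrightarrow>
        (\<forall>i. \<omega> a $ i = (\<Sum>k\<in>UNIV. jac M a b i k (Chart M a p) * \<omega> b $ k)))}"

text \<open>
  The induced coordinates \<open>(x\<^sup>1, x\<^sup>2, x\<^sub>1\<^sub>', x\<^sub>2\<^sub>')\<close> are numbered \<open>1, 2, 3, 4\<close>: the index of \<open>x\<^sup>i\<close> is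
  \<open>base_idx i\<close> and that of \<open>x\<^sub>i\<^sub>'\<close> is \<open>fibre_idx i\<close>. The bundle projection is \<open>fst\<close>,
  and \<open>vertical\<close> is the kernel of its differential.
\<close>

definition cotangent :: "('i, 'a, 2) atlas \<Rightarrow> ('i, 'a \<times> ('i \<Rightarrow> real^2), 4) atlas" where
  "cotangent M =
     \<lparr>Idx = Idx M,
      Dom = (\<lambda>a. {(p, \<omega>). p \<in> Dom M a \<and> \<omega> \<in> covectors M p}),
      Chart = (\<lambda>a (p, \<omega>). vector [Chart M a p $ 1, Chart M a p $ 2, \<omega> a $ 1, \<omega> a $ 2])\<rparr>"

definition base_idx :: "2 \<Rightarrow> 4" where
  "base_idx i = (if i = 1 then 1 else 2)"

definition fibre_idx :: "2 \<Rightarrow> 4" where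
  "fibre_idx i = (if i = 1 then 3 else 4)"

definition base_coord :: "real^4 \<Rightarrow> real^2" where
  "base_coord z = (\<chi> i. z $ base_idx i)"

definition fibre_coord :: "real^4 \<Rightarrow> 2 \<Rightarrow> real" where
  "fibre_coord z i = z $ fibre_idx i"

definition vertical :: "('i, 4) dist" where
  "vertical a z = span (range (\<lambda>i. axis (fibre_idx i) 1))"

text \<open>\<open>dd m n r s\<close> is the component with indices \<open>r, s\<close> of \<open>dz\<^sup>m \<circ> dz\<^sup>n\<close>.\<close>

definition dd :: "4 \<Rightarrow> 4 \<Rightarrow> 4 \<Rightarrow> 4 \<Rightarrow> real" where
  "dd m n r s =
     (of_bool (r = m) * of_bool (s = n) + of_bool (r = n) * of_bool (s = m)) / 2"

definition deformed_extension ::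
  "('i \<Rightarrow> 2 christoffel) \<Rightarrow> ('i, 2) tensor2 \<Rightarrow> ('i, 4) tensor2" where
  "deformed_extension \<Gamma> \<Phi> a r s z =
     2 * (\<Sum>i\<in>UNIV. dd (base_idx i) (fibre_idx i) r s) +
     (\<Sum>i\<in>UNIV. \<Sum>j\<in>UNIV.
        (- 2 * (\<Sum>k\<in>UNIV. fibre_coord z k * \<Gamma> a i j k (base_coord z)) + \<Phi> a i j (base_coord z))
        * dd (base_idx i) (base_idx j) r s)"

definition modified_extension ::
  "('i \<Rightarrow> 2 christoffel) \<Rightarrow> ('i, 2) tensor2 \<Rightarrow> ('i, 2) tensor2 \<Rightarrow> ('i, 2) tensor2 \<Rightarrow> ('i, 4) tensor2" where
  "modified_extension \<Gamma> \<Phi> T S a r s z =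
     2 * (\<Sum>i\<in>UNIV. dd (base_idx i) (fibre_idx i) r s) +
     (\<Sum>i\<in>UNIV. \<Sum>j\<in>UNIV.
        ((\<Sum>p\<in>UNIV. \<Sum>q\<in>UNIV. fibre_coord z p * fibre_coord z q *
            (T a i p (base_coord z) * S a j q (base_coord z) +
             T a j p (base_coord z) * S a i q (base_coord z))) / 2
         - 2 * (\<Sum>k\<in>UNIV. fibre_coord z k * \<Gamma> a i j k (base_coord z)) + \<Phi> a i j (base_coord z))
        * dd (base_idx i) (base_idx j) r s)"

definition scalar_endo :: "('i, 'a, 'n::finite) atlas \<Rightarrow> ('a \<Rightarrow> real) \<Rightarrow> ('i, 'n) tensor2" where
  "scalar_endo M h a i j x = (if i = j then local_rep M h a x else 0)"

definition qe_tensor ::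
  "('i, 'a, 2) atlas \<Rightarrow> ('i \<Rightarrow> 2 christoffel) \<Rightarrow> ('a \<Rightarrow> real) \<Rightarrow> real \<Rightarrow> ('i, 2) tensor2" where
  "qe_tensor M \<Gamma> f \<mu> a i j x =
     hessian M \<Gamma> f a i j x + 2 * ricci_sym \<Gamma> a i j x
       - \<mu> * (differential M f a i x * differential M f a j x)"

end

theory Submission
  imports Defs
begin

text \<open>
  Write \<open>x\<^sub>i\<close> and \<open>p\<^sub>i\<close> for the base and fibre coordinates of the cotangent bundle. Both metrics have the form
  \<open>g = 2 dx\<^sup>i \<circ> dp\<^sub>i + A\<^sub>i\<^sub>j dx\<^sup>i \<circ> dx\<^sup>j\<close> with
  \<open>A\<^sub>i\<^sub>j = \<tau> p\<^sub>i p\<^sub>j - 2 p\<^sub>k \<Gamma>\<^sub>i\<^sub>j\<^sup>k + \<Phi>\<^sub>i\<^sub>j\<close> for a function \<open>\<tau>\<close> on the surface: the deformed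
  extension is the case \<open>\<tau> = 0\<close>, and \<open>T = \<tau> Id\<close>, \<open>S = Id\<close> with \<open>\<tau> = C exp (- f)\<close> gives the modified one.
  The computations are carried out for arbitrary \<open>\<tau>\<close>, in the locale \<open>extension_metric\<close>.

  The inverse matrix is \<open>(0, I; I, - A)\<close>, so the Christoffel symbols are explicit. Those with all indices in
  the base are \<open>N\<^sub>i\<^sub>j\<^sup>k = \<Gamma>\<^sub>i\<^sub>j\<^sup>k - \<tau> (\<delta>\<^sub>i\<^sup>k p\<^sub>j + \<delta>\<^sub>j\<^sup>k p\<^sub>i) / 2\<close>, and every symbol with an upper base index and
  a lower fibre index vanishes. The latter makes the fibres parallel. It also makes the base components of
  \<open>R(X, Y) \<partial>\<^sub>k\<close> depend on \<open>N\<close> alone, which is why no second derivative of \<open>A\<close> along the base enters below.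

  For fixed \<open>p\<close>, \<open>N\<close> is a projective change of \<open>D\<close>. If \<open>Ric(N)\<close> is the trace of its curvature in the base
  directions, then the Ricci tensor of \<open>g\<close> has fibre components \<open>0\<close>, mixed components \<open>3/2 \<tau> \<delta>\<^sub>i\<^sub>j\<close>, and base
  components \<open>Ric(N)\<^sub>i\<^sub>j + Ric(N)\<^sub>j\<^sub>i + \<tau> A\<^sub>i\<^sub>j\<close> (\<open>ricci_mixed\<close>, \<open>ricci_base_RN\<close>). The mixed components force
  \<open>\<lambda> = 3/2 \<tau>\<close>. With \<open>RN_trace\<close> and \<open>hessian_lift\<close>, the terms of
  \<open>Hes\<^sub>f + \<rho> - \<mu> df \<otimes> df - 3/2 \<tau> g\<close> that are linear in \<open>p\<close> add up to a symmetric product of \<open>p\<close> with \<open>d\<tau> + \<tau> df\<close>, the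
  quadratic ones cancel, and \<open>Hes\<^sup>D\<^sub>f + 2 \<rho>\<^sup>D\<^sub>s - \<mu> df \<otimes> df - \<tau> \<Phi> / 2\<close> remains. Both parts of the theorem are
  instances of this: \<open>d\<tau> = - \<tau> df\<close> holds in either case, and the last expression is zero by hypothesis in the
  first and by the choice of \<open>\<Phi>\<close> in the second (\<open>generalized_quasi_einstein\<close>).

  For the orientation given by the induced coordinates, an anti-self-dual bivector has no component along
  \<open>\<partial>\<^sub>x\<^sub>1 \<and> \<partial>\<^sub>x\<^sub>2\<close> and its mixed part is trace-free. Contracting the Weyl tensor with it thus needs only
  the curvature components described by \<open>N\<close>, and the contraction is zero because of the formula for the
  base components of the Ricci tensor (\<open>weyl_contraction_zero\<close>). The gradient of \<open>f\<close> is a non-zero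
  vertical vector, hence null.

  These are statements about a metric on a manifold, so the global objects must exist first: the cotangent
  bundle is a manifold (\<open>smooth_manifold_cotangent\<close>), \<open>g\<close> is a tensor (\<open>g_trans\<close>), the Christoffel symbols
  define a connection (\<open>is_levi_civita_christoffel\<close>), and \<open>\<Phi>\<close> in the second part is a tensor because the
  Hessian and the Ricci tensor of \<open>D\<close> are (\<open>sym_tensor02_qe_tensor\<close>).
\<close>

section \<open>Partial derivatives\<close>

lemma partial_eqI:
  assumes "(F has_derivative F') (at x)"
  shows "partial i F x = F' (axis i 1)"
  unfolding partial_def using frechet_derivative_at[OF assms] by simp

lemma has_derivative_partial:
  fixes F :: "real^'n::finite \<Rightarrow> real"
  assumes "F differentiable (at x)"
  shows "(F has_derivative (\<lambda>h. \<Sum>i\<in>UNIV. h $ i * partial i F x)) (at x)"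
proof -
  let ?F' = "frechet_derivative F (at x)"
  have D: "(F has_derivative ?F') (at x)"
    using assms frechet_derivative_works by blast
  then have lin: "linear ?F'" by (rule has_derivative_linear)
  have "?F' h = (\<Sum>i\<in>UNIV. h $ i * partial i F x)" for h
  proof -
    have "?F' h = ?F' (\<Sum>i\<in>UNIV. (h $ i) *s axis i 1)"
      by (simp add: basis_expansion)
    also have "\<dots> = (\<Sum>i\<in>UNIV. h $ i * ?F' (axis i 1))"
      by (simp add: linear_sum[OF lin] linear_cmul[OF lin] scalar_mult_eq_scaleR)
    finally show ?thesis by (simp add: partial_def)
  qed
  then have "?F' = (\<lambda>h. \<Sum>i\<in>UNIV. h $ i * partial i F x)" by blast
  with D show ?thesis by simp
qed

text \<open>
  This includes points at which \<open>F\<close> is not differentiable: \<open>frechet_derivative\<close> is a choice among the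
  derivatives, and \<open>F\<close> and \<open>G\<close> have the same ones.
\<close>

lemma partial_cong_open:
  assumes "open W" "x \<in> W" "\<And>y. y \<in> W \<Longrightarrow> F y = G y"
  shows "partial i F x = partial i G x"
proof (cases "F differentiable (at x)")
  case True
  then show ?thesis unfolding partial_def
    using frechet_derivative_transform_within_open[of F x W G] assms by simp
next
  case False
  have "(F has_derivative D) (at x) \<longleftrightarrow> (G has_derivative D) (at x)" for D
    using assms has_derivative_transform_within_open by metis
  then show ?thesis unfolding partial_def frechet_derivative_def by simp
qed

lemma differentiable_cong_open:
  assumes "open W" "x \<in> W" "\<And>y. y \<in> W \<Longrightarrow> F y = G y" "F differentiable (at x)"
  shows "G differentiable (at x)"
  using assms unfolding differentiable_def
  by (metis has_derivative_transform_within_open)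

lemma partial_const [simp]: "partial i (\<lambda>_. c) = (\<lambda>_. 0)"
  by (auto simp: partial_def fun_eq_iff)

lemma partial_coord: "partial i (\<lambda>x. x $ k) x = (if i = k then 1 else 0)"
proof -
  have "((\<lambda>x. x $ k) has_derivative (\<lambda>h. h $ k)) (at x)"
    by (rule bounded_linear_imp_has_derivative[OF bounded_linear_vec_nth])
  from partial_eqI[OF this] show ?thesis by (auto simp: axis_def)
qed

lemma partial_add:
  assumes "F differentiable (at x)" "G differentiable (at x)"
  shows "partial i (\<lambda>y. F y + G y) x = partial i F x + partial i G x"
  using partial_eqI[OF has_derivative_add[OF has_derivative_partial[OF assms(1)] has_derivative_partial[OF assms(2)]], of i]
    partial_eqI[OF has_derivative_partial[OF assms(1)], of i] partial_eqI[OF has_derivative_partial[OF assms(2)], of i]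
  by simp

lemma partial_minus:
  assumes "F differentiable (at x)"
  shows "partial i (\<lambda>y. - F y) x = - partial i F x"
  using partial_eqI[OF has_derivative_minus[OF has_derivative_partial[OF assms(1)]], of i]
    partial_eqI[OF has_derivative_partial[OF assms(1)], of i] by simp

lemma partial_diff:
  assumes "F differentiable (at x)" "G differentiable (at x)"
  shows "partial i (\<lambda>y. F y - G y) x = partial i F x - partial i G x"
  using partial_eqI[OF has_derivative_diff[OF has_derivative_partial[OF assms(1)] has_derivative_partial[OF assms(2)]], of i]
    partial_eqI[OF has_derivative_partial[OF assms(1)], of i] partial_eqI[OF has_derivative_partial[OF assms(2)], of i]
  by simp

lemma partial_mult:
  assumes "F differentiable (at x)" "G differentiable (at x)"
  shows "partial i (\<lambda>y. F y * G y) x = partial i F x * G x + F x * partial i G x"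
  using partial_eqI[OF has_derivative_mult[OF has_derivative_partial[OF assms(1)] has_derivative_partial[OF assms(2)]], of i]
    partial_eqI[OF has_derivative_partial[OF assms(1)], of i] partial_eqI[OF has_derivative_partial[OF assms(2)], of i]
  by simp

lemma partial_divide_const:
  "F differentiable (at x) \<Longrightarrow> partial i (\<lambda>y. F y / c) x = partial i F x / c"
  using partial_mult[of F x "\<lambda>_. 1 / c" i] by simp

lemma partial_sum:
  assumes "finite I" "\<And>m. m \<in> I \<Longrightarrow> F m differentiable (at x)"
  shows "partial i (\<lambda>y. \<Sum>m\<in>I. F m y) x = (\<Sum>m\<in>I. partial i (F m) x)"
  using assms
proof (induction I rule: finite_induct)
  case (insert m I)
  then show ?case by (simp add: partial_add differentiable_sum)
qed simp

lemma partial_exp: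
  assumes "F differentiable (at x)"
  shows "partial i (\<lambda>y. exp (F y)) x = exp (F x) * partial i F x"
  using partial_eqI[OF has_derivative_exp[OF has_derivative_partial[OF assms(1)]], of i]
    partial_eqI[OF has_derivative_partial[OF assms(1)], of i]
  by simp

lemma differentiable_exp_real:
  fixes F :: "real^'n::finite \<Rightarrow> real"
  shows "F differentiable (at x) \<Longrightarrow> (\<lambda>y. exp (F y)) differentiable (at x)"
  unfolding differentiable_def using has_derivative_exp by blast

lemma has_derivative_vector_partials:
  fixes G :: "real^'n::finite \<Rightarrow> real^'m::finite"
  assumes "\<And>k. (\<lambda>y. G y $ k) differentiable (at x)"
  shows "(G has_derivative (\<lambda>h. \<chi> k. \<Sum>i\<in>UNIV. h $ i * partial i (\<lambda>y. G y $ k) x)) (at x)"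
proof -
  have "(G has_derivative (\<lambda>h. \<chi> k. \<Sum>i\<in>UNIV. h $ i * partial i (\<lambda>y. G y $ k) x)) (at x) \<longleftrightarrow>
    (\<forall>b\<in>Basis. ((\<lambda>y. G y \<bullet> b) has_derivative
       (\<lambda>h. (\<chi> k. \<Sum>i\<in>UNIV. h $ i * partial i (\<lambda>y. G y $ k) x) \<bullet> b)) (at x))"
    by (rule has_derivative_componentwise_within)
  also have "\<dots>"
    using has_derivative_partial[OF assms]
    by (auto simp: Basis_vec_def inner_axis)
  finally show ?thesis .
qed

lemma
  fixes G :: "real^'n::finite \<Rightarrow> real^'m::finite"
  assumes F: "F differentiable (at (G x))" and G: "\<And>k. (\<lambda>y. G y $ k) differentiable (at x)"
  shows partial_chain: "partial i (\<lambda>y. F (G y)) x =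
      (\<Sum>k\<in>UNIV. partial i (\<lambda>y. G y $ k) x * partial k F (G x))"
    and differentiable_chain: "(\<lambda>y. F (G y)) differentiable (at x)"
proof -
  have D: "((\<lambda>y. F (G y)) has_derivative
     (\<lambda>h. \<Sum>k\<in>UNIV. (\<chi> k. \<Sum>i\<in>UNIV. h $ i * partial i (\<lambda>y. G y $ k) x) $ k * partial k F (G x))) (at x)"
    by (rule has_derivative_compose[OF has_derivative_vector_partials[OF G] has_derivative_partial[OF F]])
  show "(\<lambda>y. F (G y)) differentiable (at x)"
    using D differentiable_def by blast
  have "(\<Sum>j\<in>UNIV. axis i (1::real) $ j * partial j (\<lambda>y. G y $ k) x) = partial i (\<lambda>y. G y $ k) x" for k
    by (simp add: axis_def if_distrib[of "\<lambda>u. u * _"] cong: if_cong)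
  then show "partial i (\<lambda>y. F (G y)) x =
      (\<Sum>k\<in>UNIV. partial i (\<lambda>y. G y $ k) x * partial k F (G x))"
    using partial_eqI[OF D, of i] by simp
qed


section \<open>Smooth functions\<close>

lemma Ck_on_SucD: "Ck_on (Suc k) W F \<Longrightarrow> Ck_on k W F"
proof (induction k arbitrary: F)
  case 0
  then show ?case
    by (simp add: continuous_at_imp_continuous_on differentiable_imp_continuous_within)
next
  case (Suc k)
  then show ?case by (simp only: Ck_on.simps) blast
qed

lemma Ck_on_differentiable: "Ck_on (Suc k) W F \<Longrightarrow> x \<in> W \<Longrightarrow> F differentiable (at x)"
  by simp

lemma Ck_on_cong:
  assumes "open W" "\<And>x. x \<in> W \<Longrightarrow> F x = G x" "Ck_on k W F"
  shows "Ck_on k W G"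
  using assms(2,3)
proof (induction k arbitrary: F G)
  case 0
  then show ?case by (simp cong: continuous_on_cong)
next
  case (Suc k)
  have "Ck_on k W (partial i G)" for i
    using Suc.IH[of "partial i F" "partial i G"] Suc.prems
      partial_cong_open[OF assms(1), of _ F G i] by simp
  moreover have "G differentiable (at x)" if "x \<in> W" for x
    using differentiable_cong_open[OF assms(1) that, of F G] Suc.prems that by simp
  ultimately show ?case by simp
qed

lemma Ck_on_const: "Ck_on k W (\<lambda>_. c)"
  by (induction k arbitrary: c) auto

lemma Ck_on_coord: "Ck_on k W (\<lambda>x. x $ i)"
proof (cases k)
  case 0
  then show ?thesis by (simp add: continuous_on_component)
next
  case (Suc m)
  have "partial j (\<lambda>x. x $ i) = (\<lambda>_. if j = i then 1 else 0)" for j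
    by (auto simp: partial_coord)
  with Suc show ?thesis
    by (simp add: Ck_on_const bounded_linear_imp_differentiable bounded_linear_vec_nth)
qed

lemma Ck_on_add:
  assumes "open W" "Ck_on k W F" "Ck_on k W G"
  shows "Ck_on k W (\<lambda>x. F x + G x)"
  using assms(2,3)
proof (induction k arbitrary: F G)
  case 0
  then show ?case by (simp add: continuous_on_add)
next
  case (Suc k)
  have "Ck_on k W (partial i (\<lambda>x. F x + G x))" for i
    by (rule Ck_on_cong[OF assms(1) _ Suc.IH[of "partial i F" "partial i G"]])
       (use Suc.prems in \<open>auto simp: partial_add\<close>)
  with Suc.prems show ?case by auto
qed

lemma Ck_on_mult:
  assumes "open W" "Ck_on k W F" "Ck_on k W G"
  shows "Ck_on k W (\<lambda>x. F x * G x)"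
  using assms(2,3)
proof (induction k arbitrary: F G)
  case 0
  then show ?case by (simp add: continuous_on_mult)
next
  case (Suc k)
  have "Ck_on k W F" "Ck_on k W G"
    using Suc.prems by (auto simp only: Ck_on_SucD)
  then have "Ck_on k W (\<lambda>x. partial i F x * G x + F x * partial i G x)" for i
    using Suc by (intro Ck_on_add[OF assms(1)] Suc.IH) auto
  then have "Ck_on k W (partial i (\<lambda>x. F x * G x))" for i
    by (rule Ck_on_cong[OF assms(1), rotated]) (use Suc.prems in \<open>auto simp: partial_mult\<close>)
  with Suc.prems show ?case by auto
qed

lemma Ck_on_sum:
  assumes "open W" "finite I" "\<And>m. m \<in> I \<Longrightarrow> Ck_on k W (F m)"
  shows "Ck_on k W (\<lambda>x. \<Sum>m\<in>I. F m x)"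
  using assms(2,3)
  by (induction I rule: finite_induct) (auto simp: Ck_on_const intro!: Ck_on_add[OF assms(1)])

lemma Ck_on_exp:
  assumes "open W" "Ck_on k W F"
  shows "Ck_on k W (\<lambda>x. exp (F x))"
  using assms(2)
proof (induction k)
  case 0
  then show ?case by (simp add: continuous_on_exp)
next
  case (Suc k)
  have "Ck_on k W (\<lambda>x. exp (F x) * partial i F x)" for i
    using Suc.IH[OF Ck_on_SucD[OF Suc.prems]] Suc.prems by (simp add: Ck_on_mult[OF assms(1)])
  then have "Ck_on k W (partial i (\<lambda>x. exp (F x)))" for i
    by (rule Ck_on_cong[OF assms(1), rotated]) (use Suc.prems in \<open>auto simp: partial_exp\<close>)
  with Suc.prems show ?case by (auto intro: differentiable_exp_real)
qed

text \<open>
  The chain rule writes a partial derivative of the composition as a sum of products, one factor of which is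
  again a composition with \<open>G\<close>; hence the induction over the order is for all \<open>F\<close> at once.
\<close>

lemma Ck_on_compose:
  fixes G :: "real^'n::finite \<Rightarrow> real^'m::finite"
  assumes "open W" "\<And>x. x \<in> W \<Longrightarrow> G x \<in> V" "Ck_on k V F" "\<And>m. Ck_on k W (\<lambda>x. G x $ m)"
  shows "Ck_on k W (\<lambda>x. F (G x))"
  using assms(3,4)
proof (induction k arbitrary: F)
  case 0
  have "continuous_on W (\<lambda>x. \<chi> m. G x $ m)"
    using 0 by (intro continuous_on_vec_lambda) auto
  then have "continuous_on W G" by simp
  then show ?case
    using 0 assms(2) by (auto intro: continuous_on_compose2[of V F])
next
  case (Suc k)
  have "Ck_on k W (\<lambda>x. G x $ m)" for m
    using Suc.prems(2)[of m] by (rule Ck_on_SucD)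
  then have "Ck_on k W (\<lambda>x. partial m F (G x))" for m
    using Suc.IH[of "partial m F"] Suc.prems(1) by simp
  moreover have "Ck_on k W (partial i (\<lambda>x. G x $ m))" for i m
    using Suc.prems(2)[of m] by simp
  ultimately have sum: "Ck_on k W (\<lambda>x. \<Sum>m\<in>UNIV. partial i (\<lambda>y. G y $ m) x * partial m F (G x))" for i
    by (intro Ck_on_sum Ck_on_mult assms(1)) simp_all
  have F: "F differentiable (at (G x))" if "x \<in> W" for x
    using assms(2)[OF that] Suc.prems(1) by simp
  have G: "(\<lambda>y. G y $ m) differentiable (at x)" if "x \<in> W" for x m
    using Suc.prems(2)[of m] that by simp
  have eq: "(\<Sum>m\<in>UNIV. partial i (\<lambda>y. G y $ m) x * partial m F (G x)) = partial i (\<lambda>x. F (G x)) x"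
    if "x \<in> W" for i x
    by (rule partial_chain[OF F[OF that] G[OF that], symmetric])
  have "Ck_on k W (partial i (\<lambda>x. F (G x)))" for i
    using Ck_on_cong[of W "\<lambda>x. \<Sum>m\<in>UNIV. partial i (\<lambda>y. G y $ m) x * partial m F (G x)"
        "partial i (\<lambda>x. F (G x))" k] assms(1) eq sum by presburger
  moreover have "(\<lambda>y. F (G y)) differentiable (at x)" if "x \<in> W" for x
    by (rule differentiable_chain[OF F[OF that] G[OF that]])
  ultimately show ?case by simp
qed

lemma smooth_on_imp_differentiable:
  "smooth_on W F \<Longrightarrow> x \<in> W \<Longrightarrow> F differentiable (at x)"
  unfolding smooth_on_def using Ck_on_differentiable by blast

lemma smooth_on_imp_continuous_on: "smooth_on W F \<Longrightarrow> continuous_on W F"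
  unfolding smooth_on_def by (metis Ck_on.simps(1))

lemma smooth_on_cong:
  "open W \<Longrightarrow> smooth_on W F \<Longrightarrow> (\<And>x. x \<in> W \<Longrightarrow> F x = G x) \<Longrightarrow> smooth_on W G"
  unfolding smooth_on_def using Ck_on_cong by blast

lemma smooth_on_partial: "smooth_on W F \<Longrightarrow> smooth_on W (partial i F)"
  unfolding smooth_on_def by (metis Ck_on.simps(2))

lemma smooth_on_const: "smooth_on W (\<lambda>_. c)"
  by (simp add: smooth_on_def Ck_on_const)

lemma smooth_on_coord: "smooth_on W (\<lambda>x. x $ i)"
  by (simp add: smooth_on_def Ck_on_coord)

lemma smooth_on_add:
  "open W \<Longrightarrow> smooth_on W F \<Longrightarrow> smooth_on W G \<Longrightarrow> smooth_on W (\<lambda>x. F x + G x)"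
  by (simp add: smooth_on_def Ck_on_add)

lemma smooth_on_mult:
  "open W \<Longrightarrow> smooth_on W F \<Longrightarrow> smooth_on W G \<Longrightarrow> smooth_on W (\<lambda>x. F x * G x)"
  by (simp add: smooth_on_def Ck_on_mult)

lemma smooth_on_minus:
  "open W \<Longrightarrow> smooth_on W F \<Longrightarrow> smooth_on W (\<lambda>x. - F x)"
  using smooth_on_mult[OF _ smooth_on_const[of W "-1"], of F] by simp

lemma smooth_on_diff:
  "open W \<Longrightarrow> smooth_on W F \<Longrightarrow> smooth_on W G \<Longrightarrow> smooth_on W (\<lambda>x. F x - G x)"
  using smooth_on_add[OF _ _ smooth_on_minus, of W F G] by simp

lemma smooth_on_divide_const:
  "open W \<Longrightarrow> smooth_on W F \<Longrightarrow> smooth_on W (\<lambda>x. F x / c)"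
  using smooth_on_mult[OF _ _ smooth_on_const[of W "1 / c"], of F] by simp

lemma smooth_on_sum:
  fixes F :: "'m::finite \<Rightarrow> real^'n::finite \<Rightarrow> real"
  shows "open W \<Longrightarrow> (\<And>m. smooth_on W (F m)) \<Longrightarrow> smooth_on W (\<lambda>x. \<Sum>m\<in>UNIV. F m x)"
  by (simp add: smooth_on_def Ck_on_sum)

lemma smooth_on_exp:
  "open W \<Longrightarrow> smooth_on W F \<Longrightarrow> smooth_on W (\<lambda>x. exp (F x))"
  by (simp add: smooth_on_def Ck_on_exp)

lemma smooth_on_compose:
  fixes G :: "real^'n::finite \<Rightarrow> real^'m::finite"
  assumes "open W" "\<And>x. x \<in> W \<Longrightarrow> G x \<in> V" "smooth_on V F" "\<And>m. smooth_on W (\<lambda>x. G x $ m)"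
  shows "smooth_on W (\<lambda>x. F (G x))"
  using assms Ck_on_compose[of W G V] by (simp add: smooth_on_def)

section \<open>Symmetry of second partial derivatives\<close>

lemma partial_along_line:
  fixes F :: "real^'n::finite \<Rightarrow> real"
  assumes "F differentiable (at (x + r *\<^sub>R axis i 1))"
  shows "((\<lambda>r. F (x + r *\<^sub>R axis i 1)) has_real_derivative partial i F (x + r *\<^sub>R axis i 1)) (at r)"
proof -
  have L: "((\<lambda>r. x + r *\<^sub>R axis i 1) has_derivative (\<lambda>h. h *\<^sub>R axis i 1)) (at r)"
    by (auto intro!: derivative_eq_intros)
  have "((\<lambda>r. F (x + r *\<^sub>R axis i 1)) has_derivative
      (\<lambda>h. \<Sum>j\<in>UNIV. (h *\<^sub>R axis i (1::real)) $ j * partial j F (x + r *\<^sub>R axis i 1))) (at r)"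
    by (rule has_derivative_compose[OF L has_derivative_partial[OF assms]])
  moreover have "(\<lambda>h. \<Sum>j\<in>UNIV. (h *\<^sub>R axis i (1::real)) $ j * partial j F (x + r *\<^sub>R axis i 1))
      = (*) (partial i F (x + r *\<^sub>R axis i 1))"
    by (auto simp: fun_eq_iff axis_def if_distrib[of "\<lambda>u. _ * u"] if_distrib[of "\<lambda>u. u * _"] cong: if_cong)
  ultimately show ?thesis by (simp add: has_field_derivative_def)
qed

text \<open>
  The mean value theorem is applied twice: in direction \<open>i\<close> to the difference of \<open>F\<close> between two
  opposite sides of the square, then in direction \<open>j\<close> to \<open>partial i F\<close>.
\<close>

lemma second_difference_mean_value:
  fixes F :: "real^'n::finite \<Rightarrow> real"
  assumes s: "0 < s"
    and box: "\<And>u v. 0 \<le> u \<Longrightarrow> u \<le> s \<Longrightarrow> 0 \<le> v \<Longrightarrow> v \<le> s \<Longrightarrow>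
         F differentiable (at (x + u *\<^sub>R axis i 1 + v *\<^sub>R axis j 1)) \<and>
         partial i F differentiable (at (x + u *\<^sub>R axis i 1 + v *\<^sub>R axis j 1))"
  obtains u v where "0 \<le> u" "u \<le> s" "0 \<le> v" "v \<le> s"
    "F (x + s *\<^sub>R axis i 1 + s *\<^sub>R axis j 1) - F (x + s *\<^sub>R axis i 1)
       - F (x + s *\<^sub>R axis j 1) + F x
     = s * (s * partial j (partial i F) (x + u *\<^sub>R axis i 1 + v *\<^sub>R axis j 1))"
proof -
  let ?a = "axis i 1 :: real^'n" and ?b = "axis j 1 :: real^'n"
  define \<phi> where "\<phi> r = F ((x + s *\<^sub>R ?b) + r *\<^sub>R ?a) - F (x + r *\<^sub>R ?a)" for r
  have "(\<phi> has_real_derivative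
      partial i F ((x + s *\<^sub>R ?b) + r *\<^sub>R ?a) - partial i F (x + r *\<^sub>R ?a)) (at r)"
    if "0 \<le> r" "r \<le> s" for r
    unfolding \<phi>_def
    using that s box[of r s] box[of r 0]
    by (intro DERIV_diff partial_along_line) (auto simp: algebra_simps)
  from MVT2[OF s this] obtain u where u: "0 < u" "u < s"
    "\<phi> s - \<phi> 0 = (s - 0) * (partial i F ((x + s *\<^sub>R ?b) + u *\<^sub>R ?a) - partial i F (x + u *\<^sub>R ?a))"
    by blast
  have "((\<lambda>r. partial i F ((x + u *\<^sub>R ?a) + r *\<^sub>R ?b)) has_real_derivative
      partial j (partial i F) ((x + u *\<^sub>R ?a) + r *\<^sub>R ?b)) (at r)" if "0 \<le> r" "r \<le> s" for r
    using that u box[of u r] by (intro partial_along_line) auto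
  from MVT2[OF s this] obtain v where v: "0 < v" "v < s"
    "partial i F ((x + u *\<^sub>R ?a) + s *\<^sub>R ?b) - partial i F ((x + u *\<^sub>R ?a) + 0 *\<^sub>R ?b) =
     (s - 0) * partial j (partial i F) ((x + u *\<^sub>R ?a) + v *\<^sub>R ?b)"
    by blast
  show thesis
    by (rule that[of u v]) (use u v in \<open>auto simp: \<phi>_def algebra_simps\<close>)
qed

text \<open>
  The second difference over a square is symmetric in the two directions. By the mean value form, the two
  mixed derivatives therefore agree at suitable, possibly different, points of every small square at \<open>x\<close>,
  and both are continuous.
\<close>

lemma partial_commute:
  fixes F :: "real^'n::finite \<Rightarrow> real"
  assumes W: "open W" "x \<in> W" and F: "smooth_on W F"
  shows "partial i (partial j F) x = partial j (partial i F) x"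
proof -
  let ?a = "axis i 1 :: real^'n" and ?b = "axis j 1 :: real^'n"
  define P Q where "P = partial j (partial i F)" and "Q = partial i (partial j F)"
  have cont: "continuous (at x) P" "continuous (at x) Q"
    using smooth_on_imp_continuous_on[OF smooth_on_partial[OF smooth_on_partial[OF F]]] W
    by (auto simp: P_def Q_def continuous_on_eq_continuous_at)
  have "dist (P x) (Q x) < 2 * e" if e: "e > 0" for e
  proof -
    obtain d1 where d1: "d1 > 0" "\<And>y. dist y x < d1 \<Longrightarrow> dist (P y) (P x) < e"
      using cont(1)[unfolded continuous_at_eps_delta, rule_format, OF e] by blast
    obtain d2 where d2: "d2 > 0" "\<And>y. dist y x < d2 \<Longrightarrow> dist (Q y) (Q x) < e"
      using cont(2)[unfolded continuous_at_eps_delta, rule_format, OF e] by blast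
    obtain d3 where d3: "d3 > 0" "\<And>y. dist y x < d3 \<Longrightarrow> y \<in> W"
      using W open_dist by metis
    \<comment> \<open>A point of the square with side \<open>s\<close> has distance at most \<open>2 * s\<close> from its corner \<open>x\<close>.\<close>
    define s where "s = Min {d1, d2, d3} / 3"
    have s: "s > 0" "2 * s < d1" "2 * s < d2" "2 * s < d3"
      using d1 d2 d3 by (auto simp: s_def)
    have near: "dist (x + u *\<^sub>R ?a + v *\<^sub>R ?b) x \<le> 2 * s" "dist (x + v *\<^sub>R ?b + u *\<^sub>R ?a) x \<le> 2 * s"
      if "0 \<le> u" "u \<le> s" "0 \<le> v" "v \<le> s" for u v
    proof -
      have "norm (u *\<^sub>R ?a + v *\<^sub>R ?b) \<le> norm (u *\<^sub>R ?a) + norm (v *\<^sub>R ?b)" by (rule norm_triangle_ineq)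
      also have "\<dots> \<le> 2 * s" using that by simp
      finally show "dist (x + u *\<^sub>R ?a + v *\<^sub>R ?b) x \<le> 2 * s" "dist (x + v *\<^sub>R ?b + u *\<^sub>R ?a) x \<le> 2 * s"
        by (simp_all add: dist_norm algebra_simps)
    qed
    have diff: "F differentiable (at y)" "partial k F differentiable (at y)" if "y \<in> W" for y k
      using that F smooth_on_partial[OF F] smooth_on_imp_differentiable by blast+
    obtain u v where 1: "0 \<le> u" "u \<le> s" "0 \<le> v" "v \<le> s"
      "F (x + s *\<^sub>R ?a + s *\<^sub>R ?b) - F (x + s *\<^sub>R ?a) - F (x + s *\<^sub>R ?b) + F x
        = s * (s * P (x + u *\<^sub>R ?a + v *\<^sub>R ?b))"
      using second_difference_mean_value[OF s(1), of F x i j] near(1) diff d3(2) s(4)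
      unfolding P_def by (smt (verit))
    obtain u' v' where 2: "0 \<le> u'" "u' \<le> s" "0 \<le> v'" "v' \<le> s"
      "F (x + s *\<^sub>R ?b + s *\<^sub>R ?a) - F (x + s *\<^sub>R ?b) - F (x + s *\<^sub>R ?a) + F x
        = s * (s * Q (x + u' *\<^sub>R ?b + v' *\<^sub>R ?a))"
      using second_difference_mean_value[OF s(1), of F x j i] near(2) diff d3(2) s(4)
      unfolding Q_def by (smt (verit))
    have swap: "x + s *\<^sub>R ?a + s *\<^sub>R ?b = x + s *\<^sub>R ?b + s *\<^sub>R ?a"
      by (rule add.commute[of "s *\<^sub>R ?a", THEN arg_cong, of "(+) x", unfolded add.assoc[symmetric]])
    have "s * (s * P (x + u *\<^sub>R ?a + v *\<^sub>R ?b)) = s * (s * Q (x + u' *\<^sub>R ?b + v' *\<^sub>R ?a))"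
      using 1(5) 2(5) unfolding swap by linarith
    then have "P (x + u *\<^sub>R ?a + v *\<^sub>R ?b) = Q (x + u' *\<^sub>R ?b + v' *\<^sub>R ?a)"
      using s(1) by simp
    moreover have "dist (P (x + u *\<^sub>R ?a + v *\<^sub>R ?b)) (P x) < e"
      using near(1)[OF 1(1-4)] s by (intro d1) simp
    moreover have "dist (Q (x + u' *\<^sub>R ?b + v' *\<^sub>R ?a)) (Q x) < e"
      using near(2)[OF 2(3,4,1,2)] s by (intro d2) simp
    ultimately show ?thesis
      unfolding dist_real_def by linarith
  qed
  from this[of "dist (P x) (Q x) / 2"] have "P x = Q x"
    by (cases "P x = Q x") auto
  then show ?thesis by (simp add: P_def Q_def)
qed

section \<open>Atlases, transition maps and the atlas topology\<close>

text \<open>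
  The part of \<open>smooth_manifold\<close> that does not mention the topology. The topological lemmas below rest on it
  alone, because they are what shows that the cotangent bundle is Hausdorff and second countable.
\<close>

definition smooth_atlas :: "('i, 'a, 'n::finite) atlas \<Rightarrow> bool" where
  "smooth_atlas M \<longleftrightarrow>
     (\<forall>a\<in>Idx M. inj_on (Chart M a) (Dom M a) \<and> open (img M a)) \<and>
     (\<forall>a\<in>Idx M. \<forall>b\<in>Idx M. open (overlap M a b) \<and>
        (\<forall>k. smooth_on (overlap M a b) (\<lambda>x. trans_map M a b x $ k)))"

lemma smooth_manifold_iff:
  "smooth_manifold M \<longleftrightarrow>
     smooth_atlas M \<and> Hausdorff_space (atlas_topology M) \<and> second_countable (atlas_topology M)"
  by (auto simp: smooth_manifold_def smooth_atlas_def)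

context
  fixes M :: "('i, 'a, 'n::finite) atlas"
  assumes M: "smooth_atlas M"
begin

lemma open_img: "a \<in> Idx M \<Longrightarrow> open (img M a)"
  and open_overlap: "a \<in> Idx M \<Longrightarrow> b \<in> Idx M \<Longrightarrow> open (overlap M a b)"
  and smooth_trans: "a \<in> Idx M \<Longrightarrow> b \<in> Idx M \<Longrightarrow> smooth_on (overlap M a b) (\<lambda>x. trans_map M a b x $ k)"
  and inj_on_Chart: "a \<in> Idx M \<Longrightarrow> inj_on (Chart M a) (Dom M a)"
  using M by (auto simp: smooth_atlas_def)

lemma param_Chart: "a \<in> Idx M \<Longrightarrow> p \<in> Dom M a \<Longrightarrow> param M a (Chart M a p) = p"
  unfolding param_def by (simp add: inj_on_Chart)

lemma param_in_Dom: "x \<in> img M a \<Longrightarrow> param M a x \<in> Dom M a"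
  and Chart_param: "x \<in> img M a \<Longrightarrow> Chart M a (param M a x) = x"
  unfolding param_def img_def by (simp_all add: inv_into_into f_inv_into_f)

lemma Chart_in_img: "p \<in> Dom M a \<Longrightarrow> Chart M a p \<in> img M a"
  by (simp add: img_def)

lemma overlap_iff:
  assumes "a \<in> Idx M"
  shows "x \<in> overlap M a b \<longleftrightarrow> x \<in> img M a \<and> param M a x \<in> Dom M b"
proof
  assume "x \<in> overlap M a b"
  then show "x \<in> img M a \<and> param M a x \<in> Dom M b"
    by (auto simp: overlap_def param_Chart[OF assms] Chart_in_img)
next
  assume "x \<in> img M a \<and> param M a x \<in> Dom M b"
  then show "x \<in> overlap M a b"
    unfolding overlap_def by (intro image_eqI[of _ _ "param M a x"]) (auto simp: Chart_param param_in_Dom)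
qed

lemma overlap_subset_img: "overlap M a b \<subseteq> img M a"
  by (auto simp: overlap_def img_def)

lemma overlap_self: "overlap M a a = img M a"
  by (simp add: overlap_def img_def)

lemma param_trans:
  assumes "a \<in> Idx M" "b \<in> Idx M" "x \<in> overlap M a b"
  shows "param M b (trans_map M a b x) = param M a x"
  using assms overlap_iff param_Chart by (simp add: trans_map_def)

lemma trans_in_overlap:
  assumes "a \<in> Idx M" "b \<in> Idx M" "x \<in> overlap M a b"
  shows "trans_map M a b x \<in> overlap M b a"
  using assms unfolding trans_map_def overlap_def by (auto simp: param_Chart)

lemma trans_in_img:
  assumes "a \<in> Idx M" "b \<in> Idx M" "x \<in> overlap M a b"
  shows "trans_map M a b x \<in> img M b"
  using trans_in_overlap[OF assms] overlap_subset_img by blast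

lemma trans_trans:
  assumes "a \<in> Idx M" "b \<in> Idx M" "x \<in> overlap M a b"
  shows "trans_map M b c (trans_map M a b x) = trans_map M a c x"
  using param_trans[OF assms] by (simp add: trans_map_def)

lemma trans_in_overlap3:
  assumes "a \<in> Idx M" "b \<in> Idx M" "x \<in> overlap M a b" "x \<in> overlap M a c"
  shows "trans_map M a b x \<in> overlap M b c"
  using assms trans_in_overlap[OF assms(1-3)] param_trans[OF assms(1-3)] overlap_iff[of a x] overlap_iff[of b]
  by auto

lemma trans_self: "a \<in> Idx M \<Longrightarrow> x \<in> img M a \<Longrightarrow> trans_map M a a x = x"
  by (simp add: trans_map_def Chart_param)

lemma trans_inverse:
  assumes "a \<in> Idx M" "b \<in> Idx M" "x \<in> overlap M a b"
  shows "trans_map M b a (trans_map M a b x) = x"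
  using trans_trans[OF assms] trans_self[OF assms(1) subsetD[OF overlap_subset_img assms(3)]] by simp

lemma differentiable_trans:
  assumes "a \<in> Idx M" "b \<in> Idx M" "x \<in> overlap M a b"
  shows "(\<lambda>z. trans_map M a b z $ k) differentiable (at x)"
  using smooth_on_imp_differentiable[OF smooth_trans[OF assms(1,2)] assms(3)] .

lemma partial_trans: "partial i (\<lambda>z. trans_map M a b z $ k) x = jac M a b i k x"
  by (simp add: jac_def)

lemma smooth_jac: "a \<in> Idx M \<Longrightarrow> b \<in> Idx M \<Longrightarrow> smooth_on (overlap M a b) (jac M a b i k)"
  unfolding jac_def by (intro smooth_on_partial smooth_trans)

lemma differentiable_jac:
  assumes "a \<in> Idx M" "b \<in> Idx M" "x \<in> overlap M a b"
  shows "jac M a b i k differentiable (at x)"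
  using smooth_on_imp_differentiable[OF smooth_jac[OF assms(1,2)] assms(3)] .

lemma partial_pullback:
  assumes "a \<in> Idx M" "b \<in> Idx M" "x \<in> overlap M a b" "F differentiable (at (trans_map M a b x))"
  shows "partial i (\<lambda>z. F (trans_map M a b z)) x =
     (\<Sum>k\<in>UNIV. jac M a b i k x * partial k F (trans_map M a b x))"
  using partial_chain[OF assms(4) differentiable_trans[OF assms(1-3)]] by (simp add: jac_def)

lemma jac_self:
  assumes "a \<in> Idx M" "x \<in> img M a"
  shows "jac M a a i k x = (if i = k then 1 else 0)"
proof -
  have "partial i (\<lambda>z. trans_map M a a z $ k) x = partial i (\<lambda>z. z $ k) x"
    by (rule partial_cong_open[OF open_img[OF assms(1)] assms(2)]) (simp add: trans_self[OF assms(1)])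
  then show ?thesis by (simp add: jac_def partial_coord)
qed

lemma jac_chain:
  assumes "a \<in> Idx M" "b \<in> Idx M" "c \<in> Idx M" "x \<in> overlap M a b" "x \<in> overlap M a c"
  shows "jac M a c i k x = (\<Sum>m\<in>UNIV. jac M a b i m x * jac M b c m k (trans_map M a b x))"
proof -
  have "partial i (\<lambda>z. trans_map M a c z $ k) x = partial i (\<lambda>z. trans_map M b c (trans_map M a b z) $ k) x"
    by (rule partial_cong_open[OF open_overlap[OF assms(1,2)] assms(4)])
      (simp add: trans_trans[OF assms(1,2)])
  also have "\<dots> = (\<Sum>m\<in>UNIV. jac M a b i m x * partial m (\<lambda>z. trans_map M b c z $ k) (trans_map M a b x))"
    by (intro partial_pullback[where F = "\<lambda>z. trans_map M b c z $ k"] differentiable_trans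
          trans_in_overlap3 assms)
  finally show ?thesis by (simp add: jac_def)
qed

lemma jac_inverse:
  assumes "a \<in> Idx M" "b \<in> Idx M" "x \<in> overlap M a b"
  shows "(\<Sum>m\<in>UNIV. jac M a b i m x * jac M b a m k (trans_map M a b x)) = (if i = k then 1 else 0)"
proof -
  have x: "x \<in> img M a" using subsetD[OF overlap_subset_img assms(3)] .
  show ?thesis
    using jac_chain[OF assms(1,2,1,3), of i k] jac_self[OF assms(1) x, of i k] x
    by (simp add: overlap_self)
qed

lemma jac_inverse':
  assumes "a \<in> Idx M" "b \<in> Idx M" "x \<in> overlap M a b"
  shows "(\<Sum>m\<in>UNIV. jac M b a i m (trans_map M a b x) * jac M a b m k x) = (if i = k then 1 else 0)"
  using jac_inverse[OF assms(2,1) trans_in_overlap[OF assms]] trans_inverse[OF assms] by simp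

lemma partial_jac_commute:
  assumes "a \<in> Idx M" "b \<in> Idx M" "x \<in> overlap M a b"
  shows "partial i (jac M a b j k) x = partial j (jac M a b i k) x"
  unfolding jac_def
  by (rule partial_commute[OF open_overlap[OF assms(1,2)] assms(3) smooth_trans[OF assms(1,2)]])

lemma local_rep_trans:
  assumes "a \<in> Idx M" "b \<in> Idx M" "x \<in> overlap M a b"
  shows "local_rep M f b (trans_map M a b x) = local_rep M f a x"
  using param_trans[OF assms] by (simp add: local_rep_def)

lemma differential_trans:
  assumes "a \<in> Idx M" "b \<in> Idx M" "x \<in> overlap M a b" "smooth_fun M f"
  shows "differential M f a i x = (\<Sum>k\<in>UNIV. jac M a b i k x * differential M f b k (trans_map M a b x))"
proof -
  have "local_rep M f b differentiable (at (trans_map M a b x))"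
    using assms(4) smooth_on_imp_differentiable trans_in_img[OF assms(1-3)] assms(2)
    by (auto simp: smooth_fun_def)
  from partial_pullback[OF assms(1-3) this, of i]
    partial_cong_open[OF open_overlap[OF assms(1,2)] assms(3), of "\<lambda>z. local_rep M f b (trans_map M a b z)"
      "local_rep M f a" i] local_rep_trans[OF assms(1,2)]
  show ?thesis by (simp add: differential_def)
qed

lemma istopology_atlas:
  "istopology (\<lambda>W. W \<subseteq> points M \<and> (\<forall>a\<in>Idx M. open (Chart M a ` (Dom M a \<inter> W))))"
  unfolding istopology_def
proof (intro conjI allI impI)
  fix S T
  assume S: "S \<subseteq> points M \<and> (\<forall>a\<in>Idx M. open (Chart M a ` (Dom M a \<inter> S)))"
    and T: "T \<subseteq> points M \<and> (\<forall>a\<in>Idx M. open (Chart M a ` (Dom M a \<inter> T)))"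
  have "Chart M a ` (Dom M a \<inter> (S \<inter> T)) = Chart M a ` (Dom M a \<inter> S) \<inter> Chart M a ` (Dom M a \<inter> T)"
    if "a \<in> Idx M" for a
    using inj_on_Chart[OF that] by (auto simp: inj_on_def)
  with S T show "S \<inter> T \<subseteq> points M" "\<forall>a\<in>Idx M. open (Chart M a ` (Dom M a \<inter> (S \<inter> T)))"
    by auto
next
  fix K
  assume K: "\<forall>S\<in>K. S \<subseteq> points M \<and> (\<forall>a\<in>Idx M. open (Chart M a ` (Dom M a \<inter> S)))"
  have "Chart M a ` (Dom M a \<inter> \<Union> K) = (\<Union>S\<in>K. Chart M a ` (Dom M a \<inter> S))" for a
    by auto
  with K show "\<Union> K \<subseteq> points M" "\<forall>a\<in>Idx M. open (Chart M a ` (Dom M a \<inter> \<Union> K))"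
    by auto
qed

lemma openin_atlas:
  "openin (atlas_topology M) W \<longleftrightarrow> W \<subseteq> points M \<and> (\<forall>a\<in>Idx M. open (Chart M a ` (Dom M a \<inter> W)))"
  unfolding atlas_topology_def using topology_inverse'[OF istopology_atlas] by simp

text \<open>
  In another chart the set is the preimage of \<open>U\<close> under a transition map, which is continuous on the open
  overlap.
\<close>

lemma openin_Chart_preimage:
  assumes "a \<in> Idx M" "open U"
  shows "openin (atlas_topology M) {p \<in> Dom M a. Chart M a p \<in> U}"
  unfolding openin_atlas
proof (intro conjI ballI)
  fix b assume b: "b \<in> Idx M"
  have "Chart M b ` (Dom M b \<inter> {p \<in> Dom M a. Chart M a p \<in> U}) = overlap M b a \<inter> trans_map M b a -` U"
    unfolding overlap_def trans_map_def using param_Chart[OF b] by auto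
  moreover have "continuous_on (overlap M b a) (\<lambda>x. \<chi> k. trans_map M b a x $ k)"
    by (intro continuous_on_vec_lambda smooth_on_imp_continuous_on smooth_trans b assms)
  ultimately show "open (Chart M b ` (Dom M b \<inter> {p \<in> Dom M a. Chart M a p \<in> U}))"
    using continuous_on_open_vimage[OF open_overlap[OF b assms(1)], of "trans_map M b a"] assms(2)
    by (simp add: Int_commute)
qed (use assms in \<open>auto simp: points_def\<close>)

lemma openin_Dom: "a \<in> Idx M \<Longrightarrow> openin (atlas_topology M) (Dom M a)"
  using openin_Chart_preimage[of a UNIV] by simp

lemma topspace_atlas: "topspace (atlas_topology M) = points M"
proof -
  have "openin (atlas_topology M) (\<Union>a\<in>Idx M. Dom M a)"
    using openin_Dom by blast
  then show ?thesis
    using openin_atlas unfolding points_def topspace_def by blast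
qed

text \<open>
  The pulled back members of a countable basis of the coordinate space form a basis, provided that countably many
  charts suffice; \<open>Idx M\<close> itself may be uncountable.
\<close>

lemma second_countable_atlas:
  assumes I: "countable I" "I \<subseteq> Idx M" "points M \<subseteq> (\<Union>a\<in>I. Dom M a)"
  shows "second_countable (atlas_topology M)"
proof -
  obtain B :: "(real^'n) set set" where B: "countable B" "topological_basis B"
    using ex_countable_basis by blast
  define \<B> where "\<B> = (\<lambda>(a, U). {p \<in> Dom M a. Chart M a p \<in> U}) ` (I \<times> B)"
  have "countable \<B>" unfolding \<B>_def using I B by blast
  moreover have "openin (atlas_topology M) V" if "V \<in> \<B>" for V
    using that I B openin_Chart_preimage topological_basis_open unfolding \<B>_def by fastforce
  moreover have "\<exists>V\<in>\<B>. p \<in> V \<and> V \<subseteq> W" if W: "openin (atlas_topology M) W" and p: "p \<in> W" for W p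
  proof -
    obtain a where a: "a \<in> I" "a \<in> Idx M" "p \<in> Dom M a"
      using W p I openin_atlas by blast
    have "open (Chart M a ` (Dom M a \<inter> W))"
      using W a openin_atlas by blast
    moreover have "Chart M a p \<in> Chart M a ` (Dom M a \<inter> W)"
      using a p by blast
    ultimately obtain U where U: "U \<in> B" "Chart M a p \<in> U" "U \<subseteq> Chart M a ` (Dom M a \<inter> W)"
      using topological_basisE[OF B(2)] by metis
    have "{q \<in> Dom M a. Chart M a q \<in> U} \<subseteq> W"
      using U(3) inj_on_Chart[OF a(2)] by (auto simp: inj_on_def)
    with U a show ?thesis unfolding \<B>_def by force
  qed
  ultimately show ?thesis unfolding second_countable_def by blast
qed

end

text \<open>
  A second countable space is Lindelof, so the cover by chart domains has a countable subcover.
\<close>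

lemma countable_subatlas:
  assumes "smooth_manifold M"
  obtains I where "countable I" "I \<subseteq> Idx M" "points M \<subseteq> (\<Union>a\<in>I. Dom M a)"
proof -
  have M: "smooth_atlas M" and "Lindelof_space (atlas_topology M)"
    using assms second_countable_imp_Lindelof_space by (auto simp: smooth_manifold_iff)
  then obtain \<V> where \<V>: "countable \<V>" "\<V> \<subseteq> Dom M ` Idx M" "\<Union> \<V> = points M"
    unfolding Lindelof_space_def topspace_atlas[OF M]
    by (metis (no_types, lifting) imageE openin_Dom[OF M] points_def)
  then obtain I where "countable I" "I \<subseteq> Idx M" "\<V> = Dom M ` I"
    using countable_subset_image[of \<V> "Dom M" "Idx M"] by auto
  with \<V> that show thesis by auto
qed

section \<open>Base and fibre coordinates\<close>

lemma idx2_cases: "i = (1::2) \<or> i = 2"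
  using exhaust_2 by auto

lemma base_idx_simps [simp]: "base_idx 1 = 1" "base_idx 2 = 2"
  and fibre_idx_simps [simp]: "fibre_idx 1 = 3" "fibre_idx 2 = 4"
  by (auto simp: base_idx_def fibre_idx_def)

lemma base_idx_eq_iff [simp]: "base_idx i = base_idx j \<longleftrightarrow> i = j"
  and fibre_idx_eq_iff [simp]: "fibre_idx i = fibre_idx j \<longleftrightarrow> i = j"
  and base_neq_fibre [simp]: "base_idx i \<noteq> fibre_idx j" "fibre_idx j \<noteq> base_idx i"
  using idx2_cases[of i] idx2_cases[of j] by auto

lemma idx4_cases:
  obtains (base) i where "c = base_idx i" | (fibre) i where "c = fibre_idx i"
proof -
  have "c = base_idx 1 \<or> c = base_idx 2 \<or> c = fibre_idx 1 \<or> c = fibre_idx 2"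
    using exhaust_4[of c] by simp
  with that show thesis by blast
qed

lemma forall_idx4: "(\<forall>c::4. P c) \<longleftrightarrow> (\<forall>i. P (base_idx i)) \<and> (\<forall>i. P (fibre_idx i))"
  by (simp add: forall_4 forall_2)

lemma sum_idx4: "(\<Sum>c\<in>UNIV. F (c::4)) = (\<Sum>i\<in>UNIV. F (base_idx i)) + (\<Sum>i\<in>UNIV. F (fibre_idx i))"
  by (simp add: sum_4 sum_2 add.assoc)

lemma base_coord_nth [simp]: "base_coord z $ i = z $ base_idx i"
  by (simp add: base_coord_def)

lemma coords_eqI: "base_coord z = base_coord w \<Longrightarrow> fibre_coord z = fibre_coord w \<Longrightarrow> z = w"
  by (simp add: vec_eq_iff forall_idx4 base_coord_def fibre_coord_def fun_eq_iff)

definition join_coords :: "real^2 \<Rightarrow> (2 \<Rightarrow> real) \<Rightarrow> real^4" where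
  "join_coords x w = vector [x $ 1, x $ 2, w 1, w 2]"

lemma join_coords_simps [simp]:
  "base_coord (join_coords x w) = x" "fibre_coord (join_coords x w) = w"
proof -
  have nth: "join_coords x w $ 1 = x $ 1" "join_coords x w $ 2 = x $ 2"
    "join_coords x w $ 3 = w 1" "join_coords x w $ 4 = w 2"
    by (simp_all add: join_coords_def vector_def)
  show "base_coord (join_coords x w) = x"
    by (simp add: vec_eq_iff forall_2 nth)
  show "fibre_coord (join_coords x w) = w"
    by (simp add: fun_eq_iff forall_2 fibre_coord_def nth)
qed

lemma bounded_linear_base_coord: "bounded_linear base_coord"
  unfolding linear_conv_bounded_linear[symmetric]
  by (rule linearI) (simp_all add: vec_eq_iff)

lemma open_base_coord_vimage: "open U \<Longrightarrow> open {z. base_coord z \<in> U}"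
  using continuous_open_vimage[of U base_coord] bounded_linear_base_coord
  by (simp add: linear_continuous_at vimage_def)

lemma smooth_on_fibre_coord: "smooth_on W (\<lambda>z. fibre_coord z i)"
  unfolding fibre_coord_def by (rule smooth_on_coord)

lemma smooth_on_base:
  assumes "open U" "smooth_on U F"
  shows "smooth_on {z. base_coord z \<in> U} (\<lambda>z. F (base_coord z))"
  by (rule smooth_on_compose[OF open_base_coord_vimage[OF assms(1)] _ assms(2)])
    (auto intro: smooth_on_coord)

lemma differentiable_nth: "(\<lambda>z. z $ c) differentiable (at z)"
  by (rule bounded_linear_imp_differentiable[OF bounded_linear_vec_nth])

lemma differentiable_fibre_coord: "(\<lambda>z. fibre_coord z i) differentiable (at z)"
  unfolding fibre_coord_def by (rule differentiable_nth)

lemma differentiable_base: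
  fixes F :: "real^2 \<Rightarrow> real"
  assumes "F differentiable (at (base_coord z))"
  shows "(\<lambda>z. F (base_coord z)) differentiable (at z)"
  by (rule differentiable_chain[where G = base_coord, OF assms]) (simp add: differentiable_nth)

lemma partial_base:
  assumes "F differentiable (at (base_coord z))"
  shows "partial (base_idx i) (\<lambda>z. F (base_coord z)) z = partial i F (base_coord z)"
    and "partial (fibre_idx i) (\<lambda>z. F (base_coord z)) z = 0"
  using partial_chain[where G = base_coord, OF assms, of "base_idx i"]
    partial_chain[where G = base_coord, OF assms, of "fibre_idx i"]
  by (simp_all add: differentiable_nth partial_coord if_distrib[of "\<lambda>u. u * _"] cong: if_cong)

lemma partial_fibre_coord:
  "partial (base_idx i) (\<lambda>z. fibre_coord z j) z = 0"
  "partial (fibre_idx i) (\<lambda>z. fibre_coord z j) z = (if i = j then 1 else 0)"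
  by (simp_all add: fibre_coord_def partial_coord)


section \<open>The cotangent bundle is a smooth manifold\<close>

text \<open>
  The covector at \<open>p\<close> whose components in the chart \<open>a\<close> are \<open>w\<close>: the transformation law determines the
  components in all other charts.
\<close>

definition covector_of :: "('i, 'a, 'n::finite) atlas \<Rightarrow> 'i \<Rightarrow> 'a \<Rightarrow> ('n \<Rightarrow> real) \<Rightarrow> 'i \<Rightarrow> real^'n" where
  "covector_of M a p w = (\<lambda>b. if b \<in> Idx M \<and> p \<in> Dom M b
     then (\<chi> i. \<Sum>k\<in>UNIV. jac M b a i k (Chart M b p) * w k) else 0)"

lemma Chart_in_overlap: "p \<in> Dom M a \<Longrightarrow> p \<in> Dom M b \<Longrightarrow> Chart M a p \<in> overlap M a b"
  by (auto simp: overlap_def)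

lemma trans_Chart: "smooth_atlas M \<Longrightarrow> a \<in> Idx M \<Longrightarrow> p \<in> Dom M a \<Longrightarrow> trans_map M a b (Chart M a p) = Chart M b p"
  by (simp add: trans_map_def param_Chart)

text \<open>
  This is the cocycle condition for the Jacobians.
\<close>

lemma covector_of_in_covectors:
  assumes M: "smooth_atlas M" and a: "a \<in> Idx M" and p: "p \<in> Dom M a"
  shows "covector_of M a p w \<in> covectors M p"
proof -
  have "covector_of M a p w b $ i = (\<Sum>m\<in>UNIV. jac M b c i m (Chart M b p) * covector_of M a p w c $ m)"
    if b: "b \<in> Idx M" "p \<in> Dom M b" and c: "c \<in> Idx M" "p \<in> Dom M c" for b c i
  proof -
    have "covector_of M a p w b $ i =
      (\<Sum>k\<in>UNIV. \<Sum>m\<in>UNIV. jac M b c i m (Chart M b p) * jac M c a m k (Chart M c p) * w k)"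
      using b jac_chain[OF M b(1) c(1) a Chart_in_overlap[OF b(2) c(2)] Chart_in_overlap[OF b(2) p]]
      by (simp add: covector_of_def trans_Chart[OF M b] sum_distrib_right)
    also have "\<dots> = (\<Sum>m\<in>UNIV. \<Sum>k\<in>UNIV. jac M b c i m (Chart M b p) * jac M c a m k (Chart M c p) * w k)"
      by (rule sum.swap)
    finally show ?thesis
      using c by (simp add: covector_of_def sum_distrib_left mult.assoc)
  qed
  then show ?thesis
    unfolding covectors_def by (auto simp: covector_of_def)
qed

lemma covector_of_self:
  assumes "smooth_atlas M" "a \<in> Idx M" "p \<in> Dom M a"
  shows "($) (covector_of M a p w a) = w"
  using assms jac_self[OF assms(1,2) Chart_in_img[OF assms(1,3)]]
  by (simp add: covector_of_def fun_eq_iff if_distrib[of "\<lambda>u. u * _"] cong: if_cong)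

lemma covector_of_component:
  assumes "\<omega> \<in> covectors M p" "a \<in> Idx M" "p \<in> Dom M a"
  shows "covector_of M a p (($) (\<omega> a)) = \<omega>"
  using assms unfolding covectors_def covector_of_def by (auto simp: fun_eq_iff vec_eq_iff)

lemma Idx_cotangent [simp]: "Idx (cotangent M) = Idx M"
  by (simp add: cotangent_def)

lemma Dom_cotangent: "(p, \<omega>) \<in> Dom (cotangent M) a \<longleftrightarrow> p \<in> Dom M a \<and> \<omega> \<in> covectors M p"
  by (simp add: cotangent_def)

lemma Chart_cotangent: "Chart (cotangent M) a (p, \<omega>) = join_coords (Chart M a p) (($) (\<omega> a))"
  by (simp add: cotangent_def join_coords_def)

context
  fixes M :: "('i, 'a, 2) atlas"
  assumes M: "smooth_atlas M"
begin

lemma img_cotangent: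
  assumes a: "a \<in> Idx M"
  shows "img (cotangent M) a = {z. base_coord z \<in> img M a}"
proof (intro set_eqI iffI)
  fix z assume "z \<in> img (cotangent M) a"
  then show "z \<in> {z. base_coord z \<in> img M a}"
    unfolding img_def by (auto simp: Chart_cotangent Dom_cotangent)
next
  fix z assume z: "z \<in> {z. base_coord z \<in> img M a}"
  let ?p = "param M a (base_coord z)"
  let ?\<omega> = "covector_of M a ?p (fibre_coord z)"
  have p: "?p \<in> Dom M a" using z param_in_Dom[OF M] by simp
  have "Chart (cotangent M) a (?p, ?\<omega>) = z"
    using z by (intro coords_eqI)
      (simp_all add: Chart_cotangent Chart_param[OF M] covector_of_self[OF M a p])
  moreover have "(?p, ?\<omega>) \<in> Dom (cotangent M) a"
    using p covector_of_in_covectors[OF M a p] by (simp add: Dom_cotangent)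
  ultimately show "z \<in> img (cotangent M) a" unfolding img_def by force
qed

lemma inj_on_Chart_cotangent:
  assumes a: "a \<in> Idx M"
  shows "inj_on (Chart (cotangent M) a) (Dom (cotangent M) a)"
proof (rule inj_onI, safe)
  fix p \<omega> q \<eta>
  assume p: "(p, \<omega>) \<in> Dom (cotangent M) a" and q: "(q, \<eta>) \<in> Dom (cotangent M) a"
    and eq: "Chart (cotangent M) a (p, \<omega>) = Chart (cotangent M) a (q, \<eta>)"
  have C: "Chart M a p = Chart M a q" and c: "($) (\<omega> a) = ($) (\<eta> a)"
    using arg_cong[OF eq, of base_coord] arg_cong[OF eq, of fibre_coord]
    by (simp_all add: Chart_cotangent)
  show "p = q"
    using C p q inj_on_Chart[OF M a] by (simp add: Dom_cotangent inj_on_eq_iff)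
  have "\<omega> = covector_of M a p (($) (\<omega> a))"
    using p by (intro covector_of_component[OF _ a, symmetric]) (simp_all add: Dom_cotangent)
  also have "\<dots> = covector_of M a q (($) (\<eta> a))"
    by (simp only: c \<open>p = q\<close>)
  also have "\<dots> = \<eta>"
    using q by (intro covector_of_component[OF _ a]) (simp_all add: Dom_cotangent)
  finally show "\<omega> = \<eta>" .
qed

text \<open>
  With this formula for the inverse charts, the transition maps of the bundle become explicit.
\<close>

lemma param_cotangent:
  assumes "a \<in> Idx M" "base_coord z \<in> img M a"
  shows "param (cotangent M) a z =
    (param M a (base_coord z), covector_of M a (param M a (base_coord z)) (fibre_coord z))"
  unfolding param_def[of "cotangent M"]
proof (rule inv_into_f_eq[OF inj_on_Chart_cotangent[OF assms(1)]])
  have p: "param M a (base_coord z) \<in> Dom M a" using assms param_in_Dom[OF M] by simp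
  then show "(param M a (base_coord z), covector_of M a (param M a (base_coord z)) (fibre_coord z))
      \<in> Dom (cotangent M) a"
    using covector_of_in_covectors[OF M assms(1) p] by (simp add: Dom_cotangent)
  show "Chart (cotangent M) a
      (param M a (base_coord z), covector_of M a (param M a (base_coord z)) (fibre_coord z)) = z"
    using assms by (intro coords_eqI)
      (simp_all add: Chart_cotangent Chart_param[OF M] covector_of_self[OF M assms(1) p])
qed

lemma overlap_cotangent:
  assumes a: "a \<in> Idx M"
  shows "overlap (cotangent M) a b = {z. base_coord z \<in> overlap M a b}"
proof (intro set_eqI iffI)
  fix z assume "z \<in> overlap (cotangent M) a b"
  then show "z \<in> {z. base_coord z \<in> overlap M a b}"
    unfolding overlap_def by (auto simp: Chart_cotangent Dom_cotangent)
next
  fix z assume z: "z \<in> {z. base_coord z \<in> overlap M a b}"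
  then have img: "base_coord z \<in> img M a" and b: "param M a (base_coord z) \<in> Dom M b"
    using overlap_iff[OF M a] by auto
  from img have "z \<in> Chart (cotangent M) a ` Dom (cotangent M) a"
    using img_cotangent[OF a] by (simp add: img_def)
  then obtain q where q: "z = Chart (cotangent M) a q" "q \<in> Dom (cotangent M) a"
    by (rule imageE)
  then have "param (cotangent M) a z = q"
    using inj_on_Chart_cotangent[OF a] unfolding param_def by simp
  then have "fst q \<in> Dom M b" using param_cotangent[OF a img] b by auto
  with q show "z \<in> overlap (cotangent M) a b"
    unfolding overlap_def by (cases q) (auto simp: Dom_cotangent intro!: image_eqI)
qed

lemma
  assumes "a \<in> Idx M" "b \<in> Idx M" "base_coord z \<in> overlap M a b"
  shows base_trans_cotangent:
      "base_coord (trans_map (cotangent M) a b z) = trans_map M a b (base_coord z)"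
    and fibre_trans_cotangent: "fibre_coord (trans_map (cotangent M) a b z) i =
      (\<Sum>k\<in>UNIV. jac M b a i k (trans_map M a b (base_coord z)) * fibre_coord z k)"
proof -
  have img: "base_coord z \<in> img M a" and b: "param M a (base_coord z) \<in> Dom M b"
    using assms overlap_iff[OF M] by auto
  show "base_coord (trans_map (cotangent M) a b z) = trans_map M a b (base_coord z)"
    by (simp add: trans_map_def param_cotangent[OF assms(1) img] Chart_cotangent)
  show "fibre_coord (trans_map (cotangent M) a b z) i =
      (\<Sum>k\<in>UNIV. jac M b a i k (trans_map M a b (base_coord z)) * fibre_coord z k)"
    using b assms(2)
    by (simp add: trans_map_def param_cotangent[OF assms(1) img] Chart_cotangent covector_of_def)
qed

lemma smooth_fibre_trans:
  assumes "a \<in> Idx M" "b \<in> Idx M"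
  shows "smooth_on {z. base_coord z \<in> overlap M a b}
    (\<lambda>z. \<Sum>k\<in>UNIV. jac M b a i k (trans_map M a b (base_coord z)) * fibre_coord z k)"
proof -
  have "smooth_on (overlap M a b) (\<lambda>x. jac M b a i k (trans_map M a b x))" for k
    by (rule smooth_on_compose[OF open_overlap[OF M assms] trans_in_overlap[OF M assms]
          smooth_jac[OF M assms(2,1)] smooth_trans[OF M assms]])
  note jac = smooth_on_base[OF open_overlap[OF M assms] this]
  have op: "open {z. base_coord z \<in> overlap M a b}"
    by (rule open_base_coord_vimage[OF open_overlap[OF M assms]])
  show ?thesis
    by (rule smooth_on_sum[OF op smooth_on_mult[OF op jac smooth_on_fibre_coord]])
qed

lemma smooth_atlas_cotangent: "smooth_atlas (cotangent M)"
  unfolding smooth_atlas_def Idx_cotangent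
proof (intro conjI ballI allI)
  fix a assume a: "a \<in> Idx M"
  show "inj_on (Chart (cotangent M) a) (Dom (cotangent M) a)"
    by (rule inj_on_Chart_cotangent[OF a])
  show "open (img (cotangent M) a)"
    unfolding img_cotangent[OF a] by (intro open_base_coord_vimage open_img M a)
  fix b assume b: "b \<in> Idx M"
  show op: "open (overlap (cotangent M) a b)"
    unfolding overlap_cotangent[OF a] by (intro open_base_coord_vimage open_overlap M a b)
  fix c
  show "smooth_on (overlap (cotangent M) a b) (\<lambda>z. trans_map (cotangent M) a b z $ c)"
  proof (cases c rule: idx4_cases)
    case (base i)
    show ?thesis
      using smooth_on_cong[OF op[unfolded overlap_cotangent[OF a]]
          smooth_on_base[OF open_overlap[OF M a b] smooth_trans[OF M a b, of i]],
          of "\<lambda>z. trans_map (cotangent M) a b z $ c"] base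
        base_trans_cotangent[OF a b]
      unfolding overlap_cotangent[OF a] by (metis base_coord_nth mem_Collect_eq)
  next
    case (fibre i)
    show ?thesis
      using smooth_on_cong[OF op[unfolded overlap_cotangent[OF a]] smooth_fibre_trans[OF a b, of i],
          of "\<lambda>z. trans_map (cotangent M) a b z $ c"] fibre fibre_trans_cotangent[OF a b, of _ i]
      unfolding overlap_cotangent[OF a] fibre_coord_def by auto
  qed
qed

lemma openin_projection_preimage:
  assumes "openin (atlas_topology M) U"
  shows "openin (atlas_topology (cotangent M)) {q \<in> points (cotangent M). fst q \<in> U}"
  unfolding openin_atlas[OF smooth_atlas_cotangent] Idx_cotangent
proof (intro conjI ballI)
  fix a assume a: "a \<in> Idx M"
  have "Chart (cotangent M) a ` (Dom (cotangent M) a \<inter> {q \<in> points (cotangent M). fst q \<in> U})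
      = {z. base_coord z \<in> Chart M a ` (Dom M a \<inter> U)}" (is "?L = ?R")
  proof (intro set_eqI iffI)
    fix z assume "z \<in> ?L"
    then show "z \<in> ?R" by (auto simp: Chart_cotangent Dom_cotangent)
  next
    fix z assume z: "z \<in> ?R"
    then have img: "base_coord z \<in> img M a" and U: "param M a (base_coord z) \<in> U"
      by (auto simp: img_def param_Chart[OF M a])
    then have "z \<in> img (cotangent M) a" using img_cotangent[OF a] by simp
    from param_in_Dom[OF smooth_atlas_cotangent this] Chart_param[OF smooth_atlas_cotangent this]
    have "param (cotangent M) a z \<in> Dom (cotangent M) a \<inter> {q \<in> points (cotangent M). fst q \<in> U}"
      using U a param_cotangent[OF a img] by (auto simp: points_def)
    then show "z \<in> ?L"
      using \<open>Chart (cotangent M) a (param (cotangent M) a z) = z\<close>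
      by (intro image_eqI[of z _ "param (cotangent M) a z"]) simp_all
  qed
  moreover have "open (Chart M a ` (Dom M a \<inter> U))"
    using assms a openin_atlas[OF M] by blast
  ultimately show "open (Chart (cotangent M) a `
      (Dom (cotangent M) a \<inter> {q \<in> points (cotangent M). fst q \<in> U}))"
    using open_base_coord_vimage by simp
qed auto

end

text \<open>
  Two covectors at different points are separated by preimages under the projection, two covectors at the same
  point inside a bundle chart. Countably many bundle charts suffice since countably many charts of \<open>M\<close> do.
\<close>

lemma smooth_manifold_cotangent:
  fixes M :: "('i, 'a, 2) atlas"
  assumes sm: "smooth_manifold M"
  shows "smooth_manifold (cotangent M)"
proof -
  have M: "smooth_atlas M" and H: "Hausdorff_space (atlas_topology M)"
    using sm by (auto simp: smooth_manifold_iff)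
  note C = smooth_atlas_cotangent[OF M]
  have "Hausdorff_space (atlas_topology (cotangent M))"
    unfolding Hausdorff_space_def topspace_atlas[OF C]
  proof (intro allI impI)
    fix q r assume qr: "q \<in> points (cotangent M) \<and> r \<in> points (cotangent M) \<and> q \<noteq> r"
    obtain a b where a: "a \<in> Idx M" "q \<in> Dom (cotangent M) a" and b: "b \<in> Idx M" "r \<in> Dom (cotangent M) b"
      using qr by (auto simp: points_def)
    then have fq: "fst q \<in> Dom M a" and fr: "fst r \<in> Dom M b"
      by (cases q; cases r; simp add: Dom_cotangent)+
    show "\<exists>U V. openin (atlas_topology (cotangent M)) U \<and> openin (atlas_topology (cotangent M)) V
        \<and> q \<in> U \<and> r \<in> V \<and> disjnt U V"
    proof (cases "fst q = fst r")
      case True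
      have ra: "r \<in> Dom (cotangent M) a"
        using True fq b(2) by (cases r) (simp add: Dom_cotangent)
      then have "Chart (cotangent M) a q \<noteq> Chart (cotangent M) a r"
        using a qr inj_on_Chart_cotangent[OF M a(1)] by (auto simp: inj_on_def)
      then obtain U V where UV: "open U" "open V" "Chart (cotangent M) a q \<in> U"
          "Chart (cotangent M) a r \<in> V" "U \<inter> V = {}"
        using hausdorff by metis
      let ?P = "\<lambda>U. {p \<in> Dom (cotangent M) a. Chart (cotangent M) a p \<in> U}"
      have "openin (atlas_topology (cotangent M)) (?P U)" "openin (atlas_topology (cotangent M)) (?P V)"
        using openin_Chart_preimage[OF C, of a] a(1) UV by simp_all
      moreover have "q \<in> ?P U" "r \<in> ?P V" "disjnt (?P U) (?P V)"
        using UV a ra by (auto simp: disjnt_def)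
      ultimately show ?thesis by blast
    next
      case False
      moreover have "fst q \<in> points M" "fst r \<in> points M"
        using fq fr a b by (auto simp: points_def)
      ultimately obtain U V where UV: "openin (atlas_topology M) U" "openin (atlas_topology M) V"
          "fst q \<in> U" "fst r \<in> V" "disjnt U V"
        using H unfolding Hausdorff_space_def topspace_atlas[OF M] by metis
      let ?P = "\<lambda>U. {q \<in> points (cotangent M). fst q \<in> U}"
      have "openin (atlas_topology (cotangent M)) (?P U)" "openin (atlas_topology (cotangent M)) (?P V)"
        using openin_projection_preimage[OF M] UV by blast+
      moreover have "q \<in> ?P U" "r \<in> ?P V" "disjnt (?P U) (?P V)"
        using UV qr by (auto simp: disjnt_def)
      ultimately show ?thesis by blast
    qed
  qed
  moreover have "second_countable (atlas_topology (cotangent M))"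
  proof -
    obtain I where I: "countable I" "I \<subseteq> Idx M" "points M \<subseteq> (\<Union>a\<in>I. Dom M a)"
      using countable_subatlas[OF sm] .
    have "points (cotangent M) \<subseteq> (\<Union>a\<in>I. Dom (cotangent M) a)"
      using I(3) by (fastforce simp: points_def Dom_cotangent)
    then show ?thesis
      using second_countable_atlas[OF C I(1)] I(2) by simp
  qed
  ultimately show ?thesis using C by (simp add: smooth_manifold_iff)
qed

text \<open>
  The inverse of the transformation of the fibre coordinates. Its coefficients are the Jacobian from \<open>a\<close> to
  \<open>b\<close> at the point itself; differentiating this relation avoids derivatives of the inverse Jacobian.
\<close>

lemma fibre_trans_inverse:
  fixes M :: "('i, 'a, 2) atlas"
  assumes M: "smooth_atlas M" and ab: "a \<in> Idx M" "b \<in> Idx M" and z: "base_coord z \<in> overlap M a b"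
  shows
  "fibre_coord z j = (\<Sum>k\<in>UNIV. jac M a b j k (base_coord z) * fibre_coord (trans_map (cotangent M) a b z) k)"
proof -
  let ?J = "\<lambda>j k. jac M a b j k (base_coord z)" and ?K = "\<lambda>k l. jac M b a k l (trans_map M a b (base_coord z))"
  have "(\<Sum>k\<in>UNIV. ?J j k * fibre_coord (trans_map (cotangent M) a b z) k)
      = (\<Sum>k\<in>UNIV. \<Sum>l\<in>UNIV. ?J j k * ?K k l * fibre_coord z l)"
    by (simp add: fibre_trans_cotangent[OF M ab z] sum_distrib_left mult.assoc)
  also have "\<dots> = (\<Sum>l\<in>UNIV. \<Sum>k\<in>UNIV. ?J j k * ?K k l * fibre_coord z l)"
    by (rule sum.swap)
  also have "\<dots> = (\<Sum>l\<in>UNIV. (\<Sum>k\<in>UNIV. ?J j k * ?K k l) * fibre_coord z l)"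
    by (simp only: sum_distrib_right)
  also have "\<dots> = fibre_coord z j"
    by (simp add: jac_inverse[OF M ab z] if_distrib[of "\<lambda>u. u * _"] cong: if_cong)
  finally show ?thesis by simp
qed

context
  fixes M :: "('i, 'a, 2) atlas" and a b :: 'i and z :: "real^4"
  assumes M: "smooth_atlas M" and ab: "a \<in> Idx M" "b \<in> Idx M" and z: "base_coord z \<in> overlap M a b"
begin

lemma jac_cotangent_base:
  "jac (cotangent M) a b (base_idx i) (base_idx k) z = jac M a b i k (base_coord z)"
  "jac (cotangent M) a b (fibre_idx i) (base_idx k) z = 0"
proof -
  have "partial c (\<lambda>z. trans_map (cotangent M) a b z $ base_idx k) z =
      partial c (\<lambda>z. trans_map M a b (base_coord z) $ k) z" for c
    using base_trans_cotangent[OF M ab] z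
    by (intro partial_cong_open[OF open_base_coord_vimage[OF open_overlap[OF M ab]], of z])
      (auto simp flip: base_coord_nth)
  then show "jac (cotangent M) a b (base_idx i) (base_idx k) z = jac M a b i k (base_coord z)"
    "jac (cotangent M) a b (fibre_idx i) (base_idx k) z = 0"
    using partial_base[OF differentiable_trans[OF M ab z]] by (simp_all add: jac_def)
qed

lemma differentiable_fibre_trans:
  "(\<lambda>z. fibre_coord (trans_map (cotangent M) a b z) k) differentiable (at z)"
  unfolding fibre_coord_def
  using differentiable_trans[OF smooth_atlas_cotangent[OF M], of a b z] ab z
  by (simp add: overlap_cotangent[OF M ab(1)])

text \<open>
  Both come from differentiating \<open>fibre_trans_inverse\<close>, in a fibre and in a base direction. The entries of the
  Jacobian are only described after multiplication by the Jacobian of \<open>M\<close>; they enter the transformation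
  law of the metric in this form.
\<close>

lemma jac_cotangent_fibre:
  "(\<Sum>k\<in>UNIV. jac M a b j k (base_coord z) * jac (cotangent M) a b (fibre_idx i) (fibre_idx k) z)
     = (if i = j then 1 else 0)" (is ?th1)
  "(\<Sum>k\<in>UNIV. jac M a b j k (base_coord z) * jac (cotangent M) a b (base_idx i) (fibre_idx k) z)
     = - (\<Sum>k\<in>UNIV. partial i (jac M a b j k) (base_coord z) * fibre_coord (trans_map (cotangent M) a b z) k)"
    (is ?th2)
proof -
  let ?J = "\<lambda>k z. jac M a b j k (base_coord z)" and ?Y = "\<lambda>k z. fibre_coord (trans_map (cotangent M) a b z) k"
  have J: "?J k differentiable (at z)" for k
    by (intro differentiable_base differentiable_jac M ab z)
  have "partial c (\<lambda>z. fibre_coord z j) z = partial c (\<lambda>z. \<Sum>k\<in>UNIV. ?J k z * ?Y k z) z" for c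
    using z
    by (intro partial_cong_open[OF open_base_coord_vimage[OF open_overlap[OF M ab]], of z])
      (auto intro!: fibre_trans_inverse[OF M ab])
  also have "\<dots> c = (\<Sum>k\<in>UNIV. partial c (?J k) z * ?Y k z + ?J k z * partial c (?Y k) z)" for c
    by (simp add: partial_sum partial_mult J differentiable_fibre_trans differentiable_mult)
  also have "\<dots> c = (\<Sum>k\<in>UNIV. partial c (?J k) z * ?Y k z)
      + (\<Sum>k\<in>UNIV. ?J k z * jac (cotangent M) a b c (fibre_idx k) z)" for c
    by (simp add: sum.distrib jac_def fibre_coord_def)
  finally have D: "partial c (\<lambda>z. fibre_coord z j) z = (\<Sum>k\<in>UNIV. partial c (?J k) z * ?Y k z)
      + (\<Sum>k\<in>UNIV. ?J k z * jac (cotangent M) a b c (fibre_idx k) z)" for c .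
  show ?th1
    using D[of "fibre_idx i"]
    by (simp add: partial_fibre_coord partial_base[OF differentiable_jac[OF M ab z]])
  show ?th2
    using D[of "base_idx i"]
    by (simp add: partial_fibre_coord partial_base[OF differentiable_jac[OF M ab z]])
qed

end

lemma local_rep_lift:
  assumes "smooth_atlas M" "a \<in> Idx M" "base_coord z \<in> img M a"
  shows "local_rep (cotangent M) (f \<circ> fst) a z = local_rep M f a (base_coord z)"
  using assms by (simp add: local_rep_def param_cotangent)

lemma smooth_fun_lift:
  fixes M :: "('i, 'a, 2) atlas"
  assumes M: "smooth_atlas M" and f: "smooth_fun M f"
  shows "smooth_fun (cotangent M) (f \<circ> fst)"
  unfolding smooth_fun_def Idx_cotangent
proof
  fix a assume a: "a \<in> Idx M"
  have "smooth_on {z. base_coord z \<in> img M a} (\<lambda>z. local_rep M f a (base_coord z))"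
    using f a by (intro smooth_on_base open_img[OF M a]) (auto simp: smooth_fun_def)
  then show "smooth_on (img (cotangent M) a) (local_rep (cotangent M) (f \<circ> fst) a)"
    unfolding img_cotangent[OF M a]
    by (rule smooth_on_cong[OF open_base_coord_vimage[OF open_img[OF M a]]])
      (simp add: local_rep_lift[OF M a])
qed

lemma differential_lift:
  fixes M :: "('i, 'a, 2) atlas"
  assumes M: "smooth_atlas M" and f: "smooth_fun M f" and a: "a \<in> Idx M" and z: "base_coord z \<in> img M a"
  shows "differential (cotangent M) (f \<circ> fst) a (base_idx i) z = differential M f a i (base_coord z)"
    and "differential (cotangent M) (f \<circ> fst) a (fibre_idx i) z = 0"
proof -
  have "local_rep M f a differentiable (at (base_coord z))"
    using f a z smooth_on_imp_differentiable by (auto simp: smooth_fun_def)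
  moreover have "partial c (local_rep (cotangent M) (f \<circ> fst) a) z
      = partial c (\<lambda>z. local_rep M f a (base_coord z)) z" for c
    by (rule partial_cong_open[OF open_base_coord_vimage[OF open_img[OF M a]], of z])
      (use z local_rep_lift[OF M a] in auto)
  ultimately show "differential (cotangent M) (f \<circ> fst) a (base_idx i) z = differential M f a i (base_coord z)"
    and "differential (cotangent M) (f \<circ> fst) a (fibre_idx i) z = 0"
    by (simp_all add: differential_def partial_base)
qed

section \<open>The Levi-Civita connection\<close>

lemma dir_deriv_coord_field: "dir_deriv (coord_field i) F x = partial i F x"
  by (simp add: dir_deriv_def coord_field_def axis_def if_distrib[of "\<lambda>u. u * _"] cong: if_cong)

lemma cov_deriv_coord_field:
  "cov_deriv G (coord_field i) Y x = (\<chi> k. partial i (\<lambda>z. Y z $ k) x + (\<Sum>j\<in>UNIV. Y x $ j * G i j k x))"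
proof -
  have "(\<Sum>m\<in>UNIV. \<Sum>j\<in>UNIV. axis i 1 $ m * Y x $ j * G m j k x) = (\<Sum>j\<in>UNIV. Y x $ j * G i j k x)" for k
  proof -
    have "(\<Sum>j\<in>UNIV. axis i 1 $ m * Y x $ j * G m j k x) = (if m = i then \<Sum>j\<in>UNIV. Y x $ j * G i j k x else 0)" for m
      by (simp add: axis_def)
    then show ?thesis by simp
  qed
  then show ?thesis
    unfolding cov_deriv_def dir_deriv_coord_field by (simp add: coord_field_def)
qed

lemma cov_deriv_coord_fields: "cov_deriv G (coord_field i) (coord_field j) x = (\<chi> k. G i j k x)"
  by (simp add: cov_deriv_coord_field coord_field_def axis_def if_distrib[of "\<lambda>u. u * _"] cong: if_cong)

lemma smooth_coord_field: "smooth_field_on W (coord_field i)"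
  by (simp add: smooth_field_on_def coord_field_def smooth_on_const)

lemma bracket_coord_fields: "bracket (coord_field i) (coord_field j) = (\<lambda>_. 0)"
  by (simp add: fun_eq_iff bracket_def dir_deriv_coord_field vec_eq_iff) (simp add: coord_field_def)

lemma torsion_free_symmetric:
  assumes "torsion_free M \<Gamma>" "a \<in> Idx M" "x \<in> img M a"
  shows "\<Gamma> a i j k x = \<Gamma> a j i k x"
proof -
  have "cov_deriv (\<Gamma> a) (coord_field i) (coord_field j) x - cov_deriv (\<Gamma> a) (coord_field j) (coord_field i) x = 0"
    using assms smooth_coord_field bracket_coord_fields unfolding torsion_free_def by metis
  then show ?thesis by (simp add: cov_deriv_coord_fields vec_eq_iff)
qed

lemma torsion_freeI:
  assumes "\<And>a x i j k. a \<in> Idx M \<Longrightarrow> x \<in> img M a \<Longrightarrow> \<Gamma> a i j k x = \<Gamma> a j i k x"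
  shows "torsion_free M \<Gamma>"
  unfolding torsion_free_def
proof (intro ballI allI impI)
  fix a X Y x assume a: "a \<in> Idx M" and x: "x \<in> img M a"
  have "(\<Sum>i\<in>UNIV. \<Sum>j\<in>UNIV. X x $ i * Y x $ j * \<Gamma> a i j k x)
      = (\<Sum>i\<in>UNIV. \<Sum>j\<in>UNIV. Y x $ i * X x $ j * \<Gamma> a i j k x)" for k
    by (subst sum.swap) (simp add: assms[OF a x, of _ _ k] mult.commute)
  then show "cov_deriv (\<Gamma> a) X Y x - cov_deriv (\<Gamma> a) Y X x = bracket X Y x"
    by (simp add: vec_eq_iff cov_deriv_def bracket_def)
qed

lemma inner_at_axis: "inner_at g a x (axis i 1) (axis j 1) = g a i j x"
proof -
  have "(\<Sum>l\<in>UNIV. g a k l x * axis i 1 $ k * axis j 1 $ l) = (if k = i then g a i j x else 0)" for k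
    by (simp add: axis_def if_distrib[of "\<lambda>u. u * _"] if_distrib[of "\<lambda>u. _ * u"] cong: if_cong)
  then show ?thesis by (simp add: inner_at_def)
qed

lemma inner_at_add_left: "inner_at g a x (u + v) w = inner_at g a x u w + inner_at g a x v w"
  and inner_at_add_right: "inner_at g a x w (u + v) = inner_at g a x w u + inner_at g a x w v"
  and inner_at_scale_left: "inner_at g a x (c *\<^sub>R u) w = c * inner_at g a x u w"
  and inner_at_scale_right: "inner_at g a x w (c *\<^sub>R u) = c * inner_at g a x w u"
  by (simp_all add: inner_at_def algebra_simps sum.distrib sum_distrib_left)

lemma inner_at_zero [simp]: "inner_at g a x 0 w = 0" "inner_at g a x w 0 = 0"
  by (simp_all add: inner_at_def)

lemma inner_at_sum_left:
  "finite I \<Longrightarrow> inner_at g a x (\<Sum>i\<in>I. c i *\<^sub>R u i) w = (\<Sum>i\<in>I. c i * inner_at g a x (u i) w)"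
  by (induction I rule: finite_induct) (simp_all add: inner_at_add_left inner_at_scale_left)

lemma inner_at_sum_right:
  "finite I \<Longrightarrow> inner_at g a x w (\<Sum>i\<in>I. c i *\<^sub>R u i) = (\<Sum>i\<in>I. c i * inner_at g a x w (u i))"
  by (induction I rule: finite_induct) (simp_all add: inner_at_add_right inner_at_scale_right)

lemma sum_swap_outer_inner:
  fixes f :: "'m::finite \<Rightarrow> 'n::finite \<Rightarrow> 'o::finite \<Rightarrow> 'p::finite \<Rightarrow> real"
  shows "(\<Sum>j\<in>UNIV. \<Sum>k\<in>UNIV. \<Sum>p\<in>UNIV. \<Sum>m\<in>UNIV. f j k p m) =
         (\<Sum>m\<in>UNIV. \<Sum>k\<in>UNIV. \<Sum>p\<in>UNIV. \<Sum>j\<in>UNIV. f j k p m)"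
proof -
  have "(\<Sum>j\<in>UNIV. \<Sum>k\<in>UNIV. \<Sum>p\<in>UNIV. \<Sum>m\<in>UNIV. f j k p m) =
        (\<Sum>k\<in>UNIV. \<Sum>j\<in>UNIV. \<Sum>p\<in>UNIV. \<Sum>m\<in>UNIV. f j k p m)" by (rule sum.swap)
  also have "\<dots> = (\<Sum>k\<in>UNIV. \<Sum>p\<in>UNIV. \<Sum>j\<in>UNIV. \<Sum>m\<in>UNIV. f j k p m)"
    by (intro sum.cong refl sum.swap)
  also have "\<dots> = (\<Sum>k\<in>UNIV. \<Sum>p\<in>UNIV. \<Sum>m\<in>UNIV. \<Sum>j\<in>UNIV. f j k p m)"
    by (intro sum.cong refl sum.swap)
  also have "\<dots> = (\<Sum>k\<in>UNIV. \<Sum>m\<in>UNIV. \<Sum>p\<in>UNIV. \<Sum>j\<in>UNIV. f j k p m)"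
    by (intro sum.cong refl sum.swap)
  also have "\<dots> = (\<Sum>m\<in>UNIV. \<Sum>k\<in>UNIV. \<Sum>p\<in>UNIV. \<Sum>j\<in>UNIV. f j k p m)"
    by (rule sum.swap)
  finally show ?thesis .
qed

text \<open>
  Compatibility of the connection \<open>G\<close> with the metric, evaluated on coordinate fields.
\<close>

definition metric_components ::
  "('i, 'n::finite) tensor2 \<Rightarrow> 'i \<Rightarrow> 'n christoffel \<Rightarrow> real^'n \<Rightarrow> bool" where
  "metric_components g a G x \<longleftrightarrow> (\<forall>i j k. partial i (g a j k) x =
      (\<Sum>m\<in>UNIV. G i j m x * g a m k x) + (\<Sum>m\<in>UNIV. G i k m x * g a j m x))"

text \<open>
  The covariant derivative, in the coordinate direction \<open>i\<close>, of a vector field \<open>U\<close> along the map \<open>y\<close>.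
\<close>

definition cov_along :: "'n::finite christoffel \<Rightarrow> (real^'m::finite \<Rightarrow> real^'n) \<Rightarrow> 'm \<Rightarrow> (real^'m \<Rightarrow> real^'n) \<Rightarrow> real^'m \<Rightarrow> real^'n" where
  "cov_along G y i U x = (\<chi> k. partial i (\<lambda>z. U z $ k) x +
      (\<Sum>p\<in>UNIV. \<Sum>l\<in>UNIV. partial i (\<lambda>z. y z $ p) x * U x $ l * G p l k (y x)))"

text \<open>
  The Leibniz rule along a map. For the identity map it shows that compatibility on coordinate fields implies
  compatibility on all fields; for a transition map it gives the derivative of the pulled back metric.
\<close>

lemma partial_inner_at_along:
  fixes y :: "real^'m::finite \<Rightarrow> real^'n::finite"
  assumes G: "metric_components g a G (y x)"
    and y: "\<And>p. (\<lambda>z. y z $ p) differentiable (at x)"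
    and g: "\<And>j k. g a j k differentiable (at (y x))"
    and U: "\<And>k. (\<lambda>z. U z $ k) differentiable (at x)"
    and V: "\<And>k. (\<lambda>z. V z $ k) differentiable (at x)"
  shows "partial i (\<lambda>z. inner_at g a (y z) (U z) (V z)) x =
     inner_at g a (y x) (cov_along G y i U x) (V x) + inner_at g a (y x) (U x) (cov_along G y i V x)"
proof -
  let ?dy = "\<lambda>p. partial i (\<lambda>z. y z $ p) x" and ?g = "\<lambda>j k. g a j k (y x)"
  let ?u = "\<lambda>j. U x $ j" and ?v = "\<lambda>k. V x $ k"
  let ?du = "\<lambda>j. partial i (\<lambda>z. U z $ j) x" and ?dv = "\<lambda>j. partial i (\<lambda>z. V z $ j) x"
  let ?G = "\<lambda>p j k. G p j k (y x)"
  note gy = differentiable_chain[where G = y, OF g y]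
  have dg: "partial i (\<lambda>z. g a j k (y z)) x =
      (\<Sum>p\<in>UNIV. \<Sum>m\<in>UNIV. ?dy p * (?G p j m * ?g m k)) + (\<Sum>p\<in>UNIV. \<Sum>m\<in>UNIV. ?dy p * (?G p k m * ?g j m))"
    for j k
    using partial_chain[where G = y, OF g[of j k] y, of i] G
    by (simp add: metric_components_def algebra_simps sum.distrib sum_distrib_left)
  have "partial i (\<lambda>z. inner_at g a (y z) (U z) (V z)) x =
     (\<Sum>j\<in>UNIV. \<Sum>k\<in>UNIV. partial i (\<lambda>z. g a j k (y z)) x * ?u j * ?v k + ?g j k * ?du j * ?v k + ?g j k * ?u j * ?dv k)"
    unfolding inner_at_def
    by (simp add: partial_sum partial_mult differentiable_sum differentiable_mult gy U V algebra_simps)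
  also have "\<dots> = (\<Sum>j\<in>UNIV. \<Sum>k\<in>UNIV. \<Sum>p\<in>UNIV. \<Sum>m\<in>UNIV. ?dy p * ?G p j m * ?g m k * ?u j * ?v k)
      + (\<Sum>j\<in>UNIV. \<Sum>k\<in>UNIV. \<Sum>p\<in>UNIV. \<Sum>m\<in>UNIV. ?dy p * ?G p k m * ?g j m * ?u j * ?v k)
      + (\<Sum>j\<in>UNIV. \<Sum>k\<in>UNIV. ?g j k * ?du j * ?v k) + (\<Sum>j\<in>UNIV. \<Sum>k\<in>UNIV. ?g j k * ?u j * ?dv k)"
    by (simp add: dg algebra_simps sum.distrib sum_distrib_left sum_distrib_right)
  also have "(\<Sum>j\<in>UNIV. \<Sum>k\<in>UNIV. \<Sum>p\<in>UNIV. \<Sum>m\<in>UNIV. ?dy p * ?G p j m * ?g m k * ?u j * ?v k)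
      = (\<Sum>j\<in>UNIV. \<Sum>k\<in>UNIV. \<Sum>p\<in>UNIV. \<Sum>l\<in>UNIV. ?g j k * (?dy p * ?u l * ?G p l j) * ?v k)"
    by (subst sum_swap_outer_inner) (simp add: algebra_simps)
  also have "(\<Sum>j\<in>UNIV. \<Sum>k\<in>UNIV. \<Sum>p\<in>UNIV. \<Sum>m\<in>UNIV. ?dy p * ?G p k m * ?g j m * ?u j * ?v k)
      = (\<Sum>j\<in>UNIV. \<Sum>k\<in>UNIV. \<Sum>p\<in>UNIV. \<Sum>l\<in>UNIV. ?g j k * ?u j * (?dy p * ?v l * ?G p l k))"
  proof (rule sum.cong[OF refl])
    fix j
    have "(\<Sum>k\<in>UNIV. \<Sum>p\<in>UNIV. \<Sum>m\<in>UNIV. ?dy p * ?G p k m * ?g j m * ?u j * ?v k)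
        = (\<Sum>m\<in>UNIV. \<Sum>p\<in>UNIV. \<Sum>k\<in>UNIV. ?dy p * ?G p k m * ?g j m * ?u j * ?v k)"
      using sum_swap_outer_inner[of "\<lambda>k (_::unit) p m. ?dy p * ?G p k m * ?g j m * ?u j * ?v k"] by simp
    then show "(\<Sum>k\<in>UNIV. \<Sum>p\<in>UNIV. \<Sum>m\<in>UNIV. ?dy p * ?G p k m * ?g j m * ?u j * ?v k)
        = (\<Sum>k\<in>UNIV. \<Sum>p\<in>UNIV. \<Sum>l\<in>UNIV. ?g j k * ?u j * (?dy p * ?v l * ?G p l k))"
      by (simp add: algebra_simps)
  qed
  finally show ?thesis
    unfolding inner_at_def cov_along_def
    by (simp add: algebra_simps sum.distrib sum_distrib_left sum_distrib_right)
qed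

lemma cov_deriv_eq_sum_cov_along:
  "cov_deriv G X Y x = (\<Sum>i\<in>UNIV. (X x $ i) *\<^sub>R cov_along G (\<lambda>z. z) i Y x)"
proof -
  have "(\<Sum>p\<in>UNIV. \<Sum>l\<in>UNIV. partial i (\<lambda>z. z $ p) x * Y x $ l * G p l k x) = (\<Sum>l\<in>UNIV. Y x $ l * G i l k x)"
    for i k
  proof -
    have "(\<Sum>l\<in>UNIV. partial i (\<lambda>z. z $ p) x * Y x $ l * G p l k x)
        = (if p = i then \<Sum>l\<in>UNIV. Y x $ l * G i l k x else 0)" for p
      by (auto simp: partial_coord)
    then show ?thesis by simp
  qed
  then show ?thesis
    by (simp add: vec_eq_iff cov_deriv_def cov_along_def dir_deriv_def algebra_simps sum.distrib sum_distrib_left)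
qed

lemma metric_connectionI:
  assumes g: "\<And>a j k. a \<in> Idx M \<Longrightarrow> smooth_on (img M a) (g a j k)"
    and comp: "\<And>a x. a \<in> Idx M \<Longrightarrow> x \<in> img M a \<Longrightarrow> metric_components g a (\<Gamma> a) x"
  shows "metric_connection M g \<Gamma>"
  unfolding metric_connection_def
proof (intro ballI allI impI)
  fix a X Y Z x
  assume a: "a \<in> Idx M" and x: "x \<in> img M a"
    and Y: "smooth_field_on (img M a) Y" and Z: "smooth_field_on (img M a) Z"
  have "(\<lambda>z. Y z $ k) differentiable (at x)" "(\<lambda>z. Z z $ k) differentiable (at x)" for k
    using Y Z x smooth_on_imp_differentiable unfolding smooth_field_on_def by blast+
  from partial_inner_at_along[where y = "\<lambda>z. z", OF comp[OF a x] _ _ this]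
  have "partial i (\<lambda>z. inner_at g a z (Y z) (Z z)) x =
     inner_at g a x (cov_along (\<Gamma> a) (\<lambda>z. z) i Y x) (Z x) + inner_at g a x (Y x) (cov_along (\<Gamma> a) (\<lambda>z. z) i Z x)" for i
    using smooth_on_imp_differentiable[OF g[OF a] x]
    by (simp add: bounded_linear_imp_differentiable bounded_linear_vec_nth)
  then show "dir_deriv X (\<lambda>z. inner_at g a z (Y z) (Z z)) x =
      inner_at g a x (cov_deriv (\<Gamma> a) X Y x) (Z x) + inner_at g a x (Y x) (cov_deriv (\<Gamma> a) X Z x)"
    by (simp add: dir_deriv_def cov_deriv_eq_sum_cov_along inner_at_sum_left inner_at_sum_right
        algebra_simps sum.distrib)
qed

lemma metric_connectionD:
  fixes M :: "('i, 'a, 'n::finite) atlas"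
  assumes "metric_connection M g \<Gamma>" "a \<in> Idx M" "x \<in> img M a"
  shows "metric_components g a (\<Gamma> a) x"
  unfolding metric_components_def
proof (intro allI)
  fix i j k
  have axis: "(\<chi> m. G m) = (\<Sum>m\<in>UNIV. (G m) *\<^sub>R axis m (1::real))" for G :: "'n \<Rightarrow> real"
    using basis_expansion[of "\<chi> m. G m"] by (simp add: scalar_mult_eq_scaleR)
  have "dir_deriv (coord_field i) (\<lambda>z. inner_at g a z (coord_field j z) (coord_field k z)) x =
      inner_at g a x (cov_deriv (\<Gamma> a) (coord_field i) (coord_field j) x) (coord_field k x) +
      inner_at g a x (coord_field j x) (cov_deriv (\<Gamma> a) (coord_field i) (coord_field k) x)"
    using assms smooth_coord_field unfolding metric_connection_def by blast
  then show "partial i (g a j k) x = (\<Sum>m\<in>UNIV. \<Gamma> a i j m x * g a m k x) + (\<Sum>m\<in>UNIV. \<Gamma> a i k m x * g a j m x)"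
    by (simp add: dir_deriv_coord_field cov_deriv_coord_fields axis inner_at_sum_left inner_at_sum_right)
      (simp add: coord_field_def inner_at_axis)
qed

text \<open>
  The Christoffel symbols of the first kind.
\<close>

definition koszul :: "('i, 'n::finite) tensor2 \<Rightarrow> 'i \<Rightarrow> 'n \<Rightarrow> 'n \<Rightarrow> 'n \<Rightarrow> real^'n \<Rightarrow> real" where
  "koszul g a i j k x = (partial i (g a j k) x + partial j (g a i k) x - partial k (g a i j) x) / 2"

text \<open>
  The cyclic combination on the right is the classical way to solve \<open>d i j k = S i j k + S i k j\<close>
  for an \<open>S\<close> that is symmetric in its first two indices.
\<close>

lemma koszul_unique:
  assumes "\<And>i j k. S i j k = (S j i k :: real)" "\<And>i j k. d i j k = S i j k + S i k j"
  shows "S i j k = (d i j k + d j i k - d k i j) / 2"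
  using assms(1)[of i j k] assms(1)[of i k j] assms(1)[of j k i]
  by (simp add: assms(2))

definition christoffel :: "('i, 'n::finite) tensor2 \<Rightarrow> 'i \<Rightarrow> 'n christoffel" where
  "christoffel g a i j k x = (\<Sum>l\<in>UNIV. matrix_inv (gram g a x) $ k $ l * koszul g a i j l x)"

lemma sum_delta_right: "(\<Sum>m\<in>UNIV. f m * (if m = k then 1 else 0)) = (f (k::'n::finite) :: real)"
  and sum_delta_right': "(\<Sum>m\<in>UNIV. f m * (if k = m then 1 else 0)) = (f (k::'n::finite) :: real)"
  by (simp_all add: if_distrib[of "\<lambda>u. _ * u"] cong: if_cong)

text \<open>
  Cancellation of a matrix with a left inverse, in terms of coefficients.
\<close>

lemma sum_inverse_cancel:
  fixes A B :: "'n::finite \<Rightarrow> 'n \<Rightarrow> real"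
  assumes "\<And>i k. (\<Sum>m\<in>UNIV. A i m * B m k) = (if i = k then 1 else 0)"
    and "\<And>m. (\<Sum>k\<in>UNIV. B m k * v k) = (\<Sum>k\<in>UNIV. B m k * w k)"
  shows "v i = w i"
proof -
  have "(\<Sum>m\<in>UNIV. A i m * (\<Sum>k\<in>UNIV. B m k * u k)) = u i" for u :: "'n \<Rightarrow> real"
  proof -
    have "(\<Sum>m\<in>UNIV. A i m * (\<Sum>k\<in>UNIV. B m k * u k)) = (\<Sum>m\<in>UNIV. \<Sum>k\<in>UNIV. A i m * B m k * u k)"
      by (simp add: sum_distrib_left mult.assoc)
    also have "\<dots> = (\<Sum>k\<in>UNIV. \<Sum>m\<in>UNIV. A i m * B m k * u k)" by (rule sum.swap)
    also have "\<dots> = (\<Sum>k\<in>UNIV. (\<Sum>m\<in>UNIV. A i m * B m k) * u k)" by (simp only: sum_distrib_right)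
    also have "\<dots> = u i"
      unfolding assms(1) by (simp add: if_distrib[of "\<lambda>u. u * _"] cong: if_cong)
    finally show ?thesis .
  qed
  from this[of v] this[of w] assms(2) show ?thesis by simp
qed

lemma matrix_inv_mult:
  assumes "invertible A"
  shows "A ** matrix_inv A = mat 1 \<and> matrix_inv A ** A = mat 1"
  unfolding matrix_inv_def using assms[unfolded invertible_def] by (rule someI_ex)

lemma gram_inverse:
  assumes "invertible (gram g a x)"
  shows "(\<Sum>m\<in>UNIV. matrix_inv (gram g a x) $ i $ m * g a m k x) = (if i = k then 1 else 0)"
    and "(\<Sum>m\<in>UNIV. g a i m x * matrix_inv (gram g a x) $ m $ k) = (if i = k then 1 else 0)"
  using matrix_inv_mult[OF assms]
  by (simp_all add: matrix_matrix_mult_def gram_def mat_def vec_eq_iff)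

context
  fixes M :: "('i, 'a, 'n::finite) atlas" and g :: "('i, 'n) tensor2"
  assumes pr: "pseudo_riemannian M g"
begin

lemma metric_atlas: "smooth_atlas M"
  using pr by (simp add: pseudo_riemannian_def smooth_manifold_iff)

lemma metric_smooth: "a \<in> Idx M \<Longrightarrow> smooth_on (img M a) (g a i j)"
  and metric_sym: "a \<in> Idx M \<Longrightarrow> x \<in> img M a \<Longrightarrow> g a i j x = g a j i x"
  and metric_invertible: "a \<in> Idx M \<Longrightarrow> x \<in> img M a \<Longrightarrow> invertible (gram g a x)"
  and metric_trans: "a \<in> Idx M \<Longrightarrow> b \<in> Idx M \<Longrightarrow> x \<in> overlap M a b \<Longrightarrow>
     g a i j x = (\<Sum>k\<in>UNIV. \<Sum>l\<in>UNIV. jac M a b i k x * jac M a b j l x * g b k l (trans_map M a b x))"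
  using pr unfolding pseudo_riemannian_def sym_tensor02_def by blast+

lemma partial_metric_sym:
  assumes "a \<in> Idx M" "x \<in> img M a"
  shows "partial k (g a i j) x = partial k (g a j i) x"
  using metric_sym[OF assms(1)] partial_cong_open[OF open_img[OF metric_atlas assms(1)] assms(2)] by blast

lemma koszul_symmetric: "a \<in> Idx M \<Longrightarrow> x \<in> img M a \<Longrightarrow> koszul g a i j k x = koszul g a j i k x"
  using partial_metric_sym[of a x k i j] by (simp add: koszul_def)

lemma lowered_connection_eq_koszul:
  assumes "a \<in> Idx M" "x \<in> img M a"
    and "metric_components g a G x" "\<And>i j k. G i j k x = G j i k x"
  shows "(\<Sum>m\<in>UNIV. G i j m x * g a m k x) = koszul g a i j k x"
  unfolding koszul_def
proof (rule koszul_unique[where S = "\<lambda>i j k. \<Sum>m\<in>UNIV. G i j m x * g a m k x"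
      and d = "\<lambda>i j k. partial i (g a j k) x"])
  show "partial i (g a j k) x = (\<Sum>m\<in>UNIV. G i j m x * g a m k x) + (\<Sum>m\<in>UNIV. G i k m x * g a m j x)" for i j k
    using assms(3) metric_sym[OF assms(1,2), of j] by (simp add: metric_components_def)
qed (simp add: assms(4))

lemma lowered_christoffel:
  assumes "a \<in> Idx M" "x \<in> img M a"
  shows "(\<Sum>m\<in>UNIV. christoffel g a i j m x * g a m k x) = koszul g a i j k x"
proof -
  let ?h = "matrix_inv (gram g a x)"
  have "(\<Sum>m\<in>UNIV. christoffel g a i j m x * g a m k x) =
      (\<Sum>m\<in>UNIV. \<Sum>l\<in>UNIV. g a k m x * ?h $ m $ l * koszul g a i j l x)"
    unfolding christoffel_def by (simp add: sum_distrib_right sum_distrib_left metric_sym[OF assms, of k] algebra_simps)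
  also have "\<dots> = (\<Sum>l\<in>UNIV. (\<Sum>m\<in>UNIV. g a k m x * ?h $ m $ l) * koszul g a i j l x)"
    by (subst sum.swap) (simp only: sum_distrib_right)
  also have "\<dots> = koszul g a i j k x"
    by (simp add: gram_inverse[OF metric_invertible[OF assms]] if_distrib[of "\<lambda>u. u * _"] cong: if_cong)
  finally show ?thesis .
qed

text \<open>
  A torsion-free metric connection has the lowered components \<open>koszul\<close>, and the metric is invertible.
\<close>

lemma levi_civita_components:
  assumes lc: "is_levi_civita M g \<Gamma>" and ax: "a \<in> Idx M" "x \<in> img M a"
  shows "\<Gamma> a i j k x = christoffel g a i j k x"
proof (rule sum_inverse_cancel[where v = "\<lambda>k. \<Gamma> a i j k x" and w = "\<lambda>k. christoffel g a i j k x"])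
  show "(\<Sum>m\<in>UNIV. matrix_inv (gram g a x) $ i $ m * g a m k x) = (if i = k then 1 else 0)" for i k
    by (rule gram_inverse[OF metric_invertible[OF ax]])
  fix m
  have "(\<Sum>k\<in>UNIV. \<Gamma> a i j k x * g a k m x) = koszul g a i j m x"
    using lc torsion_free_symmetric metric_connectionD ax
    by (intro lowered_connection_eq_koszul[OF ax]) (auto simp: is_levi_civita_def)
  with lowered_christoffel[OF ax, of i j m]
  show "(\<Sum>k\<in>UNIV. g a m k x * \<Gamma> a i j k x) = (\<Sum>k\<in>UNIV. g a m k x * christoffel g a i j k x)"
    by (simp add: metric_sym[OF ax, of m] mult.commute)
qed

lemma metric_components_christoffel:
  assumes "a \<in> Idx M" "x \<in> img M a"
  shows "metric_components g a (christoffel g a) x"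
  unfolding metric_components_def
proof (intro allI)
  fix i j k
  have "(\<Sum>m\<in>UNIV. christoffel g a i k m x * g a j m x) = koszul g a i k j x"
    using lowered_christoffel[OF assms, of i k j] metric_sym[OF assms, of j] by simp
  then show "partial i (g a j k) x = (\<Sum>m\<in>UNIV. christoffel g a i j m x * g a m k x)
      + (\<Sum>m\<in>UNIV. christoffel g a i k m x * g a j m x)"
    unfolding lowered_christoffel[OF assms]
    using partial_metric_sym[OF assms, of i j k] by (simp add: koszul_def field_simps)
qed

text \<open>
  The vectors \<open>E i j\<close> are the covariant derivatives, for the connection of the chart \<open>b\<close>, of the coordinate
  fields of the chart \<open>a\<close>. They are symmetric and satisfy the Leibniz rule with the metric of \<open>a\<close>, so by
  \<open>koszul_unique\<close> their inner products with the coordinate fields are the Christoffel symbols of the first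
  kind in the chart \<open>a\<close>. Raising the index gives the transformation law.
\<close>

lemma christoffel_trans:
  assumes a: "a \<in> Idx M" and b: "b \<in> Idx M" and x: "x \<in> overlap M a b"
  shows "(\<Sum>k\<in>UNIV. christoffel g a i j k x * jac M a b k r x) = partial i (jac M a b j r) x +
        (\<Sum>k\<in>UNIV. \<Sum>l\<in>UNIV. jac M a b i k x * jac M a b j l x * christoffel g b k l r (trans_map M a b x))"
proof -
  note at = metric_atlas
  define y where "y = trans_map M a b x"
  define J where "J j z = (\<chi> k. jac M a b j k z)" for j z
  define E where "E i j = cov_along (christoffel g b) (trans_map M a b) i (J j) x" for i j
  have xa: "x \<in> img M a" and yb: "y \<in> img M b"
    using x overlap_subset_img[OF at] trans_in_img[OF at a b x] by (auto simp: y_def)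
  have ga: "g a j k z = inner_at g b (trans_map M a b z) (J j z) (J k z)" if "z \<in> overlap M a b" for j k z
    using metric_trans[OF a b that, of j k] by (simp add: inner_at_def J_def algebra_simps)
  have E_nth: "E i j $ m = partial i (jac M a b j m) x +
      (\<Sum>k\<in>UNIV. \<Sum>l\<in>UNIV. jac M a b i k x * jac M a b j l x * christoffel g b k l m y)" for i j m
    by (simp add: E_def cov_along_def J_def y_def partial_trans[OF at])
  have chr_sym: "christoffel g b k l m y = christoffel g b l k m y" for k l m
    by (simp add: christoffel_def koszul_symmetric[OF b yb, of k l])
  have E_sym: "E i j = E j i" for i j
  proof -
    have "(\<Sum>k\<in>UNIV. \<Sum>l\<in>UNIV. jac M a b i k x * jac M a b j l x * christoffel g b k l m y)
      = (\<Sum>k\<in>UNIV. \<Sum>l\<in>UNIV. jac M a b j k x * jac M a b i l x * christoffel g b k l m y)" for m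
      by (subst sum.swap) (simp add: chr_sym[of _ _ m] mult.commute)
    then show ?thesis by (simp add: vec_eq_iff E_nth partial_jac_commute[OF at a b x, of i])
  qed
  have sym_y: "inner_at g b y u v = inner_at g b y v u" for u v
    unfolding inner_at_def by (subst sum.swap) (simp add: metric_sym[OF b yb, of _ _] algebra_simps)
  have dg: "partial i (g a j k) x = inner_at g b y (E i j) (J k x) + inner_at g b y (E i k) (J j x)" for i j k
  proof -
    have "partial i (g a j k) x = partial i (\<lambda>z. inner_at g b (trans_map M a b z) (J j z) (J k z)) x"
      by (rule partial_cong_open[OF open_overlap[OF at a b] x ga])
    also have "\<dots> = inner_at g b y (E i j) (J k x) + inner_at g b y (J j x) (E i k)"
      unfolding E_def y_def
    proof (rule partial_inner_at_along)
      show "metric_components g b (christoffel g b) (trans_map M a b x)"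
        using metric_components_christoffel[OF b yb] by (simp add: y_def)
      show "(\<lambda>z. trans_map M a b z $ p) differentiable (at x)" for p
        by (rule differentiable_trans[OF at a b x])
      show "g b j k differentiable (at (trans_map M a b x))" for j k
        using smooth_on_imp_differentiable[OF metric_smooth[OF b] yb] by (simp add: y_def)
      show "(\<lambda>z. J j z $ k) differentiable (at x)" for j k
        using differentiable_jac[OF at a b x] by (simp add: J_def)
      show "(\<lambda>z. J j z $ k) differentiable (at x)" for j k
        using differentiable_jac[OF at a b x] by (simp add: J_def)
    qed
    finally show ?thesis by (simp only: sym_y)
  qed
  have low: "inner_at g b y (E i j) (J k x) = koszul g a i j k x" for k
    unfolding koszul_def
    by (rule koszul_unique[where S = "\<lambda>i j k. inner_at g b y (E i j) (J k x)"]) (simp_all add: E_sym dg)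
  have "(\<Sum>k\<in>UNIV. christoffel g a i j k x * jac M a b k r x) = E i j $ r"
  proof (rule sum_inverse_cancel[where v = "\<lambda>r. \<Sum>k\<in>UNIV. christoffel g a i j k x * jac M a b k r x"
        and w = "\<lambda>r. E i j $ r"])
    show "(\<Sum>m\<in>UNIV. matrix_inv (gram g b y) $ i $ m * g b m k y) = (if i = k then 1 else 0)" for i k
      by (rule gram_inverse[OF metric_invertible[OF b yb]])
    fix s
    define C where "C = (\<Sum>k\<in>UNIV. christoffel g a i j k x *\<^sub>R J k x)"
    have C_nth: "C $ r = (\<Sum>k\<in>UNIV. christoffel g a i j k x * jac M a b k r x)" for r
      by (simp add: C_def J_def)
    have flat: "inner_at g b y u (J k x) = (\<Sum>s\<in>UNIV. jac M a b k s x * (\<Sum>r\<in>UNIV. g b s r y * u $ r))" for u k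
      unfolding inner_at_def
      by (subst sum.swap) (simp add: sum_distrib_left metric_sym[OF b yb] J_def algebra_simps)
    have "inner_at g b y C (J k x) = inner_at g b y (E i j) (J k x)" for k
    proof -
      have "inner_at g b y C (J k x) = (\<Sum>m\<in>UNIV. christoffel g a i j m x * g a m k x)"
        by (simp add: C_def inner_at_sum_left ga[OF x] y_def)
      then show ?thesis by (simp add: lowered_christoffel[OF a xa] low)
    qed
    then have eq: "(\<Sum>t\<in>UNIV. jac M a b k t x * (\<Sum>r\<in>UNIV. g b t r y * C $ r)) =
        (\<Sum>t\<in>UNIV. jac M a b k t x * (\<Sum>r\<in>UNIV. g b t r y * E i j $ r))" for k
      unfolding flat .
    have "(\<Sum>r\<in>UNIV. g b s r y * C $ r) = (\<Sum>r\<in>UNIV. g b s r y * E i j $ r)"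
      by (rule sum_inverse_cancel[where A = "\<lambda>i k. jac M b a i k y" and B = "\<lambda>i k. jac M a b i k x"
            and v = "\<lambda>t. \<Sum>r\<in>UNIV. g b t r y * C $ r" and w = "\<lambda>t. \<Sum>r\<in>UNIV. g b t r y * E i j $ r",
            OF jac_inverse'[OF at a b x, folded y_def] eq])
    then show "(\<Sum>r\<in>UNIV. g b s r y * (\<Sum>k\<in>UNIV. christoffel g a i j k x * jac M a b k r x)) =
        (\<Sum>r\<in>UNIV. g b s r y * E i j $ r)"
      by (simp add: C_nth)
  qed
  then show ?thesis by (simp add: E_nth y_def)
qed

lemma is_levi_civita_christoffel:
  assumes "\<And>a k l. a \<in> Idx M \<Longrightarrow> smooth_on (img M a) (\<lambda>x. matrix_inv (gram g a x) $ k $ l)"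
  shows "is_levi_civita M g (christoffel g)"
  unfolding is_levi_civita_def
proof (intro conjI)
  show "connection M (christoffel g)"
    unfolding connection_def
  proof (intro conjI ballI allI)
    fix a i j k assume a: "a \<in> Idx M"
    note op = open_img[OF metric_atlas a]
    have "smooth_on (img M a) (koszul g a i j l)" for l
      unfolding koszul_def
      by (intro smooth_on_divide_const smooth_on_diff smooth_on_add smooth_on_partial op metric_smooth a)
    then have "smooth_on (img M a) (\<lambda>x. \<Sum>l\<in>UNIV. matrix_inv (gram g a x) $ k $ l * koszul g a i j l x)"
      by (intro smooth_on_sum smooth_on_mult op assms a)
    then show "smooth_on (img M a) (christoffel g a i j k)"
      unfolding christoffel_def[abs_def] .
  qed (rule christoffel_trans)
  show "torsion_free M (christoffel g)"
    by (rule torsion_freeI) (simp add: christoffel_def koszul_symmetric)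
  show "metric_connection M g (christoffel g)"
    by (intro metric_connectionI metric_smooth metric_components_christoffel)
qed

text \<open>
  The choice in \<open>levi_civita\<close> is among connections that all have these components, and there is one.
\<close>

lemma levi_civita_eq_christoffel:
  assumes "\<And>a k l. a \<in> Idx M \<Longrightarrow> smooth_on (img M a) (\<lambda>x. matrix_inv (gram g a x) $ k $ l)"
    and "a \<in> Idx M" "x \<in> img M a"
  shows "levi_civita M g a i j k x = christoffel g a i j k x"
proof -
  have "is_levi_civita M g (levi_civita M g)"
    unfolding levi_civita_def 
    by (rule someI[where P = "is_levi_civita M g", OF is_levi_civita_christoffel]) (rule assms(1))
  from levi_civita_components[OF this assms(2,3)] show ?thesis .
qed

end

section \<open>Curvature and Hessian in coordinates\<close>

text \<open>
  The components of \<open>R(\<partial>\<^sub>i, \<partial>\<^sub>j) \<partial>\<^sub>k\<close>, in the sign convention of \<open>curvature_op\<close>.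
\<close>

definition curvature_comp :: "'n::finite christoffel \<Rightarrow> 'n \<Rightarrow> 'n \<Rightarrow> 'n \<Rightarrow> 'n \<Rightarrow> real^'n \<Rightarrow> real" where
  "curvature_comp G i j k l x = partial j (G i k l) x - partial i (G j k l) x +
     (\<Sum>m\<in>UNIV. G i k m x * G j m l x) - (\<Sum>m\<in>UNIV. G j k m x * G i m l x)"

lemma curvature_op_coord_fields:
  "curvature_op G (coord_field i) (coord_field j) (coord_field k) x $ l = curvature_comp G i j k l x"
proof -
  have "cov_deriv G (bracket (coord_field i) (coord_field j)) (coord_field k) x = 0"
    by (simp add: bracket_coord_fields cov_deriv_def dir_deriv_def vec_eq_iff)
  moreover have "cov_deriv G (coord_field i) (cov_deriv G (coord_field j) (coord_field k)) x $ l =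
      partial i (G j k l) x + (\<Sum>m\<in>UNIV. G j k m x * G i m l x)" for i j
    by (simp add: cov_deriv_coord_field[of G i] cov_deriv_coord_fields)
  ultimately show ?thesis by (simp add: curvature_op_def curvature_comp_def)
qed

lemma ricci_eq: "ricci \<Gamma> a i j x = (\<Sum>k\<in>UNIV. curvature_comp (\<Gamma> a) i k j k x)"
  by (simp add: ricci_def ricci_op_def curvature_op_coord_fields)

lemma hessian_eq:
  fixes M :: "('i, 'a, 'n::finite) atlas"
  shows
  "hessian M \<Gamma> f a i j x = partial i (differential M f a j) x - (\<Sum>k\<in>UNIV. \<Gamma> a i j k x * differential M f a k x)"
proof -
  have "dir_deriv (coord_field j) F = partial j F" for F :: "real^'n \<Rightarrow> real"
    by (simp add: fun_eq_iff dir_deriv_coord_field)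
  then show ?thesis
    by (simp add: hessian_def hessian_op_def dir_deriv_coord_field dir_deriv_def[of "cov_deriv _ _ _"]
        cov_deriv_coord_fields differential_def)
qed


section \<open>The Hessian and the Ricci tensor are tensors\<close>

lemma sum_bilinear:
  fixes a :: "'p::finite \<Rightarrow> real" and b :: "'q::finite \<Rightarrow> real" and f :: "'p \<Rightarrow> 's::finite \<Rightarrow> real"
  shows "(\<Sum>s\<in>UNIV. (\<Sum>p\<in>UNIV. a p * f p s) * (\<Sum>q\<in>UNIV. b q * h q s)) =
    (\<Sum>p\<in>UNIV. \<Sum>q\<in>UNIV. a p * b q * (\<Sum>s\<in>UNIV. f p s * h q s))"
proof -
  have "(\<Sum>s\<in>UNIV. (\<Sum>p\<in>UNIV. a p * f p s) * (\<Sum>q\<in>UNIV. b q * h q s)) =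
      (\<Sum>s\<in>UNIV. \<Sum>p\<in>UNIV. \<Sum>q\<in>UNIV. a p * b q * (f p s * h q s))"
    by (simp add: sum_product algebra_simps)
  also have "\<dots> = (\<Sum>p\<in>UNIV. \<Sum>s\<in>UNIV. \<Sum>q\<in>UNIV. a p * b q * (f p s * h q s))"
    by (rule sum.swap)
  also have "\<dots> = (\<Sum>p\<in>UNIV. \<Sum>q\<in>UNIV. \<Sum>s\<in>UNIV. a p * b q * (f p s * h q s))"
    by (intro sum.cong refl sum.swap)
  finally show ?thesis by (simp only: sum_distrib_left)
qed

context
  fixes M :: "('i, 'a, 'n::finite) atlas" and \<Gamma> :: "'i \<Rightarrow> 'n christoffel"
  assumes M: "smooth_atlas M" and conn: "connection M \<Gamma>"
begin

lemma smooth_connection: "a \<in> Idx M \<Longrightarrow> smooth_on (img M a) (\<Gamma> a i j k)"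
  using conn by (simp add: connection_def)

lemma connection_trans:
  assumes "a \<in> Idx M" "b \<in> Idx M" "x \<in> overlap M a b"
  shows "(\<Sum>k\<in>UNIV. \<Gamma> a i j k x * jac M a b k r x) = partial i (jac M a b j r) x +
        (\<Sum>k\<in>UNIV. \<Sum>l\<in>UNIV. jac M a b i k x * jac M a b j l x * \<Gamma> b k l r (trans_map M a b x))"
  using conn assms by (simp add: connection_def)

lemma smooth_differential:
  assumes "smooth_fun M f" "a \<in> Idx M"
  shows "smooth_on (img M a) (differential M f a i)"
  using assms unfolding differential_def smooth_fun_def by (intro smooth_on_partial) auto

text \<open>
  The second derivatives of the transition map, which arise from \<open>\<partial>\<^sub>i \<partial>\<^sub>j f\<close>, cancel against the
  inhomogeneous term of the transformation law of the connection.
\<close>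

lemma hessian_trans:
  assumes a: "a \<in> Idx M" and b: "b \<in> Idx M" and x: "x \<in> overlap M a b" and f: "smooth_fun M f"
  shows "hessian M \<Gamma> f a i j x = (\<Sum>k\<in>UNIV. \<Sum>l\<in>UNIV.
    jac M a b i k x * jac M a b j l x * hessian M \<Gamma> f b k l (trans_map M a b x))"
proof -
  let ?J = "\<lambda>i k. jac M a b i k x" and ?y = "trans_map M a b x"
  let ?d = "\<lambda>k. differential M f b k"
  have y: "?y \<in> img M b" by (rule trans_in_img[OF M a b x])
  have dd: "?d k differentiable (at ?y)" for k
    using smooth_on_imp_differentiable[OF smooth_differential[OF f b] y] .
  note dy = differentiable_chain[where G = "trans_map M a b", OF dd differentiable_trans[OF M a b x]]
  have "partial i (differential M f a j) x =
      partial i (\<lambda>z. \<Sum>l\<in>UNIV. jac M a b j l z * ?d l (trans_map M a b z)) x"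
    by (rule partial_cong_open[OF open_overlap[OF M a b] x]) (rule differential_trans[OF M a b _ f])
  also have "\<dots> = (\<Sum>l\<in>UNIV. partial i (jac M a b j l) x * ?d l ?y
      + ?J j l * (\<Sum>k\<in>UNIV. ?J i k * partial k (?d l) ?y))"
    by (simp add: partial_sum partial_mult differentiable_mult differentiable_jac[OF M a b x] dy
        partial_pullback[OF M a b x dd])
  finally have 1: "partial i (differential M f a j) x = (\<Sum>l\<in>UNIV. partial i (jac M a b j l) x * ?d l ?y)
      + (\<Sum>l\<in>UNIV. \<Sum>k\<in>UNIV. ?J i k * ?J j l * partial k (?d l) ?y)"
    by (simp add: sum.distrib sum_distrib_left algebra_simps)
  have "(\<Sum>m\<in>UNIV. \<Gamma> a i j m x * differential M f a m x)
      = (\<Sum>m\<in>UNIV. \<Sum>r\<in>UNIV. \<Gamma> a i j m x * ?J m r * ?d r ?y)"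
    by (simp add: differential_trans[OF M a b x f] sum_distrib_left mult.assoc)
  also have "\<dots> = (\<Sum>r\<in>UNIV. (\<Sum>m\<in>UNIV. \<Gamma> a i j m x * ?J m r) * ?d r ?y)"
    by (subst sum.swap) (simp only: sum_distrib_right)
  also have "\<dots> = (\<Sum>r\<in>UNIV. partial i (jac M a b j r) x * ?d r ?y) +
      (\<Sum>r\<in>UNIV. \<Sum>k\<in>UNIV. \<Sum>l\<in>UNIV. ?J i k * ?J j l * \<Gamma> b k l r ?y * ?d r ?y)"
    by (simp add: connection_trans[OF a b x] distrib_right sum.distrib sum_distrib_right)
  also have "(\<Sum>r\<in>UNIV. \<Sum>k\<in>UNIV. \<Sum>l\<in>UNIV. ?J i k * ?J j l * \<Gamma> b k l r ?y * ?d r ?y)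
      = (\<Sum>k\<in>UNIV. \<Sum>l\<in>UNIV. \<Sum>r\<in>UNIV. ?J i k * ?J j l * \<Gamma> b k l r ?y * ?d r ?y)"
    by (subst sum.swap) (intro sum.cong refl sum.swap)
  finally have 2: "(\<Sum>m\<in>UNIV. \<Gamma> a i j m x * differential M f a m x) =
      (\<Sum>r\<in>UNIV. partial i (jac M a b j r) x * ?d r ?y) +
      (\<Sum>k\<in>UNIV. \<Sum>l\<in>UNIV. \<Sum>r\<in>UNIV. ?J i k * ?J j l * \<Gamma> b k l r ?y * ?d r ?y)" .
  have 3: "(\<Sum>l\<in>UNIV. \<Sum>k\<in>UNIV. ?J i k * ?J j l * partial k (?d l) ?y)
      = (\<Sum>k\<in>UNIV. \<Sum>l\<in>UNIV. ?J i k * ?J j l * partial k (?d l) ?y)"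
    by (rule sum.swap)
  show ?thesis
    unfolding hessian_eq 1 2 3
    by (simp add: right_diff_distrib sum_subtractf sum_distrib_left mult.assoc)
qed

text \<open>
  Let \<open>\<omega>\<close> be the connection matrix of the chart \<open>b\<close>, pulled back to the chart \<open>a\<close>. The transformation law
  then reads \<open>\<Gamma> J = dJ + \<omega> J\<close>. Differentiate it, replace the derivatives of \<open>J\<close> by the law itself, and
  antisymmetrize: the second derivatives of \<open>J\<close> and the terms \<open>X\<close> that mix \<open>\<Gamma>\<close> and \<open>\<omega>\<close> drop out, and what
  remains is the curvature of \<open>\<Gamma>\<close> on one side and that of \<open>\<omega>\<close> on the other.
\<close>

lemma curvature_trans:
  assumes a: "a \<in> Idx M" and b: "b \<in> Idx M" and x: "x \<in> overlap M a b"
  shows "(\<Sum>k\<in>UNIV. curvature_comp (\<Gamma> a) i m j k x * jac M a b k r x) =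
    (\<Sum>l\<in>UNIV. jac M a b j l x * (\<Sum>p\<in>UNIV. \<Sum>q\<in>UNIV. jac M a b i p x * jac M a b m q x *
       curvature_comp (\<Gamma> b) p q l r (trans_map M a b x)))"
proof -
  define y where "y = trans_map M a b"
  define W where "W = overlap M a b"
  let ?J = "jac M a b"
  define \<omega> where "\<omega> i l k z = (\<Sum>p\<in>UNIV. ?J i p z * \<Gamma> b p l k (y z))" for i l k z
  have W: "open W" "x \<in> W" using open_overlap[OF M a b] x by (simp_all add: W_def)
  have xa: "x \<in> img M a" and yb: "y x \<in> img M b"
    using x overlap_subset_img[OF M] trans_in_img[OF M a b x] by (auto simp: y_def)
  have dJ: "?J i k differentiable (at x)" for i k by (rule differentiable_jac[OF M a b x])
  have dGb: "\<Gamma> b i j k differentiable (at (y x))" for i j k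
    using smooth_on_imp_differentiable[OF smooth_connection[OF b] yb] .
  have dGby: "(\<lambda>z. \<Gamma> b i j k (y z)) differentiable (at x)" for i j k
    unfolding y_def
    by (rule differentiable_chain[where G = "trans_map M a b", OF dGb[unfolded y_def] differentiable_trans[OF M a b x]])
  have dGa: "\<Gamma> a i j k differentiable (at x)" for i j k
    using smooth_on_imp_differentiable[OF smooth_connection[OF a] xa] .
  have d\<omega>: "\<omega> i l k differentiable (at x)" for i l k
    unfolding \<omega>_def[abs_def] by (simp add: differentiable_sum differentiable_mult dJ dGby)
  have ddJ: "partial i (?J j k) differentiable (at x)" for i j k
    using smooth_on_imp_differentiable[OF smooth_on_partial[OF smooth_jac[OF M a b]] x] .
  have law: "(\<Sum>k\<in>UNIV. \<Gamma> a i j k z * ?J k r z) = partial i (?J j r) z + (\<Sum>l\<in>UNIV. \<omega> i l r z * ?J j l z)"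
    if "z \<in> W" for i j r z
  proof -
    have "(\<Sum>k\<in>UNIV. \<Sum>l\<in>UNIV. ?J i k z * ?J j l z * \<Gamma> b k l r (trans_map M a b z))
        = (\<Sum>l\<in>UNIV. \<omega> i l r z * ?J j l z)"
      by (subst sum.swap) (simp add: \<omega>_def y_def sum_distrib_left algebra_simps)
    then show ?thesis using connection_trans[OF a b, of z i j r] that by (simp add: W_def)
  qed
  \<comment> \<open>The four kinds of terms after one differentiation: apart from \<open>J\<close>, \<open>A\<close> involves just \<open>\<Gamma>\<close>, and \<open>B\<close> and \<open>Y\<close> just \<open>\<omega>\<close>.\<close>
  define X where "X m i = (\<Sum>l\<in>UNIV. \<Sum>s\<in>UNIV. \<omega> i l r x * \<Gamma> a m j s x * ?J s l x)" for m i
  define A where "A m i = (\<Sum>k\<in>UNIV. partial m (\<Gamma> a i j k) x * ?J k r x)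
      + (\<Sum>k\<in>UNIV. \<Sum>s\<in>UNIV. \<Gamma> a i j k x * \<Gamma> a m k s x * ?J s r x)" for m i
  define B where "B m i = (\<Sum>l\<in>UNIV. partial m (\<omega> i l r) x * ?J j l x)" for m i
  define Y where "Y m i = (\<Sum>l\<in>UNIV. \<Sum>q\<in>UNIV. \<omega> i l r x * \<omega> m q l x * ?J j q x)" for m i
  have lawx: "partial m (?J k r) x = (\<Sum>s\<in>UNIV. \<Gamma> a m k s x * ?J s r x) - (\<Sum>l\<in>UNIV. \<omega> m l r x * ?J k l x)" for m k r
    using law[OF W(2), of m k r] by simp
  have key: "A m i - X i m = partial m (partial i (?J j r)) x + B m i + X m i - Y m i" for m i
  proof -
    have "partial m (\<lambda>z. \<Sum>k\<in>UNIV. \<Gamma> a i j k z * ?J k r z) x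
        = partial m (\<lambda>z. partial i (?J j r) z + (\<Sum>l\<in>UNIV. \<omega> i l r z * ?J j l z)) x"
      by (rule partial_cong_open[OF W law])
    then have "(\<Sum>k\<in>UNIV. partial m (\<Gamma> a i j k) x * ?J k r x + \<Gamma> a i j k x * partial m (?J k r) x)
        = partial m (partial i (?J j r)) x + (\<Sum>l\<in>UNIV. partial m (\<omega> i l r) x * ?J j l x + \<omega> i l r x * partial m (?J j l) x)"
      by (simp add: partial_sum partial_mult partial_add differentiable_mult differentiable_sum dJ dGa d\<omega> ddJ)
    moreover have "(\<Sum>k\<in>UNIV. partial m (\<Gamma> a i j k) x * ?J k r x + \<Gamma> a i j k x * partial m (?J k r) x)
        = A m i - (\<Sum>k\<in>UNIV. \<Sum>l\<in>UNIV. \<omega> m l r x * \<Gamma> a i j k x * ?J k l x)"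
      by (simp add: lawx A_def right_diff_distrib sum.distrib sum_subtractf sum_distrib_left algebra_simps)
    moreover have "(\<Sum>k\<in>UNIV. \<Sum>l\<in>UNIV. \<omega> m l r x * \<Gamma> a i j k x * ?J k l x) = X i m"
      unfolding X_def by (rule sum.swap)
    moreover have "(\<Sum>l\<in>UNIV. partial m (\<omega> i l r) x * ?J j l x + \<omega> i l r x * partial m (?J j l) x)
        = B m i + X m i - Y m i"
      by (simp add: lawx B_def X_def Y_def right_diff_distrib sum.distrib sum_subtractf sum_distrib_left algebra_simps)
    ultimately show ?thesis by simp
  qed
  have "partial m (partial i (?J j r)) x = partial i (partial m (?J j r)) x"
    by (rule partial_commute[OF open_overlap[OF M a b] x smooth_jac[OF M a b]])
  with key[of m i] key[of i m] have "A m i - A i m = B m i - B i m + Y i m - Y m i" by simp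
  moreover have "A m i - A i m = (\<Sum>k\<in>UNIV. curvature_comp (\<Gamma> a) i m j k x * ?J k r x)"
  proof -
    have "(\<Sum>k\<in>UNIV. \<Sum>s\<in>UNIV. \<Gamma> a i j k x * \<Gamma> a m k s x * ?J s r x)
        = (\<Sum>s\<in>UNIV. (\<Sum>k\<in>UNIV. \<Gamma> a i j k x * \<Gamma> a m k s x) * ?J s r x)" for m i
      by (subst sum.swap) (simp only: sum_distrib_right)
    then show ?thesis
      by (simp add: A_def curvature_comp_def left_diff_distrib distrib_right sum.distrib sum_subtractf)
  qed
  moreover have "B m i - B i m + Y i m - Y m i = (\<Sum>l\<in>UNIV. ?J j l x * (partial m (\<omega> i l r) x - partial i (\<omega> m l r) x
      + (\<Sum>s\<in>UNIV. \<omega> i l s x * \<omega> m s r x) - (\<Sum>s\<in>UNIV. \<omega> m l s x * \<omega> i s r x)))"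
  proof -
    have "Y m i = (\<Sum>q\<in>UNIV. ?J j q x * (\<Sum>l\<in>UNIV. \<omega> m q l x * \<omega> i l r x))" for m i
      unfolding Y_def by (subst sum.swap) (simp add: sum_distrib_left algebra_simps)
    then show ?thesis
      by (simp add: B_def right_diff_distrib distrib_left sum.distrib sum_subtractf mult.commute)
  qed
  moreover have "partial m (\<omega> i l r) x - partial i (\<omega> m l r) x
      + (\<Sum>s\<in>UNIV. \<omega> i l s x * \<omega> m s r x) - (\<Sum>s\<in>UNIV. \<omega> m l s x * \<omega> i s r x)
     = (\<Sum>p\<in>UNIV. \<Sum>q\<in>UNIV. ?J i p x * ?J m q x * curvature_comp (\<Gamma> b) p q l r (y x))" for l
  proof -
    have d: "partial m (\<omega> i l r) x = (\<Sum>p\<in>UNIV. partial m (?J i p) x * \<Gamma> b p l r (y x))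
        + (\<Sum>p\<in>UNIV. \<Sum>q\<in>UNIV. ?J i p x * ?J m q x * partial q (\<Gamma> b p l r) (y x))" for m i
      unfolding \<omega>_def[abs_def]
      by (simp add: partial_sum partial_mult differentiable_mult dJ dGby sum.distrib sum_distrib_left
          partial_pullback[OF M a b x dGb[unfolded y_def], folded y_def] algebra_simps)
    have "(\<Sum>p\<in>UNIV. \<Sum>q\<in>UNIV. ?J m p x * ?J i q x * partial q (\<Gamma> b p l r) (y x))
        = (\<Sum>p\<in>UNIV. \<Sum>q\<in>UNIV. ?J i p x * ?J m q x * partial p (\<Gamma> b q l r) (y x))"
      by (subst sum.swap) (simp add: mult.commute)
    then have 1: "partial m (\<omega> i l r) x - partial i (\<omega> m l r) x = (\<Sum>p\<in>UNIV. \<Sum>q\<in>UNIV. ?J i p x * ?J m q x *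
        (partial q (\<Gamma> b p l r) (y x) - partial p (\<Gamma> b q l r) (y x)))"
      unfolding d partial_jac_commute[OF M a b x, of m i]
      by (simp add: right_diff_distrib sum_subtractf)
    have 2: "(\<Sum>s\<in>UNIV. \<omega> i l s x * \<omega> m s r x) = (\<Sum>p\<in>UNIV. \<Sum>q\<in>UNIV. ?J i p x * ?J m q x *
        (\<Sum>s\<in>UNIV. \<Gamma> b p l s (y x) * \<Gamma> b q s r (y x)))" for m i
      unfolding \<omega>_def by (rule sum_bilinear)
    have 3: "(\<Sum>s\<in>UNIV. \<omega> m l s x * \<omega> i s r x) = (\<Sum>p\<in>UNIV. \<Sum>q\<in>UNIV. ?J i p x * ?J m q x *
        (\<Sum>s\<in>UNIV. \<Gamma> b q l s (y x) * \<Gamma> b p s r (y x)))"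
      unfolding 2 by (subst sum.swap) (simp add: mult.commute)
    show ?thesis
      unfolding 1 2[of i m] 3
      by (simp add: curvature_comp_def sum.distrib[symmetric] sum_subtractf[symmetric] algebra_simps)
  qed
  ultimately show ?thesis by (simp add: y_def)
qed

text \<open>
  Multiplying \<open>curvature_trans\<close> by the inverse Jacobian frees the upper index, which can then be contracted.
\<close>

lemma ricci_trans:
  assumes a: "a \<in> Idx M" and b: "b \<in> Idx M" and x: "x \<in> overlap M a b"
  shows "ricci \<Gamma> a i j x = (\<Sum>k\<in>UNIV. \<Sum>l\<in>UNIV.
    jac M a b i k x * jac M a b j l x * ricci \<Gamma> b k l (trans_map M a b x))"
proof -
  let ?J = "\<lambda>i k. jac M a b i k x" and ?y = "trans_map M a b x"
  let ?K = "\<lambda>i k. jac M b a i k ?y" and ?C = "\<lambda>i m j k. curvature_comp (\<Gamma> a) i m j k x"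
  let ?Cb = "\<lambda>p q l r. curvature_comp (\<Gamma> b) p q l r ?y"
  have raise: "?C i m j s = (\<Sum>r\<in>UNIV. (\<Sum>k\<in>UNIV. ?C i m j k * ?J k r) * ?K r s)" for m s
  proof -
    have "(\<Sum>r\<in>UNIV. (\<Sum>k\<in>UNIV. ?C i m j k * ?J k r) * ?K r s) = (\<Sum>r\<in>UNIV. \<Sum>k\<in>UNIV. ?C i m j k * (?J k r * ?K r s))"
      by (simp add: sum_distrib_right mult.assoc)
    also have "\<dots> = (\<Sum>k\<in>UNIV. ?C i m j k * (\<Sum>r\<in>UNIV. ?J k r * ?K r s))"
      by (subst sum.swap) (simp only: sum_distrib_left)
    also have "\<dots> = ?C i m j s"
      by (simp add: jac_inverse[OF M a b x] sum_delta_right)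
    finally show ?thesis by simp
  qed
  have "ricci \<Gamma> a i j x = (\<Sum>m\<in>UNIV. \<Sum>r\<in>UNIV. (\<Sum>l\<in>UNIV. ?J j l * (\<Sum>p\<in>UNIV. \<Sum>q\<in>UNIV. ?J i p * ?J m q * ?Cb p q l r)) * ?K r m)"
    unfolding ricci_eq by (subst raise) (simp only: curvature_trans[OF a b x])
  also have "\<dots> = (\<Sum>m\<in>UNIV. \<Sum>r\<in>UNIV. \<Sum>l\<in>UNIV. \<Sum>p\<in>UNIV. \<Sum>q\<in>UNIV. ?J i p * ?J j l * ?Cb p q l r * (?K r m * ?J m q))"
    by (simp add: sum_distrib_left sum_distrib_right algebra_simps)
  also have "\<dots> = (\<Sum>r\<in>UNIV. \<Sum>l\<in>UNIV. \<Sum>p\<in>UNIV. \<Sum>q\<in>UNIV. \<Sum>m\<in>UNIV. ?J i p * ?J j l * ?Cb p q l r * (?K r m * ?J m q))"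
  proof -
    have swap: "(\<Sum>m\<in>UNIV. \<Sum>r\<in>UNIV. \<Sum>l\<in>UNIV. \<Sum>p\<in>UNIV. \<Sum>q\<in>UNIV. F m r l p q)
        = (\<Sum>r\<in>UNIV. \<Sum>l\<in>UNIV. \<Sum>p\<in>UNIV. \<Sum>q\<in>UNIV. \<Sum>m\<in>UNIV. F m r l p q)"
      for F :: "'n \<Rightarrow> 'n \<Rightarrow> 'n \<Rightarrow> 'n \<Rightarrow> 'n \<Rightarrow> real"
    proof -
      have "(\<Sum>m\<in>UNIV. \<Sum>r\<in>UNIV. \<Sum>l\<in>UNIV. \<Sum>p\<in>UNIV. \<Sum>q\<in>UNIV. F m r l p q)
        = (\<Sum>r\<in>UNIV. \<Sum>m\<in>UNIV. \<Sum>l\<in>UNIV. \<Sum>p\<in>UNIV. \<Sum>q\<in>UNIV. F m r l p q)" by (rule sum.swap)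
      also have "\<dots> = (\<Sum>r\<in>UNIV. \<Sum>l\<in>UNIV. \<Sum>m\<in>UNIV. \<Sum>p\<in>UNIV. \<Sum>q\<in>UNIV. F m r l p q)"
        by (intro sum.cong refl sum.swap)
      also have "\<dots> = (\<Sum>r\<in>UNIV. \<Sum>l\<in>UNIV. \<Sum>p\<in>UNIV. \<Sum>m\<in>UNIV. \<Sum>q\<in>UNIV. F m r l p q)"
        by (intro sum.cong refl sum.swap)
      also have "\<dots> = (\<Sum>r\<in>UNIV. \<Sum>l\<in>UNIV. \<Sum>p\<in>UNIV. \<Sum>q\<in>UNIV. \<Sum>m\<in>UNIV. F m r l p q)"
        by (intro sum.cong refl sum.swap)
      finally show ?thesis .
    qed
    show ?thesis by (rule swap)
  qed
  also have "\<dots> = (\<Sum>r\<in>UNIV. \<Sum>l\<in>UNIV. \<Sum>p\<in>UNIV. \<Sum>q\<in>UNIV. ?J i p * ?J j l * ?Cb p q l r * (if r = q then 1 else 0))"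
    by (simp only: sum_distrib_left[symmetric] jac_inverse'[OF M a b x])
  also have "\<dots> = (\<Sum>r\<in>UNIV. \<Sum>l\<in>UNIV. \<Sum>p\<in>UNIV. ?J i p * ?J j l * ?Cb p r l r)"
    by (simp only: sum_delta_right')
  also have "\<dots> = (\<Sum>p\<in>UNIV. \<Sum>l\<in>UNIV. \<Sum>r\<in>UNIV. ?J i p * ?J j l * ?Cb p r l r)"
    using sum_swap_outer_inner[of "\<lambda>r l (_::unit) p. ?J i p * ?J j l * ?Cb p r l r"] by simp
  finally show ?thesis
    by (simp only: ricci_eq sum_distrib_left)
qed

lemma smooth_curvature_comp:
  assumes "a \<in> Idx M"
  shows "smooth_on (img M a) (curvature_comp (\<Gamma> a) i j k l)"
  unfolding curvature_comp_def[abs_def]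
  by (intro smooth_on_diff smooth_on_add smooth_on_sum smooth_on_mult smooth_on_partial open_img M
      smooth_connection assms)

lemma smooth_ricci:
  assumes "a \<in> Idx M"
  shows "smooth_on (img M a) (ricci \<Gamma> a i j)"
  unfolding ricci_eq[abs_def]
  by (intro smooth_on_sum smooth_curvature_comp open_img M assms)

lemma smooth_hessian:
  assumes "a \<in> Idx M" "smooth_fun M f"
  shows "smooth_on (img M a) (hessian M \<Gamma> f a i j)"
  unfolding hessian_eq[abs_def]
  by (intro smooth_on_diff smooth_on_sum smooth_on_mult smooth_on_partial open_img M
      smooth_connection smooth_differential assms)

lemma hessian_symmetric:
  assumes tf: "torsion_free M \<Gamma>" and f: "smooth_fun M f" and a: "a \<in> Idx M" and x: "x \<in> img M a"
  shows "hessian M \<Gamma> f a i j x = hessian M \<Gamma> f a j i x"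
proof -
  have "smooth_on (img M a) (local_rep M f a)" using f a by (simp add: smooth_fun_def)
  then have "partial i (differential M f a j) x = partial j (differential M f a i) x"
    unfolding differential_def by (rule partial_commute[OF open_img[OF M a] x])
  then show ?thesis
    by (simp add: hessian_eq torsion_free_symmetric[OF tf a x, of i j])
qed

end

lemma qe_tensor_eq:
  "qe_tensor M \<Gamma> f \<mu> a i j x = hessian M \<Gamma> f a i j x + ricci \<Gamma> a i j x + ricci \<Gamma> a j i x
     - \<mu> * (differential M f a i x * differential M f a j x)"
  by (simp add: qe_tensor_def ricci_sym_def)

text \<open>
  The factor \<open>h\<close> accommodates the factor \<open>2 / C * exp f\<close> of the tensor field in the second part of the theorem.
\<close>

lemma sym_tensor02_qe_tensor:
  fixes M :: "('i, 'a, 2) atlas"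
  assumes M: "smooth_atlas M" and conn: "connection M \<Gamma>" and tf: "torsion_free M \<Gamma>"
    and f: "smooth_fun M f" and h: "smooth_fun M h"
  shows "sym_tensor02 M (\<lambda>a i j x. local_rep M h a x * qe_tensor M \<Gamma> f \<mu> a i j x)"
  unfolding sym_tensor02_def
proof (intro conjI ballI allI)
  fix a i j assume a: "a \<in> Idx M"
  note op = open_img[OF M a]
  have "smooth_on (img M a) (local_rep M h a)" using h a by (simp add: smooth_fun_def)
  moreover have "smooth_on (img M a) (qe_tensor M \<Gamma> f \<mu> a i j)"
    unfolding qe_tensor_eq[abs_def]
    by (intro smooth_on_diff smooth_on_add smooth_on_mult smooth_on_const op
        smooth_hessian[OF M conn] smooth_ricci[OF M conn] smooth_differential[OF M conn] a f)
  ultimately show "smooth_on (img M a) (\<lambda>x. local_rep M h a x * qe_tensor M \<Gamma> f \<mu> a i j x)"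
    by (rule smooth_on_mult[OF op])
  fix x assume x: "x \<in> img M a"
  show "local_rep M h a x * qe_tensor M \<Gamma> f \<mu> a i j x = local_rep M h a x * qe_tensor M \<Gamma> f \<mu> a j i x"
    by (simp add: qe_tensor_eq hessian_symmetric[OF M conn tf f a x, of i j])
next
  fix a b x i j assume a: "a \<in> Idx M" and b: "b \<in> Idx M" and x: "x \<in> overlap M a b"
  let ?J = "\<lambda>i k. jac M a b i k x" and ?y = "trans_map M a b x"
  let ?d = "\<lambda>k. differential M f b k ?y"
  have ric: "ricci \<Gamma> a j i x = (\<Sum>k\<in>UNIV. \<Sum>l\<in>UNIV. ?J i k * ?J j l * ricci \<Gamma> b l k ?y)"
    unfolding ricci_trans[OF M conn a b x, of j i]
    by (subst sum.swap) (simp add: algebra_simps)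
  have df: "differential M f a i x * differential M f a j x = (\<Sum>k\<in>UNIV. \<Sum>l\<in>UNIV. ?J i k * ?J j l * (?d k * ?d l))"
    by (simp add: differential_trans[OF M a b x f] sum_product algebra_simps)
  have "qe_tensor M \<Gamma> f \<mu> a i j x = (\<Sum>k\<in>UNIV. \<Sum>l\<in>UNIV. ?J i k * ?J j l * qe_tensor M \<Gamma> f \<mu> b k l ?y)"
    unfolding qe_tensor_eq hessian_trans[OF M conn a b x f] df ric ricci_trans[OF M conn a b x, of i j]
    by (simp add: sum.distrib sum_subtractf right_diff_distrib distrib_left sum_distrib_left algebra_simps)
  then show "local_rep M h a x * qe_tensor M \<Gamma> f \<mu> a i j x = (\<Sum>k\<in>UNIV. \<Sum>l\<in>UNIV. ?J i k * ?J j l *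
      (local_rep M h b ?y * qe_tensor M \<Gamma> f \<mu> b k l ?y))"
    by (simp add: local_rep_trans[OF M a b x] sum_distrib_left algebra_simps)
qed

section \<open>The extension metric\<close>

text \<open>
  A metric \<open>2 dx\<^sup>i \<circ> dp\<^sub>i + A\<^sub>i\<^sub>j dx\<^sup>i \<circ> dx\<^sup>j\<close> with
  \<open>A\<^sub>i\<^sub>j = \<tau> p\<^sub>i p\<^sub>j - 2 p\<^sub>k \<Gamma>\<^sub>i\<^sub>j\<^sup>k + \<Phi>\<^sub>i\<^sub>j\<close>. The components are prescribed over the chart images only, since
  the values of a tensor elsewhere carry no information.
\<close>

locale extension_metric =
  fixes M :: "('i, 'a, 2) atlas" and \<Gamma> :: "'i \<Rightarrow> 2 christoffel" and \<Phi> :: "('i, 2) tensor2"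
    and \<tau> :: "'a \<Rightarrow> real" and g :: "('i, 4) tensor2"
  assumes surface: "affine_surface M \<Gamma>"
    and tensor: "sym_tensor02 M \<Phi>"
    and smooth_\<tau>: "smooth_fun M \<tau>"
    and g_base_base: "\<And>a z i j. a \<in> Idx M \<Longrightarrow> base_coord z \<in> img M a \<Longrightarrow>
      g a (base_idx i) (base_idx j) z =
        local_rep M \<tau> a (base_coord z) * (fibre_coord z i * fibre_coord z j)
        - 2 * (\<Sum>k\<in>UNIV. fibre_coord z k * \<Gamma> a i j k (base_coord z)) + \<Phi> a i j (base_coord z)"
    and g_base_fibre: "\<And>a z i j. a \<in> Idx M \<Longrightarrow> base_coord z \<in> img M a \<Longrightarrow>
      g a (base_idx i) (fibre_idx j) z = (if i = j then 1 else 0)"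
    and g_fibre_base: "\<And>a z i j. a \<in> Idx M \<Longrightarrow> base_coord z \<in> img M a \<Longrightarrow>
      g a (fibre_idx i) (base_idx j) z = (if i = j then 1 else 0)"
    and g_fibre_fibre: "\<And>a z i j. a \<in> Idx M \<Longrightarrow> base_coord z \<in> img M a \<Longrightarrow>
      g a (fibre_idx i) (fibre_idx j) z = 0"
begin

lemma atlas: "smooth_atlas M" and connection: "connection M \<Gamma>" and torsion_free: "torsion_free M \<Gamma>"
  and manifold: "smooth_manifold M"
  using surface by (auto simp: affine_surface_def smooth_manifold_iff)

lemma img_bundle: "a \<in> Idx M \<Longrightarrow> img (cotangent M) a = {z. base_coord z \<in> img M a}"
  by (rule img_cotangent[OF atlas])

lemma open_img_bundle: "a \<in> Idx M \<Longrightarrow> open {z. base_coord z \<in> img M a}"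
  by (intro open_base_coord_vimage open_img[OF atlas])

lemma smooth_\<Phi>: "a \<in> Idx M \<Longrightarrow> smooth_on (img M a) (\<Phi> a i j)"
  and \<Phi>_sym: "a \<in> Idx M \<Longrightarrow> x \<in> img M a \<Longrightarrow> \<Phi> a i j x = \<Phi> a j i x"
  and \<Phi>_trans: "a \<in> Idx M \<Longrightarrow> b \<in> Idx M \<Longrightarrow> x \<in> overlap M a b \<Longrightarrow> \<Phi> a i j x =
    (\<Sum>k\<in>UNIV. \<Sum>l\<in>UNIV. jac M a b i k x * jac M a b j l x * \<Phi> b k l (trans_map M a b x))"
  using tensor unfolding sym_tensor02_def by blast+

lemma \<Gamma>_sym: "a \<in> Idx M \<Longrightarrow> x \<in> img M a \<Longrightarrow> \<Gamma> a i j k x = \<Gamma> a j i k x"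
  by (rule torsion_free_symmetric[OF torsion_free])

lemma smooth_g:
  assumes a: "a \<in> Idx M"
  shows "smooth_on {z. base_coord z \<in> img M a} (g a r s)"
proof -
  let ?W = "{z. base_coord z \<in> img M a}"
  note op = open_img_bundle[OF a]
  have base: "smooth_on ?W (\<lambda>z. F (base_coord z))" if "smooth_on (img M a) F" for F
    by (rule smooth_on_base[OF open_img[OF atlas a] that])
  have \<tau>: "smooth_on (img M a) (local_rep M \<tau> a)" using smooth_\<tau> a by (simp add: smooth_fun_def)
  have bb: "smooth_on ?W (\<lambda>z. local_rep M \<tau> a (base_coord z) * (fibre_coord z i * fibre_coord z j)
        - 2 * (\<Sum>k\<in>UNIV. fibre_coord z k * \<Gamma> a i j k (base_coord z)) + \<Phi> a i j (base_coord z))" for i j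
    by (intro smooth_on_add smooth_on_diff smooth_on_mult smooth_on_sum smooth_on_const smooth_on_fibre_coord op
        base \<tau> smooth_\<Phi> smooth_connection[OF atlas connection] a)
  show ?thesis
  proof (cases r rule: idx4_cases)
    case r: (base i)
    show ?thesis
    proof (cases s rule: idx4_cases)
      case (base j)
      then show ?thesis using smooth_on_cong[OF op bb[of i j], of "g a r s"] r g_base_base[OF a] by simp
    next
      case (fibre j)
      then show ?thesis
        using smooth_on_cong[OF op smooth_on_const[of ?W "if i = j then 1 else 0"], of "g a r s"] r g_base_fibre[OF a] by simp
    qed
  next
    case r: (fibre i)
    show ?thesis
    proof (cases s rule: idx4_cases)
      case (base j)
      then show ?thesis
        using smooth_on_cong[OF op smooth_on_const[of ?W "if i = j then 1 else 0"], of "g a r s"] r g_fibre_base[OF a] by simp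
    next
      case (fibre j)
      then show ?thesis
        using smooth_on_cong[OF op smooth_on_const[of ?W 0], of "g a r s"] r g_fibre_fibre[OF a] by simp
    qed
  qed
qed

lemma g_base_sym:
  assumes "a \<in> Idx M" "base_coord z \<in> img M a"
  shows "g a (base_idx i) (base_idx j) z = g a (base_idx j) (base_idx i) z"
  using \<Gamma>_sym[OF assms, of i j] \<Phi>_sym[OF assms, of i j] by (simp add: g_base_base[OF assms])

lemma g_sym:
  assumes "a \<in> Idx M" "base_coord z \<in> img M a"
  shows "g a r s z = g a s r z"
  by (cases r rule: idx4_cases; cases s rule: idx4_cases)
    (simp_all add: g_base_sym[OF assms] g_base_fibre[OF assms] g_fibre_base[OF assms] g_fibre_fibre[OF assms])

lemma sum_combine:
  fixes J P G F :: "2 \<Rightarrow> 2 \<Rightarrow> real"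
  shows "t * (\<Sum>k\<in>UNIV. \<Sum>l\<in>UNIV. J k l * P k l) - 2 * (s + (\<Sum>k\<in>UNIV. \<Sum>l\<in>UNIV. J k l * G k l))
      + (\<Sum>k\<in>UNIV. \<Sum>l\<in>UNIV. J k l * F k l)
    = (\<Sum>k\<in>UNIV. \<Sum>l\<in>UNIV. J k l * (t * P k l - 2 * G k l + F k l)) - 2 * s"
  by (simp add: sum_2 algebra_simps)

text \<open>
  Substituting \<open>fibre_trans_inverse\<close> and the transformation law of \<open>\<Gamma>\<close> leaves one inhomogeneous term. It
  is compensated in \<open>g_trans\<close> by the mixed derivatives of the fibre coordinates (\<open>jac_cotangent_fibre\<close>).
\<close>

lemma g_trans_base:
  assumes a: "a \<in> Idx M" and b: "b \<in> Idx M" and z: "base_coord z \<in> overlap M a b"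
  shows "g a (base_idx i) (base_idx j) z =
    (\<Sum>k\<in>UNIV. \<Sum>l\<in>UNIV. jac M a b i k (base_coord z) * jac M a b j l (base_coord z) *
        g b (base_idx k) (base_idx l) (trans_map (cotangent M) a b z))
    - 2 * (\<Sum>r\<in>UNIV. partial i (jac M a b j r) (base_coord z) * fibre_coord (trans_map (cotangent M) a b z) r)"
proof -
  let ?x = "base_coord z" and ?w = "trans_map (cotangent M) a b z"
  let ?y = "trans_map M a b ?x" and ?J = "\<lambda>i k. jac M a b i k (base_coord z)"
  let ?p = "fibre_coord z" and ?q = "fibre_coord ?w" and ?t = "local_rep M \<tau> a ?x"
  have za: "?x \<in> img M a" using z overlap_subset_img[OF atlas] by blast
  have wy: "base_coord ?w = ?y" by (rule base_trans_cotangent[OF atlas a b z])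
  have wb: "base_coord ?w \<in> img M b" unfolding wy by (rule trans_in_img[OF atlas a b z])
  note p = fibre_trans_inverse[OF atlas a b z]
  have pp: "?p i * ?p j = (\<Sum>k\<in>UNIV. \<Sum>l\<in>UNIV. ?J i k * ?J j l * (?q k * ?q l))"
    unfolding p[of i] p[of j] by (simp add: sum_product algebra_simps)
  have "(\<Sum>k\<in>UNIV. ?p k * \<Gamma> a i j k ?x) = (\<Sum>k\<in>UNIV. \<Sum>r\<in>UNIV. \<Gamma> a i j k ?x * ?J k r * ?q r)"
    unfolding p by (simp add: sum_distrib_left sum_distrib_right algebra_simps)
  also have "\<dots> = (\<Sum>r\<in>UNIV. (\<Sum>k\<in>UNIV. \<Gamma> a i j k ?x * ?J k r) * ?q r)"
    by (subst sum.swap) (simp only: sum_distrib_right)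
  also have "\<dots> = (\<Sum>r\<in>UNIV. partial i (jac M a b j r) ?x * ?q r) +
      (\<Sum>r\<in>UNIV. \<Sum>k\<in>UNIV. \<Sum>l\<in>UNIV. ?J i k * ?J j l * (?q r * \<Gamma> b k l r ?y))"
    by (simp add: connection_trans[OF atlas connection a b z] distrib_right sum.distrib sum_distrib_right sum_distrib_left algebra_simps)
  also have "(\<Sum>r\<in>UNIV. \<Sum>k\<in>UNIV. \<Sum>l\<in>UNIV. ?J i k * ?J j l * (?q r * \<Gamma> b k l r ?y))
      = (\<Sum>k\<in>UNIV. \<Sum>l\<in>UNIV. ?J i k * ?J j l * (\<Sum>r\<in>UNIV. ?q r * \<Gamma> b k l r ?y))"
    unfolding sum_distrib_left by (subst sum.swap) (intro sum.cong refl sum.swap)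
  finally have \<Gamma>: "(\<Sum>k\<in>UNIV. ?p k * \<Gamma> a i j k ?x) = (\<Sum>r\<in>UNIV. partial i (jac M a b j r) ?x * ?q r) +
      (\<Sum>k\<in>UNIV. \<Sum>l\<in>UNIV. ?J i k * ?J j l * (\<Sum>r\<in>UNIV. ?q r * \<Gamma> b k l r ?y))" .
  show ?thesis
    unfolding g_base_base[OF a za] g_base_base[OF b wb] wy pp \<Gamma> \<Phi>_trans[OF a b z] local_rep_trans[OF atlas a b z]
    by (rule sum_combine)
qed

lemma g_trans:
  assumes a: "a \<in> Idx M" and b: "b \<in> Idx M" and z: "base_coord z \<in> overlap M a b"
  shows "g a r s z = (\<Sum>c\<in>UNIV. \<Sum>d\<in>UNIV. jac (cotangent M) a b r c z * jac (cotangent M) a b s d z *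
      g b c d (trans_map (cotangent M) a b z))"
proof -
  let ?w = "trans_map (cotangent M) a b z" and ?J = "\<lambda>i k. jac M a b i k (base_coord z)"
  let ?Jc = "\<lambda>r c. jac (cotangent M) a b r c z"
  have za: "base_coord z \<in> img M a" using z overlap_subset_img[OF atlas] by blast
  have wb: "base_coord ?w \<in> img M b"
    using trans_in_img[OF atlas a b z] base_trans_cotangent[OF atlas a b z] by simp
  have rhs: "(\<Sum>c\<in>UNIV. \<Sum>d\<in>UNIV. ?Jc r c * ?Jc s d * g b c d ?w) =
      (\<Sum>k\<in>UNIV. \<Sum>l\<in>UNIV. ?Jc r (base_idx k) * ?Jc s (base_idx l) * g b (base_idx k) (base_idx l) ?w)
      + (\<Sum>k\<in>UNIV. ?Jc r (base_idx k) * ?Jc s (fibre_idx k)) + (\<Sum>k\<in>UNIV. ?Jc r (fibre_idx k) * ?Jc s (base_idx k))"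
    for r s
    by (simp add: sum_idx4 g_base_fibre[OF b wb] g_fibre_base[OF b wb] g_fibre_fibre[OF b wb] sum.distrib
        sum_delta_right' del: mult_if_delta)
  note Jb = jac_cotangent_base[OF atlas a b z] and Jf = jac_cotangent_fibre[OF atlas a b z]
  have Jf': "(\<Sum>k\<in>UNIV. ?Jc (fibre_idx i) (fibre_idx k) * ?J j k) = (if i = j then 1 else 0)"
    "(\<Sum>k\<in>UNIV. ?Jc (base_idx i) (fibre_idx k) * ?J j k)
       = - (\<Sum>k\<in>UNIV. partial i (jac M a b j k) (base_coord z) * fibre_coord ?w k)" for i j
    using Jf[of j i] by (simp_all add: mult.commute)
  show ?thesis
  proof (cases r rule: idx4_cases)
    case r: (base i)
    show ?thesis
    proof (cases s rule: idx4_cases)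
      case (base j)
      then show ?thesis
        unfolding rhs r base Jb Jf Jf' g_trans_base[OF a b z]
        by (simp add: partial_jac_commute[OF atlas a b z, of j i])
    next
      case (fibre j)
      then show ?thesis
        unfolding rhs r fibre Jb Jf Jf' g_base_fibre[OF a za] by auto
    qed
  next
    case r: (fibre i)
    show ?thesis
    proof (cases s rule: idx4_cases)
      case (base j)
      then show ?thesis
        unfolding rhs r base Jb Jf Jf' g_fibre_base[OF a za] by auto
    next
      case (fibre j)
      then show ?thesis
        unfolding rhs r fibre Jb Jf Jf' g_fibre_fibre[OF a za] by simp
    qed
  qed
qed

text \<open>
  The block matrix \<open>(0, I; I, - A)\<close>. The mixed blocks are read off from \<open>g\<close>, and subtracting \<open>2\<close> turns a fibre
  index into the corresponding base index.
\<close>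

definition ginv :: "'i \<Rightarrow> real^4 \<Rightarrow> real^4^4" where
  "ginv a z = (\<chi> r s. if r \<in> range base_idx then (if s \<in> range base_idx then 0 else g a r s z)
     else (if s \<in> range base_idx then g a r s z else - g a (r - 2) (s - 2) z))"

lemma fibre_idx_minus: "fibre_idx i - 2 = base_idx i"
  using idx2_cases[of i] by auto

lemma ginv_simps:
  assumes "a \<in> Idx M" "base_coord z \<in> img M a"
  shows "ginv a z $ base_idx i $ base_idx j = 0"
    "ginv a z $ base_idx i $ fibre_idx j = (if i = j then 1 else 0)"
    "ginv a z $ fibre_idx i $ base_idx j = (if i = j then 1 else 0)"
    "ginv a z $ fibre_idx i $ fibre_idx j = - g a (base_idx i) (base_idx j) z"
  by (auto simp: ginv_def fibre_idx_minus g_base_fibre[OF assms] g_fibre_base[OF assms])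

lemma gram_ginv:
  assumes "a \<in> Idx M" "base_coord z \<in> img M a"
  shows "gram g a z ** ginv a z = mat 1" "ginv a z ** gram g a z = mat 1"
proof -
  show "gram g a z ** ginv a z = mat 1"
    by (simp add: vec_eq_iff forall_idx4 matrix_matrix_mult_def gram_def mat_def sum_idx4 ginv_simps[OF assms]
        g_base_fibre[OF assms] g_fibre_base[OF assms] g_fibre_fibre[OF assms] sum_delta_right sum_delta_right' sum_negf
        if_distrib[of "\<lambda>u. u * _"] cong: if_cong)
  then show "ginv a z ** gram g a z = mat 1"
    by (simp add: matrix_left_right_inverse)
qed

lemma invertible_gram:
  assumes "a \<in> Idx M" "base_coord z \<in> img M a"
  shows "invertible (gram g a z)"
  using gram_ginv[OF assms] unfolding invertible_def by blast

lemma matrix_inv_gram: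
  assumes "a \<in> Idx M" "base_coord z \<in> img M a"
  shows "matrix_inv (gram g a z) = ginv a z"
proof -
  have "matrix_inv (gram g a z) = matrix_inv (gram g a z) ** (gram g a z ** ginv a z)"
    by (simp add: gram_ginv[OF assms])
  also have "\<dots> = ginv a z"
    using matrix_inv_mult[OF invertible_gram[OF assms]] by (simp add: matrix_mul_assoc)
  finally show ?thesis .
qed

lemma sym_tensor02_g: "sym_tensor02 (cotangent M) g"
  unfolding sym_tensor02_def Idx_cotangent
proof (intro conjI ballI allI)
  fix a r s assume a: "a \<in> Idx M"
  show "smooth_on (img (cotangent M) a) (g a r s)"
    using smooth_g[OF a] by (simp add: img_bundle[OF a])
  fix z assume "z \<in> img (cotangent M) a"
  then show "g a r s z = g a s r z" using g_sym[OF a] by (simp add: img_bundle[OF a])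
next
  fix a b z r s assume "a \<in> Idx M" "b \<in> Idx M" "z \<in> overlap (cotangent M) a b"
  then show "g a r s z = (\<Sum>k\<in>UNIV. \<Sum>l\<in>UNIV. jac (cotangent M) a b r k z * jac (cotangent M) a b s l z *
      g b k l (trans_map (cotangent M) a b z))"
    by (intro g_trans) (auto simp: overlap_cotangent[OF atlas])
qed

lemma pseudo_riemannian: "pseudo_riemannian (cotangent M) g"
  unfolding pseudo_riemannian_def Idx_cotangent
  using smooth_manifold_cotangent[OF manifold] sym_tensor02_g invertible_gram
  by (auto simp: img_bundle)

text \<open>
  For \<open>v = (u, w)\<close> one has \<open>g(v, v) = u \<bullet> A u + 2 u \<bullet> w\<close>. On the graph \<open>w = (e u - A u) / 2\<close> this is
  \<open>e \<bar>u\<bar>\<^sup>2\<close>, so \<open>e = 1\<close> and \<open>e = - 1\<close> give a positive and a negative plane.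
\<close>

lemma has_signature: "has_signature (cotangent M) g 2 2"
  unfolding has_signature_def Idx_cotangent
proof (intro conjI ballI)
  fix a z assume a: "a \<in> Idx M" and "z \<in> img (cotangent M) a"
  then have z: "base_coord z \<in> img M a" by (simp add: img_bundle)
  define A where "A = (\<lambda>i j. g a (base_idx i) (base_idx j) z)"
  define L where "L e u = join_coords u (\<lambda>i. (e * u $ i - (\<Sum>j\<in>UNIV. A i j * u $ j)) / 2)" for e :: real and u
  have L_nth: "L e u $ base_idx i = u $ i"
    "L e u $ fibre_idx i = (e * u $ i - (\<Sum>j\<in>UNIV. A i j * u $ j)) / 2" for e u i
    using join_coords_simps[of u] by (simp_all add: L_def flip: base_coord_nth fibre_coord_def)
  have lin: "linear (L e)" for e
    by (rule linearI)
      (simp_all add: vec_eq_iff forall_idx4 L_nth algebra_simps sum.distrib sum_distrib_left add_divide_distrib diff_divide_distrib)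
  have inj: "inj (L e)" for e
    by (rule injI) (metis L_nth(1) vec_eq_iff)
  have norm: "inner_at g a z (L e u) (L e u) = e * (\<Sum>i\<in>UNIV. u $ i * u $ i)" for e u
  proof -
    have "inner_at g a z (L e u) (L e u) = (\<Sum>i\<in>UNIV. \<Sum>j\<in>UNIV. A i j * u $ i * u $ j)
        + 2 * (\<Sum>i\<in>UNIV. u $ i * ((e * u $ i - (\<Sum>j\<in>UNIV. A i j * u $ j)) / 2))"
      by (simp add: inner_at_def sum_idx4 L_nth g_base_fibre[OF a z] g_fibre_base[OF a z] g_fibre_fibre[OF a z]
          sum.distrib if_distrib[of "\<lambda>u. u * _"] cong: if_cong)
        (simp add: sum_2 A_def field_simps)
    also have "\<dots> = e * (\<Sum>i\<in>UNIV. u $ i * u $ i)"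
      by (simp add: sum_2 field_simps)
    finally show ?thesis .
  qed
  have pos: "(\<Sum>i\<in>UNIV. u $ i * u $ i) > 0" if "u \<noteq> 0" for u :: "real^2"
    using that by (auto simp: vec_eq_iff forall_2 sum_2 add_pos_nonneg add_nonneg_pos not_sum_squares_lt_zero
        sum_squares_gt_zero_iff)
  have sub: "subspace (range (L e))" for e by (rule linear_subspace_image[OF lin]) simp
  have dim: "dim (range (L e)) = 2" for e
    using dim_image_eq[OF lin, of e UNIV] inj[of e] by simp
  have L0: "L e 0 = 0" for e using lin linear_0 by blast
  show "\<exists>P N. subspace P \<and> subspace N \<and> dim P = 2 \<and> dim N = 2 \<and>
        (\<forall>v\<in>P. v \<noteq> 0 \<longrightarrow> inner_at g a z v v > 0) \<and> (\<forall>v\<in>N. v \<noteq> 0 \<longrightarrow> inner_at g a z v v < 0)"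
  proof (intro exI conjI)
    show "\<forall>v\<in>range (L 1). v \<noteq> 0 \<longrightarrow> inner_at g a z v v > 0"
      using pos L0 by (auto simp: norm) (metis norm pos)
    show "\<forall>v\<in>range (L (-1)). v \<noteq> 0 \<longrightarrow> inner_at g a z v v < 0"
      using pos L0 by (auto simp: norm) (metis norm pos)
  qed (rule sub dim)+
qed simp


section \<open>The Levi-Civita connection of the extension metric\<close>

text \<open>
  The Christoffel symbols with all three indices in the base. At fixed fibre coordinates they are those of a
  connection projectively related to \<open>D\<close>.
\<close>

definition N :: "'i \<Rightarrow> 2 \<Rightarrow> 2 \<Rightarrow> 2 \<Rightarrow> real^4 \<Rightarrow> real" where
  "N a i j k z = \<Gamma> a i j k (base_coord z) - local_rep M \<tau> a (base_coord z) *
     ((if k = i then 1 else 0) * fibre_coord z j + (if k = j then 1 else 0) * fibre_coord z i) / 2"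

text \<open>
  The Christoffel symbols with two lower base indices and an upper fibre index.
\<close>

definition Q :: "'i \<Rightarrow> 2 \<Rightarrow> 2 \<Rightarrow> 2 \<Rightarrow> real^4 \<Rightarrow> real" where
  "Q a i j k z = (partial (base_idx i) (g a (base_idx j) (base_idx k)) z
      + partial (base_idx j) (g a (base_idx i) (base_idx k)) z
      - partial (base_idx k) (g a (base_idx i) (base_idx j)) z) / 2
      - (\<Sum>l\<in>UNIV. g a (base_idx k) (base_idx l) z * N a i j l z)"

context
  fixes a z
  assumes a: "a \<in> Idx M" and z: "base_coord z \<in> img M a"
begin

lemma differentiable_base_data:
  "(\<lambda>z. local_rep M \<tau> a (base_coord z)) differentiable (at z)"
  "(\<lambda>z. \<Gamma> a i j k (base_coord z)) differentiable (at z)"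
  "(\<lambda>z. \<Phi> a i j (base_coord z)) differentiable (at z)"
  "local_rep M \<tau> a differentiable (at (base_coord z))"
  "\<Gamma> a i j k differentiable (at (base_coord z))"
  "\<Phi> a i j differentiable (at (base_coord z))"
proof -
  show 1: "local_rep M \<tau> a differentiable (at (base_coord z))"
    using smooth_\<tau> a z smooth_on_imp_differentiable by (auto simp: smooth_fun_def)
  show 2: "\<Gamma> a i j k differentiable (at (base_coord z))"
    by (rule smooth_on_imp_differentiable[OF smooth_connection[OF atlas connection a] z])
  show 3: "\<Phi> a i j differentiable (at (base_coord z))"
    by (rule smooth_on_imp_differentiable[OF smooth_\<Phi>[OF a] z])
  show "(\<lambda>z. local_rep M \<tau> a (base_coord z)) differentiable (at z)"
    "(\<lambda>z. \<Gamma> a i j k (base_coord z)) differentiable (at z)"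
    "(\<lambda>z. \<Phi> a i j (base_coord z)) differentiable (at z)"
    by (intro differentiable_base 1 2 3)+
qed

text \<open>
  This is where \<open>N\<close> comes from: it is \<open>- 1/2\<close> times the fibre derivative of \<open>A\<close>.
\<close>

lemma partial_fibre_g: "partial (fibre_idx k) (g a (base_idx i) (base_idx j)) z = - 2 * N a i j k z"
proof -
  have "partial (fibre_idx k) (g a (base_idx i) (base_idx j)) z =
    partial (fibre_idx k) (\<lambda>z. local_rep M \<tau> a (base_coord z) * (fibre_coord z i * fibre_coord z j)
        - 2 * (\<Sum>k\<in>UNIV. fibre_coord z k * \<Gamma> a i j k (base_coord z)) + \<Phi> a i j (base_coord z)) z"
    by (rule partial_cong_open[OF open_img_bundle[OF a], of z]) (use z in \<open>simp_all add: g_base_base[OF a]\<close>)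
  also have "\<dots> = - 2 * N a i j k z"
    by (simp add: partial_add partial_diff partial_mult partial_sum partial_fibre_coord partial_base
        differentiable_base_data differentiable_fibre_coord differentiable_sum differentiable_mult N_def
        if_distrib[of "\<lambda>u. u * _"] if_distrib[of "\<lambda>u. _ * u"] cong: if_cong)
  finally show ?thesis .
qed

lemma partial_g_const:
  "partial c (g a (base_idx i) (fibre_idx j)) z = 0"
  "partial c (g a (fibre_idx i) (base_idx j)) z = 0"
  "partial c (g a (fibre_idx i) (fibre_idx j)) z = 0"
  using partial_cong_open[OF open_img_bundle[OF a], of z "g a (base_idx i) (fibre_idx j)" "\<lambda>_. if i = j then 1 else 0" c]
    partial_cong_open[OF open_img_bundle[OF a], of z "g a (fibre_idx i) (base_idx j)" "\<lambda>_. if i = j then 1 else 0" c]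
    partial_cong_open[OF open_img_bundle[OF a], of z "g a (fibre_idx i) (fibre_idx j)" "\<lambda>_. 0" c] z
  by (simp_all add: g_base_fibre[OF a] g_fibre_base[OF a] g_fibre_fibre[OF a])

lemma N_sym: "N a i j k z = N a j i k z"
  using \<Gamma>_sym[OF a z, of i j k] by (simp add: N_def algebra_simps)

text \<open>
  The inverse of the metric is read off from \<open>ginv\<close>.
\<close>

lemma levi_civita_koszul:
  "levi_civita (cotangent M) g a r s (base_idx k) z = koszul g a r s (fibre_idx k) z"
  "levi_civita (cotangent M) g a r s (fibre_idx k) z = koszul g a r s (base_idx k) z
     - (\<Sum>l\<in>UNIV. g a (base_idx k) (base_idx l) z * koszul g a r s (fibre_idx l) z)"
proof -
  have "smooth_on (img (cotangent M) b) (\<lambda>w. matrix_inv (gram g b w) $ r $ s)" if b: "b \<in> Idx M" for b r s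
  proof -
    have "smooth_on {w. base_coord w \<in> img M b} (\<lambda>w. ginv b w $ r $ s)"
      unfolding ginv_def
      by (cases "r \<in> range base_idx"; cases "s \<in> range base_idx")
        (simp_all add: smooth_on_const smooth_on_minus[OF open_img_bundle[OF b]] smooth_g[OF b])
    then show ?thesis
      unfolding img_bundle[OF b]
      by (rule smooth_on_cong[OF open_img_bundle[OF b]]) (simp add: matrix_inv_gram[OF b])
  qed
  then have "levi_civita (cotangent M) g a r s m z = christoffel g a r s m z" for m
    using levi_civita_eq_christoffel[OF pseudo_riemannian, of a z] a z by (simp add: img_bundle)
  then show "levi_civita (cotangent M) g a r s (base_idx k) z = koszul g a r s (fibre_idx k) z"
    "levi_civita (cotangent M) g a r s (fibre_idx k) z = koszul g a r s (base_idx k) z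
     - (\<Sum>l\<in>UNIV. g a (base_idx k) (base_idx l) z * koszul g a r s (fibre_idx l) z)"
    by (simp_all add: christoffel_def matrix_inv_gram[OF a z] sum_idx4 ginv_simps[OF a z]
        if_distrib[of "\<lambda>u. u * _"] sum_negf cong: if_cong)
qed

text \<open>
  All mixed symbols are \<open>- N\<close> or zero; in particular an upper base index never occurs with a lower fibre index.
\<close>

lemma nabla_components:
  "levi_civita (cotangent M) g a (base_idx i) (base_idx j) (base_idx k) z = N a i j k z"
  "levi_civita (cotangent M) g a (base_idx i) (base_idx j) (fibre_idx k) z = Q a i j k z"
  "levi_civita (cotangent M) g a (base_idx i) (fibre_idx j) (base_idx k) z = 0"
  "levi_civita (cotangent M) g a (base_idx i) (fibre_idx j) (fibre_idx k) z = - N a i k j z"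
  "levi_civita (cotangent M) g a (fibre_idx j) (base_idx i) (base_idx k) z = 0"
  "levi_civita (cotangent M) g a (fibre_idx j) (base_idx i) (fibre_idx k) z = - N a i k j z"
  "levi_civita (cotangent M) g a (fibre_idx i) (fibre_idx j) r z = 0"
proof -
  have K: "koszul g a (base_idx i) (base_idx j) (fibre_idx k) z = N a i j k z"
    "koszul g a (base_idx i) (fibre_idx j) (fibre_idx k) z = 0"
    "koszul g a (fibre_idx j) (base_idx i) (fibre_idx k) z = 0"
    "koszul g a (base_idx i) (fibre_idx j) (base_idx k) z = - N a i k j z"
    "koszul g a (fibre_idx j) (base_idx i) (base_idx k) z = - N a i k j z"
    "koszul g a (fibre_idx i) (fibre_idx j) s z = 0" for i j k s
    by (simp_all add: koszul_def partial_g_const partial_fibre_g)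
      (cases s rule: idx4_cases; simp add: partial_g_const)
  show "levi_civita (cotangent M) g a (base_idx i) (base_idx j) (base_idx k) z = N a i j k z"
    "levi_civita (cotangent M) g a (base_idx i) (base_idx j) (fibre_idx k) z = Q a i j k z"
    "levi_civita (cotangent M) g a (base_idx i) (fibre_idx j) (base_idx k) z = 0"
    "levi_civita (cotangent M) g a (base_idx i) (fibre_idx j) (fibre_idx k) z = - N a i k j z"
    "levi_civita (cotangent M) g a (fibre_idx j) (base_idx i) (base_idx k) z = 0"
    "levi_civita (cotangent M) g a (fibre_idx j) (base_idx i) (fibre_idx k) z = - N a i k j z"
    by (simp_all add: levi_civita_koszul K Q_def sum_negf)
      (simp_all add: koszul_def)
  show "levi_civita (cotangent M) g a (fibre_idx i) (fibre_idx j) r z = 0"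
    by (cases r rule: idx4_cases) (simp_all add: levi_civita_koszul K)
qed

end

end

section \<open>Curvature of the extension metric\<close>

context extension_metric
begin

abbreviation nabla :: "'i \<Rightarrow> 4 christoffel" where
  "nabla \<equiv> levi_civita (cotangent M) g"

text \<open>
  The curvature of \<open>N\<close>, taken at fixed fibre coordinates.
\<close>

definition RN :: "'i \<Rightarrow> 2 \<Rightarrow> 2 \<Rightarrow> 2 \<Rightarrow> 2 \<Rightarrow> real^4 \<Rightarrow> real" where
  "RN a i j k l z = partial (base_idx j) (N a i k l) z - partial (base_idx i) (N a j k l) z
     + (\<Sum>m\<in>UNIV. N a i k m z * N a j m l z) - (\<Sum>m\<in>UNIV. N a j k m z * N a i m l z)"

context
  fixes a z
  assumes a: "a \<in> Idx M" and z: "base_coord z \<in> img M a"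
begin

lemma differentiable_N: "N a i j k differentiable (at z)"
  unfolding N_def[abs_def]
  by (simp add: differentiable_base_data[OF a z] differentiable_fibre_coord differentiable_mult)

lemma partial_fibre_N: "partial (fibre_idx m) (N a i j k) z = - local_rep M \<tau> a (base_coord z) *
    ((if k = i then 1 else 0) * (if m = j then 1 else 0) + (if k = j then 1 else 0) * (if m = i then 1 else 0)) / 2"
  unfolding N_def[abs_def]
  by (simp add: partial_diff partial_add partial_mult partial_divide_const partial_base partial_fibre_coord
      differentiable_base_data[OF a z] differentiable_fibre_coord differentiable_mult del: mult_if_delta)

lemma partial_base_N: "partial (base_idx m) (N a i j k) z = partial m (\<Gamma> a i j k) (base_coord z)
    - differential M \<tau> a m (base_coord z) *
    ((if k = i then 1 else 0) * fibre_coord z j + (if k = j then 1 else 0) * fibre_coord z i) / 2"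
  unfolding N_def[abs_def]
  by (simp add: partial_diff partial_add partial_mult partial_divide_const partial_base partial_fibre_coord
      differentiable_base_data[OF a z] differentiable_fibre_coord differentiable_mult differential_def
      del: mult_if_delta)

lemma partial_nabla:
  "partial c (nabla a (base_idx i) (base_idx j) (base_idx k)) z = partial c (N a i j k) z"
  "partial c (nabla a (base_idx i) (base_idx j) (fibre_idx k)) z = partial c (Q a i j k) z"
  "partial c (nabla a (base_idx i) (fibre_idx j) (base_idx k)) z = 0"
  "partial c (nabla a (base_idx i) (fibre_idx j) (fibre_idx k)) z = - partial c (N a i k j) z"
  "partial c (nabla a (fibre_idx j) (base_idx i) (base_idx k)) z = 0"
  "partial c (nabla a (fibre_idx j) (base_idx i) (fibre_idx k)) z = - partial c (N a i k j) z"
  "partial c (nabla a (fibre_idx i) (fibre_idx j) r) z = 0"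
proof -
  have cong: "partial c F z = partial c G z" if "\<And>w. base_coord w \<in> img M a \<Longrightarrow> F w = G w" for F G
    by (rule partial_cong_open[OF open_img_bundle[OF a], of z]) (use z that in auto)
  note C = nabla_components[OF a]
  show "partial c (nabla a (base_idx i) (base_idx j) (base_idx k)) z = partial c (N a i j k) z"
    "partial c (nabla a (base_idx i) (base_idx j) (fibre_idx k)) z = partial c (Q a i j k) z"
    by (intro cong C; assumption)+
  have zero: "partial c F z = 0" if "\<And>w. base_coord w \<in> img M a \<Longrightarrow> F w = 0" for F
    using cong[of F "\<lambda>_. 0", OF that] by simp
  show "partial c (nabla a (base_idx i) (fibre_idx j) (base_idx k)) z = 0"
    "partial c (nabla a (fibre_idx j) (base_idx i) (base_idx k)) z = 0"
    "partial c (nabla a (fibre_idx i) (fibre_idx j) r) z = 0"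
    by (rule zero, rule C, assumption)+
  have minus: "partial c F z = - partial c (N a i k j) z"
    if "\<And>w. base_coord w \<in> img M a \<Longrightarrow> F w = - N a i k j w" for F
    using cong[of F "\<lambda>w. - N a i k j w", OF that] partial_minus[OF differentiable_N, of c i k j] by simp
  show "partial c (nabla a (base_idx i) (fibre_idx j) (fibre_idx k)) z = - partial c (N a i k j) z"
    "partial c (nabla a (fibre_idx j) (base_idx i) (fibre_idx k)) z = - partial c (N a i k j) z"
    by (rule minus, rule C, assumption)+
qed

text \<open>
  The only derivatives of \<open>Q\<close> that enter the Ricci tensor. They contain just first base derivatives of \<open>N\<close>,
  because the fibre derivative turns the base derivatives of \<open>A\<close> into base derivatives of \<open>- 2 N\<close>.
\<close>

lemma partial_fibre_Q:
  "partial (fibre_idx m) (Q a i j k) z =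
     partial (base_idx k) (N a i j m) z - partial (base_idx i) (N a j k m) z - partial (base_idx j) (N a i k m) z
     + 2 * (\<Sum>l\<in>UNIV. N a k l m z * N a i j l z)
     - (\<Sum>l\<in>UNIV. g a (base_idx k) (base_idx l) z * partial (fibre_idx m) (N a i j l) z)"
proof -
  let ?W = "{w. base_coord w \<in> img M a}"
  let ?g = "\<lambda>i j. g a (base_idx i) (base_idx j)"
  note op = open_img_bundle[OF a]
  have zW: "z \<in> ?W" using z by simp
  have dg: "?g i j differentiable (at z)" for i j
    by (rule smooth_on_imp_differentiable[OF smooth_g[OF a] zW])
  have ddg: "partial c (?g i j) differentiable (at z)" for c i j
    by (rule smooth_on_imp_differentiable[OF smooth_on_partial[OF smooth_g[OF a]] zW])
  have swap: "partial (fibre_idx m) (partial (base_idx c) (?g i j)) z = - 2 * partial (base_idx c) (N a i j m) z"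
    for c i j
  proof -
    have "partial (fibre_idx m) (partial (base_idx c) (?g i j)) z
        = partial (base_idx c) (partial (fibre_idx m) (?g i j)) z"
      by (rule partial_commute[OF op zW smooth_g[OF a]])
    also have "\<dots> = partial (base_idx c) (\<lambda>w. - 2 * N a i j m w) z"
      by (rule partial_cong_open[OF op zW]) (simp add: partial_fibre_g[OF a])
    also have "\<dots> = - 2 * partial (base_idx c) (N a i j m) z"
      by (simp add: partial_minus partial_mult differentiable_N differentiable_mult)
    finally show ?thesis .
  qed
  show ?thesis
    unfolding Q_def[abs_def]
    by (simp add: partial_diff partial_add partial_mult partial_sum partial_divide_const
        differentiable_N dg ddg differentiable_mult differentiable_sum swap partial_fibre_g[OF a z]
        sum.distrib sum_negf sum_subtractf sum_distrib_left algebra_simps)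
      (simp add: field_simps)
qed

text \<open>
  The list is complete except for the fibre components of \<open>R(X, Y) \<partial>\<^sub>k\<close> with \<open>k\<close> in the base. Of those, the last two
  are the ones that occur in the Ricci tensor.
\<close>

lemma curvature_components:
  "curvature_comp (nabla a) (base_idx i) (base_idx j) (base_idx k) (base_idx l) z = RN a i j k l z"
  "curvature_comp (nabla a) (base_idx i) (fibre_idx j) (base_idx k) (base_idx l) z = partial (fibre_idx j) (N a i k l) z"
  "curvature_comp (nabla a) (fibre_idx j) (base_idx i) (base_idx k) (base_idx l) z = - partial (fibre_idx j) (N a i k l) z"
  "curvature_comp (nabla a) (fibre_idx i) (fibre_idx j) (base_idx k) (base_idx l) z = 0"
  "curvature_comp (nabla a) r s (fibre_idx k) (base_idx l) z = 0"
  "curvature_comp (nabla a) (base_idx i) (base_idx j) (fibre_idx k) (fibre_idx l) z = - RN a i j l k z"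
  "curvature_comp (nabla a) (base_idx i) (fibre_idx j) (fibre_idx k) (fibre_idx l) z = - partial (fibre_idx j) (N a i l k) z"
  "curvature_comp (nabla a) (fibre_idx j) (base_idx i) (fibre_idx k) (fibre_idx l) z = partial (fibre_idx j) (N a i l k) z"
  "curvature_comp (nabla a) (fibre_idx i) (fibre_idx j) (fibre_idx k) (fibre_idx l) z = 0"
  "curvature_comp (nabla a) (base_idx i) (fibre_idx j) (base_idx k) (fibre_idx l) z =
     partial (fibre_idx j) (Q a i k l) z + partial (base_idx i) (N a k l j) z
     - (\<Sum>m\<in>UNIV. N a i k m z * N a m l j z) - (\<Sum>m\<in>UNIV. N a k m j z * N a i l m z)"
  "curvature_comp (nabla a) (fibre_idx i) (fibre_idx j) (base_idx k) (fibre_idx l) z =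
     partial (fibre_idx i) (N a k l j) z - partial (fibre_idx j) (N a k l i) z"
proof -
  note rules = curvature_comp_def sum_idx4 nabla_components[OF a z] partial_nabla
  show "curvature_comp (nabla a) r s (fibre_idx k) (base_idx l) z = 0"
    by (cases r rule: idx4_cases; cases s rule: idx4_cases) (simp_all add: rules)
qed (simp_all add: curvature_comp_def sum_idx4 nabla_components[OF a z] partial_nabla RN_def mult.commute
    sum_negf)

lemma ricci_mixed:
  "ricci nabla a (fibre_idx i) (fibre_idx j) z = 0"
  "ricci nabla a (base_idx i) (fibre_idx j) z = 3 / 2 * local_rep M \<tau> a (base_coord z) * (if i = j then 1 else 0)"
  "ricci nabla a (fibre_idx j) (base_idx i) z = 3 / 2 * local_rep M \<tau> a (base_coord z) * (if i = j then 1 else 0)"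
  using idx2_cases[of i] idx2_cases[of j]
  by (auto simp: ricci_eq sum_idx4 curvature_components partial_fibre_N sum_2)

text \<open>
  The trace over the base directions gives \<open>Ric(N)\<^sub>i\<^sub>j\<close>. Inserting \<open>partial_fibre_Q\<close> into the trace over the
  fibre directions gives \<open>Ric(N)\<^sub>j\<^sub>i\<close> and, from the fibre derivative of \<open>N\<close>, the term \<open>\<tau> A\<^sub>i\<^sub>j\<close>.
\<close>

lemma ricci_base_RN:
  "ricci nabla a (base_idx i) (base_idx j) z = (\<Sum>k\<in>UNIV. RN a i k j k z) + (\<Sum>k\<in>UNIV. RN a j k i k z)
     + local_rep M \<tau> a (base_coord z) * g a (base_idx i) (base_idx j) z"
proof -
  have N21: "N a 2 1 k z = N a 1 2 k z" "partial c (N a 2 1 k) z = partial c (N a 1 2 k) z" for c k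
    using N_sym[OF a z, of 2 1 k] N_sym[OF a, of _ 2 1 k] z
    by (auto intro: partial_cong_open[OF open_img_bundle[OF a], of z])
  have g21: "g a (base_idx 2) (base_idx 1) z = g a (base_idx 1) (base_idx 2) z"
    by (rule g_base_sym[OF a z])
  have trace: "ricci nabla a (base_idx i) (base_idx j) z = (\<Sum>k\<in>UNIV. RN a i k j k z)
     + (\<Sum>k\<in>UNIV. partial (fibre_idx k) (Q a i j k) z + partial (base_idx i) (N a j k k) z
        - (\<Sum>m\<in>UNIV. N a i j m z * N a m k k z) - (\<Sum>m\<in>UNIV. N a j m k z * N a i k m z))"
    by (simp add: ricci_eq sum_idx4 curvature_components)
  show ?thesis
    unfolding trace
    using idx2_cases[of i] idx2_cases[of j]
    by (elim disjE; hypsubst)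
      (simp_all add: partial_fibre_Q partial_fibre_N RN_def sum_2 N21 g21[simplified] algebra_simps)
qed

text \<open>
  The behaviour of the symmetrized Ricci tensor under the projective change of \<open>D\<close> by the 1-form
  \<open>- \<tau> p / 2\<close> in which \<open>p\<close> is held constant.
\<close>

lemma RN_trace:
  fixes i j
  defines "x \<equiv> base_coord z"
  shows "(\<Sum>k\<in>UNIV. RN a i k j k z) + (\<Sum>k\<in>UNIV. RN a j k i k z) =
     ricci \<Gamma> a i j x + ricci \<Gamma> a j i x
     + (differential M \<tau> a i x * fibre_coord z j + differential M \<tau> a j x * fibre_coord z i) / 2
     - local_rep M \<tau> a x * (\<Sum>k\<in>UNIV. fibre_coord z k * \<Gamma> a i j k x)
     + (local_rep M \<tau> a x)\<^sup>2 * (fibre_coord z i * fibre_coord z j) / 2"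
proof -
  have G21: "\<Gamma> a 2 1 k x = \<Gamma> a 1 2 k x" "partial c (\<Gamma> a 2 1 k) x = partial c (\<Gamma> a 1 2 k) x" for c k
    using \<Gamma>_sym[OF a, of _ 2 1 k] z
    by (auto simp: x_def intro: partial_cong_open[OF open_img[OF atlas a]])
  show ?thesis
    unfolding ricci_eq curvature_comp_def RN_def partial_base_N N_def x_def[symmetric]
    using idx2_cases[of i] idx2_cases[of j]
    by (elim disjE; hypsubst) (simp_all add: sum_2 G21 field_simps power2_eq_square)
qed

text \<open>
  The difference \<open>\<Gamma> - N\<close> contributes the term with \<open>\<tau>\<close>.
\<close>

lemma hessian_lift:
  assumes f: "smooth_fun M f"
  shows "hessian (cotangent M) nabla (f \<circ> fst) a (base_idx i) (base_idx j) z =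
      hessian M \<Gamma> f a i j (base_coord z) + local_rep M \<tau> a (base_coord z) / 2 *
        (differential M f a i (base_coord z) * fibre_coord z j + differential M f a j (base_coord z) * fibre_coord z i)"
    and "hessian (cotangent M) nabla (f \<circ> fst) a (base_idx i) (fibre_idx j) z = 0"
    and "hessian (cotangent M) nabla (f \<circ> fst) a (fibre_idx j) (base_idx i) z = 0"
    and "hessian (cotangent M) nabla (f \<circ> fst) a (fibre_idx i) (fibre_idx j) z = 0"
proof -
  note d = differential_lift[OF atlas f a]
  have "differential M f a k differentiable (at (base_coord z))" for k
    by (rule smooth_on_imp_differentiable[OF smooth_differential[OF atlas connection f a] z])
  then have db: "partial (base_idx i) (differential (cotangent M) (f \<circ> fst) a (base_idx k)) z
        = partial i (differential M f a k) (base_coord z)"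
    "partial (fibre_idx i) (differential (cotangent M) (f \<circ> fst) a (base_idx k)) z = 0" for i k
    using partial_cong_open[OF open_img_bundle[OF a], of z "differential (cotangent M) (f \<circ> fst) a (base_idx k)"
        "\<lambda>w. differential M f a k (base_coord w)"] d z
    by (simp_all add: partial_base)
  have df: "partial c (differential (cotangent M) (f \<circ> fst) a (fibre_idx k)) z = 0" for c k
    using partial_cong_open[OF open_img_bundle[OF a], of z "differential (cotangent M) (f \<circ> fst) a (fibre_idx k)"
        "\<lambda>_. 0"] d z by simp
  have N: "(\<Sum>k\<in>UNIV. N a i j k z * differential M f a k (base_coord z)) =
      (\<Sum>k\<in>UNIV. \<Gamma> a i j k (base_coord z) * differential M f a k (base_coord z))
      - local_rep M \<tau> a (base_coord z) / 2 *
        (differential M f a i (base_coord z) * fibre_coord z j + differential M f a j (base_coord z) * fibre_coord z i)"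
    using idx2_cases[of i] idx2_cases[of j]
    by (elim disjE; hypsubst) (simp_all add: N_def sum_2 field_simps)
  note rules = hessian_eq sum_idx4 d[OF z] db df nabla_components[OF a z]
  show "hessian (cotangent M) nabla (f \<circ> fst) a (base_idx i) (fibre_idx j) z = 0"
    "hessian (cotangent M) nabla (f \<circ> fst) a (fibre_idx j) (base_idx i) z = 0"
    "hessian (cotangent M) nabla (f \<circ> fst) a (fibre_idx i) (fibre_idx j) z = 0"
    by (simp_all add: rules)
  show "hessian (cotangent M) nabla (f \<circ> fst) a (base_idx i) (base_idx j) z =
      hessian M \<Gamma> f a i j (base_coord z) + local_rep M \<tau> a (base_coord z) / 2 *
        (differential M f a i (base_coord z) * fibre_coord z j + differential M f a j (base_coord z) * fibre_coord z i)"
    by (simp add: rules N)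
qed

end

text \<open>
  In the base components, \<open>d\<tau> = - \<tau> df\<close> makes the terms of \<open>hessian_lift\<close> and of \<open>RN_trace\<close> that contain
  first derivatives of \<open>f\<close> and \<open>\<tau>\<close> cancel. Besides the Ricci tensor of \<open>D\<close>, \<open>RN_trace\<close> then contributes
  \<open>\<tau> (A\<^sub>i\<^sub>j - \<Phi>\<^sub>i\<^sub>j) / 2\<close>, which completes \<open>\<tau> A\<^sub>i\<^sub>j\<close> to \<open>3/2 \<tau> A\<^sub>i\<^sub>j\<close> up to \<open>\<tau> \<Phi>\<^sub>i\<^sub>j / 2\<close>.
\<close>

lemma generalized_quasi_einstein:
  assumes f: "smooth_fun M f"
    and d\<tau>: "\<And>a x i. a \<in> Idx M \<Longrightarrow> x \<in> img M a \<Longrightarrow>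
      differential M \<tau> a i x = - local_rep M \<tau> a x * differential M f a i x"
    and qe: "\<And>a x i j. a \<in> Idx M \<Longrightarrow> x \<in> img M a \<Longrightarrow>
      qe_tensor M \<Gamma> f \<mu> a i j x = local_rep M \<tau> a x / 2 * \<Phi> a i j x"
  shows "generalized_quasi_einstein (cotangent M) g (f \<circ> fst) \<mu> (\<lambda>q. 3 / 2 * \<tau> (fst q))"
  unfolding generalized_quasi_einstein_def Idx_cotangent
proof (intro conjI ballI allI)
  show "pseudo_riemannian (cotangent M) g" by (rule pseudo_riemannian)
  show "smooth_fun (cotangent M) (f \<circ> fst)" by (rule smooth_fun_lift[OF atlas f])
  have "smooth_fun M (\<lambda>p. 3 / 2 * \<tau> p)"
    unfolding smooth_fun_def
  proof
    fix a assume a: "a \<in> Idx M"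
    have "smooth_on (img M a) (\<lambda>x. 3 / 2 * local_rep M \<tau> a x)"
      using smooth_\<tau> a by (intro smooth_on_mult smooth_on_const open_img[OF atlas]) (auto simp: smooth_fun_def)
    then show "smooth_on (img M a) (local_rep M (\<lambda>p. 3 / 2 * \<tau> p) a)"
      by (simp add: local_rep_def comp_def)
  qed
  from smooth_fun_lift[OF atlas this]
  show "smooth_fun (cotangent M) (\<lambda>q. 3 / 2 * \<tau> (fst q))" by (simp add: comp_def)
  fix a z r s assume a: "a \<in> Idx M" and "z \<in> img (cotangent M) a"
  then have z: "base_coord z \<in> img M a" by (simp add: img_bundle)
  have lam: "local_rep (cotangent M) (\<lambda>q. 3 / 2 * \<tau> (fst q)) a z = 3 / 2 * local_rep M \<tau> a (base_coord z)"
    using local_rep_lift[OF atlas a z, of \<tau>] by (simp add: local_rep_def)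
  note rules = hessian_lift[OF a z f] ricci_mixed[OF a z] differential_lift[OF atlas f a z] lam
    g_base_fibre[OF a z] g_fibre_base[OF a z] g_fibre_fibre[OF a z]
  show "hessian (cotangent M) nabla (f \<circ> fst) a r s z + ricci nabla a r s z
      - \<mu> * (differential (cotangent M) (f \<circ> fst) a r z * differential (cotangent M) (f \<circ> fst) a s z)
      = local_rep (cotangent M) (\<lambda>q. 3 / 2 * \<tau> (fst q)) a z * g a r s z"
  proof (cases r rule: idx4_cases)
    case r: (base i)
    show ?thesis
    proof (cases s rule: idx4_cases)
      case (base j)
      have qe': "hessian M \<Gamma> f a i j (base_coord z) = local_rep M \<tau> a (base_coord z) / 2 * \<Phi> a i j (base_coord z)
          - ricci \<Gamma> a i j (base_coord z) - ricci \<Gamma> a j i (base_coord z)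
          + \<mu> * (differential M f a i (base_coord z) * differential M f a j (base_coord z))"
        using qe[OF a z, of i j] by (simp add: qe_tensor_eq)
      show ?thesis
        unfolding r base rules ricci_base_RN[OF a z] RN_trace[OF a z] qe' d\<tau>[OF a z] g_base_base[OF a z]
        by (simp add: field_simps power2_eq_square)
    next
      case (fibre j)
      show ?thesis unfolding r fibre rules by simp
    qed
  next
    case r: (fibre i)
    show ?thesis
    proof (cases s rule: idx4_cases)
      case (base j)
      show ?thesis unfolding r base rules by simp
    next
      case (fibre j)
      show ?thesis unfolding r fibre rules by simp
    qed
  qed
qed

text \<open>
  A function pulled back from the base has a vertical gradient, and the fibres are null.
\<close>

lemma isotropic:
  assumes f: "smooth_fun M f" and df: "differential_nowhere_zero M f"
  shows "isotropic (cotangent M) g (f \<circ> fst)"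
  unfolding isotropic_def Idx_cotangent
proof (intro ballI)
  fix a z assume a: "a \<in> Idx M" and "z \<in> img (cotangent M) a"
  then have z: "base_coord z \<in> img M a" by (simp add: img_bundle)
  let ?v = "gradient (cotangent M) g (f \<circ> fst) a z"
  have v: "?v $ base_idx i = 0" "?v $ fibre_idx i = differential M f a i (base_coord z)" for i
    by (simp_all add: gradient_def matrix_inv_gram[OF a z] matrix_vector_mult_def sum_idx4 ginv_simps[OF a z]
        differential_lift[OF atlas f a z] if_distrib[of "\<lambda>u. u * _"] cong: if_cong)
  obtain i where "differential M f a i (base_coord z) \<noteq> 0"
    using df a z unfolding differential_nowhere_zero_def by blast
  then have "?v \<noteq> 0" using v(2)[of i] by auto
  moreover have "inner_at g a z ?v ?v = 0"
    by (simp add: inner_at_def sum_idx4 v g_fibre_fibre[OF a z])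
  ultimately show "inner_at g a z ?v ?v = 0 \<and> ?v \<noteq> 0" by blast
qed


section \<open>The Walker structure\<close>

lemma vertical_iff: "v \<in> vertical a z \<longleftrightarrow> (\<forall>i. v $ base_idx i = 0)"
proof
  assume "v \<in> vertical a z"
  then show "\<forall>i. v $ base_idx i = 0"
    unfolding vertical_def
    by (induction rule: span_induct_alt) (auto simp: axis_def)
next
  assume v: "\<forall>i. v $ base_idx i = 0"
  have "v = (\<Sum>i\<in>UNIV. v $ fibre_idx i *\<^sub>R axis (fibre_idx i) 1)"
    using v by (simp add: vec_eq_iff forall_idx4 axis_def if_distrib[of "\<lambda>u. _ * u"] cong: if_cong)
  also have "\<dots> \<in> vertical a z"
    unfolding vertical_def by (intro span_sum span_scale span_base) blast
  finally show "v \<in> vertical a z" .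
qed

lemma dim_vertical: "dim (vertical a z) = 2"
proof -
  have "range (\<lambda>i. axis (fibre_idx i) (1::real)) \<subseteq> Basis"
    by (auto simp: axis_in_Basis_iff)
  then have "independent (range (\<lambda>i. axis (fibre_idx i) (1::real)))"
    using independent_Basis independent_mono by blast
  moreover have "inj (\<lambda>i. axis (fibre_idx i) (1::real))"
    by (auto simp: inj_def axis_eq_axis)
  then have "card (range (\<lambda>i. axis (fibre_idx i) (1::real))) = 2"
    by (simp add: card_image)
  ultimately show ?thesis
    unfolding vertical_def by (simp add: dim_eq_card_independent)
qed

text \<open>
  Surjectivity of the Jacobian between vertical spaces: on fibre components it is inverted by the Jacobian of
  \<open>M\<close>.
\<close>

lemma distribution_vertical: "distribution (cotangent M) 2 vertical"
  unfolding distribution_def Idx_cotangent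
proof (intro conjI ballI)
  fix a z assume a: "a \<in> Idx M" and z: "z \<in> img (cotangent M) a"
  show "subspace (vertical a z)" by (simp add: vertical_def)
  show "dim (vertical a z) = 2" by (rule dim_vertical)
  define E :: "nat \<Rightarrow> real^4 \<Rightarrow> real^4" where "E m = (\<lambda>_. axis (if m = 0 then 3 else 4) 1)" for m
  have "smooth_field_on (img (cotangent M) a) (E m)" for m
    by (simp add: E_def smooth_field_on_def smooth_on_const)
  moreover have "vertical a y = span ((\<lambda>m. E m y) ` {..<2})" for y
  proof -
    have "range (\<lambda>i. axis (fibre_idx i) (1::real)) = {axis 3 1, axis 4 1}"
      unfolding UNIV_2 by simp
    moreover have "(\<lambda>m. E m y) ` {..<2} = {axis 3 1, axis 4 1}"
      by (auto simp: E_def lessThan_Suc numeral_2_eq_2)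
    ultimately show ?thesis by (simp add: vertical_def)
  qed
  moreover have "open (img (cotangent M) a)"
    using open_img_bundle[OF a] by (simp add: img_bundle[OF a])
  ultimately show "\<exists>W (E :: nat \<Rightarrow> real^4 \<Rightarrow> real^4). open W \<and> z \<in> W \<and> W \<subseteq> img (cotangent M) a \<and> (\<forall>m<2. smooth_field_on W (E m)) \<and>
           (\<forall>y\<in>W. vertical a y = span ((\<lambda>m. E m y) ` {..<2}))"
    using z by (intro exI[of _ "img (cotangent M) a"] exI[of _ E]) simp
next
  fix a b z assume a: "a \<in> Idx M" and b: "b \<in> Idx M" and "z \<in> overlap (cotangent M) a b"
  then have z: "base_coord z \<in> overlap M a b" by (simp add: overlap_cotangent[OF atlas])
  let ?w = "trans_map (cotangent M) a b z" and ?Jc = "\<lambda>r s. jac (cotangent M) a b r s z"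
  let ?D = "\<lambda>v::real^4. \<chi> s. \<Sum>r\<in>UNIV. ?Jc r s * v $ r"
  let ?J = "\<lambda>i k. jac M a b i k (base_coord z)"
  show "vertical b ?w = ?D ` vertical a z"
  proof (intro set_eqI iffI)
    fix v assume "v \<in> ?D ` vertical a z"
    then obtain u where u: "v = ?D u" "u \<in> vertical a z" by blast
    have "u $ base_idx i = 0" for i using u(2) by (simp add: vertical_iff)
    then have "v $ base_idx k = 0" for k
      unfolding u(1) by (simp add: sum_idx4 jac_cotangent_base[OF atlas a b z])
    then show "v \<in> vertical b ?w" unfolding vertical_iff by (rule allI)
  next
    fix v assume v: "v \<in> vertical b ?w"
    define u where "u = join_coords 0 (\<lambda>i. \<Sum>k\<in>UNIV. ?J i k * v $ fibre_idx k)"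
    have u: "u $ base_idx i = 0" "u $ fibre_idx i = (\<Sum>k\<in>UNIV. ?J i k * v $ fibre_idx k)" for i
      using join_coords_simps[of 0 "\<lambda>i. \<Sum>k\<in>UNIV. ?J i k * v $ fibre_idx k"]
      by (simp_all add: u_def flip: base_coord_nth fibre_coord_def)
    have "?D u $ fibre_idx l = v $ fibre_idx l" for l
    proof (rule sum_inverse_cancel[where A = "\<lambda>i m. jac M b a i m (trans_map M a b (base_coord z))" and B = ?J
          and v = "\<lambda>l. ?D u $ fibre_idx l" and w = "\<lambda>l. v $ fibre_idx l", OF jac_inverse'[OF atlas a b z]])
      fix m
      have "(\<Sum>l\<in>UNIV. ?J m l * ?D u $ fibre_idx l)
          = (\<Sum>l\<in>UNIV. \<Sum>i\<in>UNIV. ?J m l * ?Jc (fibre_idx i) (fibre_idx l) * u $ fibre_idx i)"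
        by (simp add: sum_idx4 u(1) sum_distrib_left mult.assoc)
      also have "\<dots> = (\<Sum>i\<in>UNIV. (\<Sum>l\<in>UNIV. ?J m l * ?Jc (fibre_idx i) (fibre_idx l)) * u $ fibre_idx i)"
        by (subst sum.swap) (simp only: sum_distrib_right)
      also have "\<dots> = u $ fibre_idx m"
        unfolding jac_cotangent_fibre[OF atlas a b z] by (simp add: if_distrib[of "\<lambda>u. u * _"] cong: if_cong)
      finally show "(\<Sum>l\<in>UNIV. ?J m l * ?D u $ fibre_idx l) = (\<Sum>l\<in>UNIV. ?J m l * v $ fibre_idx l)"
        by (simp add: u(2))
    qed
    moreover have "?D u $ base_idx k = v $ base_idx k" for k
      using v by (simp add: vertical_iff sum_idx4 u(1) jac_cotangent_base[OF atlas a b z])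
    ultimately have "v = ?D u" by (simp add: vec_eq_iff forall_idx4)
    moreover have "u \<in> vertical a z" by (simp add: vertical_iff u(1))
    ultimately show "v \<in> ?D ` vertical a z" by blast
  qed
qed

text \<open>
  The vertical distribution is parallel because an upper base index never occurs with a lower fibre index among
  the Christoffel symbols.
\<close>

lemma walker_vertical: "walker (cotangent M) g vertical"
  unfolding walker_def
proof (intro conjI pseudo_riemannian has_signature distribution_vertical)
  show "null_distribution (cotangent M) g vertical"
    unfolding null_distribution_def Idx_cotangent
    by (auto simp: img_bundle vertical_iff inner_at_def sum_idx4 g_fibre_fibre)
  show "parallel_distribution (cotangent M) nabla vertical"
    unfolding parallel_distribution_def Idx_cotangent vertical_iff
  proof (intro ballI allI impI)
    fix a W y i and X Y :: "real^4 \<Rightarrow> real^4"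
    assume a: "a \<in> Idx M" and W: "open W" "W \<subseteq> img (cotangent M) a"
      and Y: "\<forall>y\<in>W. \<forall>i. Y y $ base_idx i = 0" and y: "y \<in> W"
    have yb: "base_coord y \<in> img M a" using W y img_bundle[OF a] by auto
    have "partial c (\<lambda>z. Y z $ base_idx i) y = 0" for c
      using partial_cong_open[OF W(1) y, of "\<lambda>z. Y z $ base_idx i" "\<lambda>_. 0" c] Y by simp
    then show "cov_deriv (nabla a) X Y y $ base_idx i = 0"
      using Y y by (simp add: cov_deriv_def dir_deriv_def sum_idx4 nabla_components[OF a yb])
  qed
qed

end

section \<open>Self-duality\<close>

lemma det_4:
  fixes A :: "real^4^4"
  shows "det A =
    A$1$1 * A$2$2 * A$3$3 * A$4$4 - A$1$1 * A$2$2 * A$3$4 * A$4$3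
  - A$1$1 * A$2$3 * A$3$2 * A$4$4 + A$1$1 * A$2$3 * A$3$4 * A$4$2
  + A$1$1 * A$2$4 * A$3$2 * A$4$3 - A$1$1 * A$2$4 * A$3$3 * A$4$2
  - A$1$2 * A$2$1 * A$3$3 * A$4$4 + A$1$2 * A$2$1 * A$3$4 * A$4$3
  + A$1$2 * A$2$3 * A$3$1 * A$4$4 - A$1$2 * A$2$3 * A$3$4 * A$4$1
  - A$1$2 * A$2$4 * A$3$1 * A$4$3 + A$1$2 * A$2$4 * A$3$3 * A$4$1
  + A$1$3 * A$2$1 * A$3$2 * A$4$4 - A$1$3 * A$2$1 * A$3$4 * A$4$2
  - A$1$3 * A$2$2 * A$3$1 * A$4$4 + A$1$3 * A$2$2 * A$3$4 * A$4$1
  + A$1$3 * A$2$4 * A$3$1 * A$4$2 - A$1$3 * A$2$4 * A$3$2 * A$4$1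
  - A$1$4 * A$2$1 * A$3$2 * A$4$3 + A$1$4 * A$2$1 * A$3$3 * A$4$2
  + A$1$4 * A$2$2 * A$3$1 * A$4$3 - A$1$4 * A$2$2 * A$3$3 * A$4$1
  - A$1$4 * A$2$3 * A$3$1 * A$4$2 + A$1$4 * A$2$3 * A$3$2 * A$4$1"
proof -
  have f1: "finite {2::4, 3, 4}" "1 \<notin> {2::4, 3, 4}" by auto
  have f2: "finite {3::4, 4}" "2 \<notin> {3::4, 4}" by auto
  have f3: "finite {4::4}" "3 \<notin> {4::4}" by auto
  show ?thesis
    unfolding det_def UNIV_4
    unfolding sum_over_permutations_insert[OF f1] sum_over_permutations_insert[OF f2]
      sum_over_permutations_insert[OF f3] permutes_sing
    by (simp add: sign_swap_id permutation_swap_id permutation_compose sign_compose sign_id swap_id_eq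
        transpose_def)
qed

lemma axis_nth_if: "axis i (1::real) $ k = (if k = i then 1 else 0)"
  by (auto simp: axis_def)

lemma vector4_nth:
  "(vector [u, v, w, x] :: 'b::zero^4) $ 1 = u" "(vector [u, v, w, x] :: 'b^4) $ 2 = v"
  "(vector [u, v, w, x] :: 'b^4) $ 3 = w" "(vector [u, v, w, x] :: 'b^4) $ 4 = x"
  by (simp_all add: vector_def)

lemma transpose_uminus_nth:
  fixes \<beta> :: "real^'n^'n"
  assumes "transpose \<beta> = - \<beta>"
  shows "\<beta> $ i $ j = - \<beta> $ j $ i"
proof -
  have "transpose \<beta> $ j $ i = (- \<beta>) $ j $ i" by (simp only: assms)
  from this[unfolded transpose_def vec_lambda_beta vector_uminus_component] show ?thesis .
qed

text \<open>
  The contraction of a bivector with the Levi-Civita symbol. It exchanges complementary pairs of indices, with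
  the sign of the permutation.
\<close>

lemma sum_levi_civita_symbol:
  fixes \<beta> :: "real^4^4"
  assumes "transpose \<beta> = - \<beta>"
  defines "S \<equiv> \<lambda>c d. (\<Sum>i\<in>UNIV. \<Sum>j\<in>UNIV. \<beta> $ i $ j *
      det (vector [axis i 1, axis j 1, axis c 1, axis d 1] :: real^4^4)) / 2"
  shows "S 1 2 = \<beta> $ 3 $ 4" "S 1 3 = - \<beta> $ 2 $ 4" "S 1 4 = \<beta> $ 2 $ 3"
    "S 2 3 = \<beta> $ 1 $ 4" "S 2 4 = - \<beta> $ 1 $ 3" "S 3 4 = \<beta> $ 1 $ 2"
    "S c c = 0" "S d c = - S c d"
proof -
  note anti = transpose_uminus_nth[OF assms(1)]
  have b: "\<beta> $ 2 $ 1 = - \<beta> $ 1 $ 2" "\<beta> $ 3 $ 1 = - \<beta> $ 1 $ 3" "\<beta> $ 4 $ 1 = - \<beta> $ 1 $ 4"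
    "\<beta> $ 3 $ 2 = - \<beta> $ 2 $ 3" "\<beta> $ 4 $ 2 = - \<beta> $ 2 $ 4" "\<beta> $ 4 $ 3 = - \<beta> $ 3 $ 4"
    by (rule anti)+
  note rules = S_def sum_4 det_4 vector4_nth axis_nth_if b
  show "S 1 2 = \<beta> $ 3 $ 4" by (simp add: rules)
  show "S 1 3 = - \<beta> $ 2 $ 4" by (simp add: rules)
  show "S 1 4 = \<beta> $ 2 $ 3" by (simp add: rules)
  show "S 2 3 = \<beta> $ 1 $ 4" by (simp add: rules)
  show "S 2 4 = - \<beta> $ 1 $ 3" by (simp add: rules)
  show "S 3 4 = \<beta> $ 1 $ 2" by (simp add: rules)
  have swap: "det (vector [u, v, w, x] :: real^4^4) = - det (vector [u, v, x, w] :: real^4^4)" for u v w x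
    by (simp add: det_4 vector4_nth)
  show swap_S: "S d c = - S c d" for c d
    unfolding S_def
    by (subst swap) (simp add: sum_negf)
  from this[of c c] show "S c c = 0" by simp
qed

context extension_metric
begin

text \<open>
  The Jacobian of the bundle is block triangular, with the Jacobian of \<open>M\<close> and its inverse transpose as diagonal
  blocks. Its determinant is \<open>1\<close>, so the induced coordinates orient the bundle even over a non-orientable
  surface.
\<close>

lemma orientation_bundle: "orientation (cotangent M) (\<lambda>_ _. 1)"
  unfolding orientation_def Idx_cotangent
proof (intro conjI ballI)
  fix a b z assume a: "a \<in> Idx M" and b: "b \<in> Idx M" and "z \<in> overlap (cotangent M) a b"
  then have z: "base_coord z \<in> overlap M a b" by (simp add: overlap_cotangent[OF atlas])
  let ?J = "\<lambda>i k. jac M a b i k (base_coord z)"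
  let ?Jc = "\<lambda>r s. jac (cotangent M) a b r s z"
  have zero: "?Jc 3 1 = 0" "?Jc 3 2 = 0" "?Jc 4 1 = 0" "?Jc 4 2 = 0"
    using jac_cotangent_base(2)[OF atlas a b z, of 1 1] jac_cotangent_base(2)[OF atlas a b z, of 1 2]
      jac_cotangent_base(2)[OF atlas a b z, of 2 1] jac_cotangent_base(2)[OF atlas a b z, of 2 2] by simp_all
  have base: "?Jc 1 1 = ?J 1 1" "?Jc 1 2 = ?J 1 2" "?Jc 2 1 = ?J 2 1" "?Jc 2 2 = ?J 2 2"
    using jac_cotangent_base(1)[OF atlas a b z, of 1 1] jac_cotangent_base(1)[OF atlas a b z, of 1 2]
      jac_cotangent_base(1)[OF atlas a b z, of 2 1] jac_cotangent_base(1)[OF atlas a b z, of 2 2] by simp_all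
  have inv: "?J 1 1 * ?Jc 3 3 + ?J 1 2 * ?Jc 3 4 = 1" "?J 1 1 * ?Jc 4 3 + ?J 1 2 * ?Jc 4 4 = 0"
    "?J 2 1 * ?Jc 3 3 + ?J 2 2 * ?Jc 3 4 = 0" "?J 2 1 * ?Jc 4 3 + ?J 2 2 * ?Jc 4 4 = 1"
    using jac_cotangent_fibre(1)[OF atlas a b z, of 1 1] jac_cotangent_fibre(1)[OF atlas a b z, of 1 2]
      jac_cotangent_fibre(1)[OF atlas a b z, of 2 1] jac_cotangent_fibre(1)[OF atlas a b z, of 2 2]
    by (simp_all add: sum_2)
  have "det (\<chi> r s. ?Jc r s) =
      (?J 1 1 * ?Jc 3 3 + ?J 1 2 * ?Jc 3 4) * (?J 2 1 * ?Jc 4 3 + ?J 2 2 * ?Jc 4 4)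
      - (?J 1 1 * ?Jc 4 3 + ?J 1 2 * ?Jc 4 4) * (?J 2 1 * ?Jc 3 3 + ?J 2 2 * ?Jc 3 4)"
    by (simp add: det_4 zero base algebra_simps)
  also have "\<dots> = 1" unfolding inv by simp
  finally show "1 = sgn (det (\<chi> r s. ?Jc r s)) * 1" by simp
qed simp_all

context
  fixes a z
  assumes a: "a \<in> Idx M" and z: "base_coord z \<in> img M a"
begin

lemma gram_det: "det (gram g a z) = 1"
proof -
  have "g a 1 3 z = 1" "g a 1 4 z = 0" "g a 2 3 z = 0" "g a 2 4 z = 1"
    using g_base_fibre[OF a z, of 1 1] g_base_fibre[OF a z, of 1 2]
      g_base_fibre[OF a z, of 2 1] g_base_fibre[OF a z, of 2 2] by simp_all
  moreover have "g a 3 1 z = 1" "g a 3 2 z = 0" "g a 4 1 z = 0" "g a 4 2 z = 1"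
    using g_fibre_base[OF a z, of 1 1] g_fibre_base[OF a z, of 1 2]
      g_fibre_base[OF a z, of 2 1] g_fibre_base[OF a z, of 2 2] by simp_all
  moreover have "g a 3 3 z = 0" "g a 3 4 z = 0" "g a 4 3 z = 0" "g a 4 4 z = 0"
    using g_fibre_fibre[OF a z, of 1 1] g_fibre_fibre[OF a z, of 1 2]
      g_fibre_fibre[OF a z, of 2 1] g_fibre_fibre[OF a z, of 2 2] by simp_all
  ultimately show ?thesis by (simp add: det_4 gram_def)
qed

text \<open>
  The inverse metric \<open>ginv\<close> raises both indices of the contraction with the Levi-Civita symbol.
\<close>

lemma hodge_components:
  assumes \<beta>: "transpose \<beta> = - \<beta>"
  defines "h \<equiv> hodge g (\<lambda>_ _. 1) a z \<beta>"
  defines "A \<equiv> \<lambda>i j. g a i j z"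
  shows "h $ 1 $ 2 = \<beta> $ 1 $ 2"
    "h $ 1 $ 3 = \<beta> $ 2 $ 4 - A 1 2 * \<beta> $ 1 $ 2"
    "h $ 1 $ 4 = - \<beta> $ 1 $ 4 - A 2 2 * \<beta> $ 1 $ 2"
    "h $ 2 $ 3 = - \<beta> $ 2 $ 3 + A 1 1 * \<beta> $ 1 $ 2"
    "h $ 2 $ 4 = \<beta> $ 1 $ 3 + A 1 2 * \<beta> $ 1 $ 2"
    "h $ 3 $ 4 = \<beta> $ 3 $ 4 + A 1 2 * (\<beta> $ 2 $ 4 - \<beta> $ 1 $ 3) - A 2 2 * \<beta> $ 2 $ 3 + A 1 1 * \<beta> $ 1 $ 4
      + (A 1 1 * A 2 2 - (A 1 2)\<^sup>2) * \<beta> $ 1 $ 2"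
    "transpose h = - h"
proof -
  define S where "S c d = (\<Sum>i\<in>UNIV. \<Sum>j\<in>UNIV. \<beta> $ i $ j *
      det (vector [axis i 1, axis j 1, axis c 1, axis d 1] :: real^4^4)) / 2" for c d
  note sym = sum_levi_civita_symbol[OF \<beta>, folded S_def]
  have S: "S 1 1 = 0" "S 2 2 = 0" "S 3 3 = 0" "S 4 4 = 0" "S 1 2 = \<beta> $ 3 $ 4" "S 1 3 = - \<beta> $ 2 $ 4"
    "S 1 4 = \<beta> $ 2 $ 3" "S 2 3 = \<beta> $ 1 $ 4" "S 2 4 = - \<beta> $ 1 $ 3" "S 3 4 = \<beta> $ 1 $ 2"
    "S 2 1 = - \<beta> $ 3 $ 4" "S 3 1 = \<beta> $ 2 $ 4" "S 4 1 = - \<beta> $ 2 $ 3" "S 3 2 = - \<beta> $ 1 $ 4"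
    "S 4 2 = \<beta> $ 1 $ 3" "S 4 3 = - \<beta> $ 1 $ 2"
    using sym(1-7) sym(8)[of 2 1] sym(8)[of 3 1] sym(8)[of 4 1] sym(8)[of 3 2] sym(8)[of 4 2] sym(8)[of 4 3]
    by simp_all
  let ?B = "ginv a z"
  have h: "h $ k $ l = (\<Sum>c\<in>UNIV. \<Sum>d\<in>UNIV. ?B $ k $ c * ?B $ l $ d * S c d)" for k l
    by (simp add: h_def hodge_def vol_def matrix_inv_gram[OF a z] gram_det S_def)
  have B: "?B $ 1 $ 1 = 0" "?B $ 1 $ 2 = 0" "?B $ 2 $ 1 = 0" "?B $ 2 $ 2 = 0"
    "?B $ 1 $ 3 = 1" "?B $ 1 $ 4 = 0" "?B $ 2 $ 3 = 0" "?B $ 2 $ 4 = 1"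
    "?B $ 3 $ 1 = 1" "?B $ 3 $ 2 = 0" "?B $ 4 $ 1 = 0" "?B $ 4 $ 2 = 1"
    "?B $ 3 $ 3 = - A 1 1" "?B $ 3 $ 4 = - A 1 2" "?B $ 4 $ 3 = - A 1 2" "?B $ 4 $ 4 = - A 2 2"
    using ginv_simps[OF a z, of 1 1] ginv_simps[OF a z, of 1 2] ginv_simps[OF a z, of 2 1] ginv_simps[OF a z, of 2 2]
      g_base_sym[OF a z, of 2 1]
    by (simp_all add: A_def)
  show "h $ 1 $ 2 = \<beta> $ 1 $ 2"
    "h $ 1 $ 3 = \<beta> $ 2 $ 4 - A 1 2 * \<beta> $ 1 $ 2"
    "h $ 1 $ 4 = - \<beta> $ 1 $ 4 - A 2 2 * \<beta> $ 1 $ 2"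
    "h $ 2 $ 3 = - \<beta> $ 2 $ 3 + A 1 1 * \<beta> $ 1 $ 2"
    "h $ 2 $ 4 = \<beta> $ 1 $ 3 + A 1 2 * \<beta> $ 1 $ 2"
    "h $ 3 $ 4 = \<beta> $ 3 $ 4 + A 1 2 * (\<beta> $ 2 $ 4 - \<beta> $ 1 $ 3) - A 2 2 * \<beta> $ 2 $ 3 + A 1 1 * \<beta> $ 1 $ 4
      + (A 1 1 * A 2 2 - (A 1 2)\<^sup>2) * \<beta> $ 1 $ 2"
    by (simp_all add: h sum_4 B S algebra_simps power2_eq_square)
  have anti: "h $ l $ k = - h $ k $ l" for k l
  proof -
    have "h $ l $ k = (\<Sum>d\<in>UNIV. \<Sum>c\<in>UNIV. ?B $ l $ c * ?B $ k $ d * S c d)"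
      unfolding h by (rule sum.swap)
    also have "\<dots> = - h $ k $ l"
      unfolding h by (subst sym(8)) (simp add: sum_negf mult.commute)
    finally show ?thesis .
  qed
  show "transpose h = - h"
    unfolding vec_eq_iff transpose_def vec_lambda_beta vector_uminus_component
    by (intro allI anti)
qed

lemma hodge_wedge_vertical:
  assumes "u \<in> vertical a z" "v \<in> vertical a z"
  shows "hodge g (\<lambda>_ _. 1) a z (wedge u v) = wedge u v"
proof -
  let ?\<beta> = "wedge u v"
  have \<beta>: "transpose ?\<beta> = - ?\<beta>"
    by (simp add: vec_eq_iff transpose_def wedge_def)
  have "u $ 1 = 0" "u $ 2 = 0" "v $ 1 = 0" "v $ 2 = 0"
    using assms unfolding vertical_iff by (metis base_idx_simps)+
  then have w: "?\<beta> $ 1 $ k = 0" "?\<beta> $ 2 $ k = 0" for k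
    by (simp_all add: wedge_def)
  note h = hodge_components[OF \<beta>] and hT = transpose_uminus_nth[OF hodge_components(7)[OF \<beta>]]
  have diag: "hodge g (\<lambda>_ _. 1) a z ?\<beta> $ k $ k = ?\<beta> $ k $ k" for k
    using hT[of k k] by (simp add: wedge_def)
  have up: "hodge g (\<lambda>_ _. 1) a z ?\<beta> $ 1 $ 2 = ?\<beta> $ 1 $ 2" "hodge g (\<lambda>_ _. 1) a z ?\<beta> $ 1 $ 3 = ?\<beta> $ 1 $ 3"
    "hodge g (\<lambda>_ _. 1) a z ?\<beta> $ 1 $ 4 = ?\<beta> $ 1 $ 4" "hodge g (\<lambda>_ _. 1) a z ?\<beta> $ 2 $ 3 = ?\<beta> $ 2 $ 3"
    "hodge g (\<lambda>_ _. 1) a z ?\<beta> $ 2 $ 4 = ?\<beta> $ 2 $ 4" "hodge g (\<lambda>_ _. 1) a z ?\<beta> $ 3 $ 4 = ?\<beta> $ 3 $ 4"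
    unfolding h w by simp_all
  have low: "hodge g (\<lambda>_ _. 1) a z ?\<beta> $ l $ k = ?\<beta> $ l $ k" if "hodge g (\<lambda>_ _. 1) a z ?\<beta> $ k $ l = ?\<beta> $ k $ l" for k l
    using that hT[of l k] transpose_uminus_nth[OF \<beta>, of l k] by linarith
  show ?thesis
    unfolding vec_eq_iff forall_4 using diag up low[OF up(1)] low[OF up(2)] low[OF up(3)] low[OF up(4)]
      low[OF up(5)] low[OF up(6)] by blast
qed

lemma riemann_eq:
  "riemann (cotangent M) g a z r s k l = (\<Sum>m\<in>UNIV. curvature_comp (nabla a) r s k m z * g a m l z)"
proof -
  have "(\<Sum>j\<in>UNIV. g a m j z * v * axis l 1 $ j) = v * g a m l z" for m v
    by (simp add: axis_nth_if if_distrib[of "\<lambda>u. _ * u"] cong: if_cong)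
  then show ?thesis
    by (simp add: riemann_def inner_at_def curvature_op_coord_fields)
qed

text \<open>
  Lowering an index exchanges base and fibre components up to terms with \<open>A\<close>, which drop out here. The second
  equation expresses the skew-symmetry of \<open>R(X, Y)\<close>.
\<close>

lemma riemann_components:
  "riemann (cotangent M) g a z r s k (fibre_idx l) = curvature_comp (nabla a) r s k (base_idx l) z"
  "riemann (cotangent M) g a z r s (fibre_idx m) (base_idx l) = - curvature_comp (nabla a) r s (base_idx l) (base_idx m) z"
proof -
  show "riemann (cotangent M) g a z r s k (fibre_idx l) = curvature_comp (nabla a) r s k (base_idx l) z"
    by (simp add: riemann_eq sum_idx4 g_base_fibre[OF a z] g_fibre_fibre[OF a z] if_distrib[of "\<lambda>u. _ * u"] cong: if_cong)
  have "riemann (cotangent M) g a z r s (fibre_idx m) (base_idx l) = curvature_comp (nabla a) r s (fibre_idx m) (fibre_idx l) z"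
    by (simp add: riemann_eq sum_idx4 g_fibre_base[OF a z] curvature_components[OF a z] if_distrib[of "\<lambda>u. _ * u"] cong: if_cong)
  also have "\<dots> = - curvature_comp (nabla a) r s (base_idx l) (base_idx m) z"
    by (cases r rule: idx4_cases; cases s rule: idx4_cases) (simp_all add: curvature_components[OF a z])
  finally show "riemann (cotangent M) g a z r s (fibre_idx m) (base_idx l) = - curvature_comp (nabla a) r s (base_idx l) (base_idx m) z" .
qed

lemma scalar_curv_eq: "scalar_curv (cotangent M) g a z = 6 * local_rep M \<tau> a (base_coord z)"
  by (simp add: scalar_curv_def matrix_inv_gram[OF a z] sum_idx4 ginv_simps[OF a z] ricci_mixed[OF a z]
      if_distrib[of "\<lambda>u. u * _"] cong: if_cong) (simp add: sum_2)

text \<open>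
  The scalar curvature is \<open>6 \<tau>\<close>, and the dimension \<open>4\<close> turns its coefficient into \<open>\<tau>\<close>.
\<close>

lemma weyl_eq:
  defines "\<rho> \<equiv> \<lambda>r s. ricci nabla a r s z" and "h \<equiv> \<lambda>r s. g a r s z"
  shows "weyl (cotangent M) g a z r s k l = riemann (cotangent M) g a z r s k l
      - (\<rho> r k * h s l - \<rho> r l * h s k + \<rho> s l * h r k - \<rho> s k * h r l) / 2
      + local_rep M \<tau> a (base_coord z) * (h r k * h s l - h r l * h s k)"
  by (simp add: weyl_def scalar_curv_eq \<rho>_def h_def)

text \<open>
  The hypotheses describe the anti-self-dual bivectors. By skew-symmetry only the mixed components and the
  component \<open>3 4\<close> of \<open>\<gamma>\<close> contribute. For \<open>r\<close>, \<open>s\<close> in the base the sum vanishes by \<open>ricci_base_RN\<close>: in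
  dimension two, \<open>RN\<close> is determined by its trace. For mixed \<open>r\<close>, \<open>s\<close> the Weyl tensor is a multiple of the trace
  of the mixed part of \<open>\<gamma>\<close>, which is zero.
\<close>

lemma weyl_contraction_zero:
  fixes \<gamma> :: "4 \<Rightarrow> 4 \<Rightarrow> real"
  assumes bb: "\<And>i j. \<gamma> (base_idx i) (base_idx j) = 0"
    and fb: "\<And>i j. \<gamma> (fibre_idx i) (base_idx j) = - \<gamma> (base_idx j) (fibre_idx i)"
    and ff: "\<And>i j. \<gamma> (fibre_idx i) (fibre_idx j) = - \<gamma> (fibre_idx j) (fibre_idx i)"
    and trace: "\<gamma> 2 4 = - \<gamma> 1 3"
    and f12: "\<gamma> 3 4 = g a 1 2 z * \<gamma> 1 3 - g a 1 1 z * \<gamma> 1 4 / 2 + g a 2 2 z * \<gamma> 2 3 / 2"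
  shows "(\<Sum>k\<in>UNIV. \<Sum>l\<in>UNIV. weyl (cotangent M) g a z r s k l * \<gamma> k l) = 0"
proof -
  define W where "W k l = weyl (cotangent M) g a z r s k l" for k l
  have W_bf: "W (fibre_idx l) (base_idx k) = - W (base_idx k) (fibre_idx l)" for k l
    unfolding W_def weyl_eq riemann_components by (simp add: field_simps)
  have W_ff: "W (fibre_idx l) (fibre_idx k) = - W (fibre_idx k) (fibre_idx l)" for k l
    unfolding W_def weyl_eq riemann_components curvature_components[OF a z] by (simp add: field_simps)
  define c where "c k l = \<gamma> (base_idx k) (fibre_idx l)" for k l
  define d where "d = \<gamma> 3 4"
  have \<gamma>0: "\<gamma> 3 3 = 0" "\<gamma> 4 4 = 0" "\<gamma> 4 3 = - d"
    using ff[of 1 1] ff[of 2 2] ff[of 2 1] by (simp_all add: d_def)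
  have "(\<Sum>k\<in>UNIV. \<Sum>l\<in>UNIV. W k l * \<gamma> k l) =
      (\<Sum>k\<in>UNIV. \<Sum>l\<in>UNIV. W (base_idx k) (fibre_idx l) * c k l)
      + (\<Sum>k\<in>UNIV. \<Sum>l\<in>UNIV. W (base_idx l) (fibre_idx k) * c l k)
      + (\<Sum>k\<in>UNIV. \<Sum>l\<in>UNIV. W (fibre_idx k) (fibre_idx l) * \<gamma> (fibre_idx k) (fibre_idx l))"
    by (simp add: sum_idx4 bb fb W_bf c_def sum.distrib)
  also have "(\<Sum>k\<in>UNIV. \<Sum>l\<in>UNIV. W (base_idx l) (fibre_idx k) * c l k)
      = (\<Sum>k\<in>UNIV. \<Sum>l\<in>UNIV. W (base_idx k) (fibre_idx l) * c k l)"
    by (rule sum.swap)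
  also have "(\<Sum>k\<in>UNIV. \<Sum>l\<in>UNIV. W (fibre_idx k) (fibre_idx l) * \<gamma> (fibre_idx k) (fibre_idx l))
      = 2 * (W (fibre_idx 1) (fibre_idx 2) * d)"
    using W_ff[of 2 1] by (simp add: sum_2 \<gamma>0 d_def[symmetric])
  finally have total: "(\<Sum>k\<in>UNIV. \<Sum>l\<in>UNIV. W k l * \<gamma> k l) = 2 *
      ((\<Sum>k\<in>UNIV. \<Sum>l\<in>UNIV. W (base_idx k) (fibre_idx l) * c k l) + W (fibre_idx 1) (fibre_idx 2) * d)"
    by simp
  define A where "A i j = g a (base_idx i) (base_idx j) z" for i j
  have c22: "c 2 2 = - c 1 1" and d: "d = A 1 2 * c 1 1 - A 1 1 * c 1 2 / 2 + A 2 2 * c 2 1 / 2"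
    using trace f12 by (simp_all add: c_def d_def A_def)
  have A21: "A 2 1 = A 1 2" using g_base_sym[OF a z, of 2 1] by (simp add: A_def)
  have RN_anti: "RN a 2 1 k l z = - RN a 1 2 k l z" "RN a i i k l z = 0" for i k l
    by (simp_all add: RN_def)
  note rules = weyl_eq riemann_components curvature_components[OF a z] ricci_mixed[OF a z] ricci_base_RN[OF a z]
    g_base_fibre[OF a z] g_fibre_base[OF a z] g_fibre_fibre[OF a z] partial_fibre_N[OF a z] A_def[symmetric]
  have "(\<Sum>k\<in>UNIV. \<Sum>l\<in>UNIV. W (base_idx k) (fibre_idx l) * c k l) + W (fibre_idx 1) (fibre_idx 2) * d = 0"
  proof (cases r rule: idx4_cases)
    case r: (base i)
    show ?thesis
    proof (cases s rule: idx4_cases)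
      case (base j)
      show ?thesis
        unfolding W_def r base rules
        using idx2_cases[of i] idx2_cases[of j]
        by (elim disjE; hypsubst) (simp_all add: sum_2 c22 d A21 RN_anti field_simps)
    next
      case (fibre j)
      show ?thesis
        unfolding W_def r fibre rules
        using idx2_cases[of i] idx2_cases[of j]
        by (elim disjE; hypsubst) (simp_all add: sum_2 c22 field_simps)
    qed
  next
    case r: (fibre i)
    show ?thesis
    proof (cases s rule: idx4_cases)
      case (base j)
      show ?thesis
        unfolding W_def r base rules
        using idx2_cases[of i] idx2_cases[of j]
        by (elim disjE; hypsubst) (simp_all add: sum_2 c22 field_simps)
    next
      case (fibre j)
      show ?thesis
        unfolding W_def r fibre rules by simp
    qed
  qed
  then show ?thesis using total by (simp add: W_def)
qed

text \<open>
  By \<open>hodge_components\<close>, the projection \<open>(\<beta> - \<star>\<beta>) / 2\<close> satisfies the hypotheses of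
  \<open>weyl_contraction_zero\<close>.
\<close>

lemma weyl_minus_zero:
  assumes \<beta>: "transpose \<beta> = - \<beta>"
  shows "weyl_minus (cotangent M) g (\<lambda>_ _. 1) a z \<beta> = 0"
proof -
  define h where "h = hodge g (\<lambda>_ _. 1) a z \<beta>"
  define \<gamma> where "\<gamma> k l = (\<beta> $ k $ l - h $ k $ l) / 2" for k l
  note hc = hodge_components[OF \<beta>, folded h_def]
  have anti: "\<gamma> k l = - \<gamma> l k" for k l
  proof -
    have "\<beta> $ k $ l + \<beta> $ l $ k = 0" "h $ k $ l + h $ l $ k = 0"
      using transpose_uminus_nth[OF \<beta>, of k l] transpose_uminus_nth[OF hc(7), of k l]
      unfolding eq_neg_iff_add_eq_0 by blast+
    moreover have "\<gamma> k l + \<gamma> l k = (\<beta> $ k $ l + \<beta> $ l $ k) / 2 - (h $ k $ l + h $ l $ k) / 2"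
      unfolding \<gamma>_def by (simp add: field_simps)
    ultimately show ?thesis unfolding eq_neg_iff_add_eq_0 by simp
  qed
  have "(\<Sum>k\<in>UNIV. \<Sum>l\<in>UNIV. weyl (cotangent M) g a z r s k l * \<gamma> k l) = 0" for r s
  proof (rule weyl_contraction_zero)
    have "\<gamma> 1 1 = 0" "\<gamma> 2 2 = 0" using anti[of 1 1] anti[of 2 2] by simp_all
    moreover have "\<gamma> 1 2 = 0" unfolding \<gamma>_def hc by simp
    moreover from this have "\<gamma> 2 1 = 0" using anti[of 2 1] by simp
    ultimately show "\<gamma> (base_idx i) (base_idx j) = 0" for i j
      using idx2_cases[of i] idx2_cases[of j] by auto
    show "\<gamma> 2 4 = - \<gamma> 1 3" unfolding \<gamma>_def hc by (simp add: field_simps)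
    show "\<gamma> 3 4 = g a 1 2 z * \<gamma> 1 3 - g a 1 1 z * \<gamma> 1 4 / 2 + g a 2 2 z * \<gamma> 2 3 / 2"
      unfolding \<gamma>_def hc by (simp add: field_simps power2_eq_square)
  qed (rule anti)+
  then show ?thesis
    by (simp add: weyl_minus_def vec_eq_iff \<gamma>_def h_def)
qed

end

lemma self_dual_walker: "self_dual_walker (cotangent M) g vertical"
  unfolding self_dual_walker_def
proof (intro conjI walker_vertical exI[of _ "\<lambda>_ _. 1"] orientation_bundle)
  show "self_dual_distribution (cotangent M) g (\<lambda>_ _. 1) vertical"
    unfolding self_dual_distribution_def Idx_cotangent
    using hodge_wedge_vertical by (auto simp: img_bundle)
  show "self_dual (cotangent M) g (\<lambda>_ _. 1)"
    unfolding self_dual_def Idx_cotangent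
    using weyl_minus_zero by (auto simp: img_bundle)
qed

end

section \<open>Deformed and modified extensions\<close>

lemma sum_dd_base_fibre:
  "(\<Sum>i\<in>UNIV. dd (base_idx i) (fibre_idx i) (base_idx k) (base_idx l)) = 0"
  "2 * (\<Sum>i\<in>UNIV. dd (base_idx i) (fibre_idx i) (base_idx k) (fibre_idx l)) = (if k = l then 1 else 0)"
  "2 * (\<Sum>i\<in>UNIV. dd (base_idx i) (fibre_idx i) (fibre_idx k) (base_idx l)) = (if k = l then 1 else 0)"
  "(\<Sum>i\<in>UNIV. dd (base_idx i) (fibre_idx i) (fibre_idx k) (fibre_idx l)) = 0"
  using idx2_cases[of k] idx2_cases[of l] by (auto simp: dd_def sum_2)

lemma sum_dd_base_base:
  assumes "X 1 2 = X (2::2) (1::2)"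
  shows "(\<Sum>i\<in>UNIV. \<Sum>j\<in>UNIV. X i j * dd (base_idx i) (base_idx j) (base_idx k) (base_idx l)) = X k l"
    and "(\<Sum>i\<in>UNIV. \<Sum>j\<in>UNIV. X i j * dd (base_idx i) (base_idx j) (base_idx k) (fibre_idx l)) = 0"
    and "(\<Sum>i\<in>UNIV. \<Sum>j\<in>UNIV. X i j * dd (base_idx i) (base_idx j) (fibre_idx k) (base_idx l)) = 0"
    and "(\<Sum>i\<in>UNIV. \<Sum>j\<in>UNIV. X i j * dd (base_idx i) (base_idx j) (fibre_idx k) (fibre_idx l)) = 0"
  using idx2_cases[of k] idx2_cases[of l] assms by (auto simp: dd_def sum_2)

lemma extension_metricI:
  assumes surface: "affine_surface M \<Gamma>" and tensor: "sym_tensor02 M \<Phi>" and \<tau>: "smooth_fun M \<tau>"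
    and g: "\<And>a r s z. a \<in> Idx M \<Longrightarrow> base_coord z \<in> img M a \<Longrightarrow> g a r s z =
      2 * (\<Sum>i\<in>UNIV. dd (base_idx i) (fibre_idx i) r s) +
      (\<Sum>i\<in>UNIV. \<Sum>j\<in>UNIV. (local_rep M \<tau> a (base_coord z) * (fibre_coord z i * fibre_coord z j)
        - 2 * (\<Sum>k\<in>UNIV. fibre_coord z k * \<Gamma> a i j k (base_coord z)) + \<Phi> a i j (base_coord z))
        * dd (base_idx i) (base_idx j) r s)"
  shows "extension_metric M \<Gamma> \<Phi> \<tau> g"
proof
  fix a z i j assume a: "a \<in> Idx M" and z: "base_coord z \<in> img M a"
  define X where "X i j = local_rep M \<tau> a (base_coord z) * (fibre_coord z i * fibre_coord z j)
        - 2 * (\<Sum>k\<in>UNIV. fibre_coord z k * \<Gamma> a i j k (base_coord z)) + \<Phi> a i j (base_coord z)" for i j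
  have "\<Gamma> a 1 2 k (base_coord z) = \<Gamma> a 2 1 k (base_coord z)" for k
    using surface torsion_free_symmetric a z by (auto simp: affine_surface_def)
  moreover have "\<Phi> a 1 2 (base_coord z) = \<Phi> a 2 1 (base_coord z)"
    using tensor a z by (simp add: sym_tensor02_def)
  ultimately have "X 1 2 = X 2 1" by (simp add: X_def)
  note dd = sum_dd_base_base[of X, OF this] sum_dd_base_fibre
  note g = g[OF a z, folded X_def]
  show "g a (base_idx i) (base_idx j) z = local_rep M \<tau> a (base_coord z) * (fibre_coord z i * fibre_coord z j)
        - 2 * (\<Sum>k\<in>UNIV. fibre_coord z k * \<Gamma> a i j k (base_coord z)) + \<Phi> a i j (base_coord z)"
    by (simp add: g dd) (simp add: X_def)
  show "g a (base_idx i) (fibre_idx j) z = (if i = j then 1 else 0)"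
    "g a (fibre_idx i) (base_idx j) z = (if i = j then 1 else 0)"
    "g a (fibre_idx i) (fibre_idx j) z = 0"
    unfolding g dd by simp_all
qed (rule surface tensor \<tau>)+

lemma smooth_fun_const: "smooth_fun M (\<lambda>_. c)"
  unfolding smooth_fun_def local_rep_def comp_def by (simp add: smooth_on_const)

lemma smooth_fun_scaled_exp:
  assumes M: "smooth_atlas M" and f: "smooth_fun M f"
  shows "smooth_fun M (\<lambda>p. c * exp (e * f p))"
  unfolding smooth_fun_def
proof
  fix a assume a: "a \<in> Idx M"
  have "smooth_on (img M a) (\<lambda>x. c * exp (e * local_rep M f a x))"
    using f a by (intro smooth_on_mult smooth_on_const smooth_on_exp open_img[OF M]) (auto simp: smooth_fun_def)
  then show "smooth_on (img M a) (local_rep M (\<lambda>p. c * exp (e * f p)) a)"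
    by (simp add: local_rep_def comp_def)
qed

lemma deformed_extension_metric:
  assumes "affine_surface M \<Gamma>" "sym_tensor02 M \<Phi>"
  shows "extension_metric M \<Gamma> \<Phi> (\<lambda>_. 0) (deformed_extension \<Gamma> \<Phi>)"
  by (rule extension_metricI[OF assms smooth_fun_const])
    (simp add: deformed_extension_def local_rep_def)

text \<open>
  For \<open>T = \<tau> Id\<close> and \<open>S = Id\<close> the quadratic term of the modified extension is \<open>\<tau> p\<^sub>i p\<^sub>j\<close>.
\<close>

lemma modified_extension_metric:
  assumes "affine_surface M \<Gamma>" "sym_tensor02 M \<Phi>" "smooth_fun M \<tau>"
  shows "extension_metric M \<Gamma> \<Phi> \<tau> (modified_extension \<Gamma> \<Phi> (scalar_endo M \<tau>) (scalar_endo M (\<lambda>_. 1)))"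
proof (rule extension_metricI[OF assms])
  fix a r s z
  define t where "t = local_rep M \<tau> a (base_coord z)"
  have "(\<Sum>p\<in>UNIV. \<Sum>q\<in>UNIV. fibre_coord z p * fibre_coord z q *
            (scalar_endo M \<tau> a i p (base_coord z) * scalar_endo M (\<lambda>_. 1) a j q (base_coord z) +
             scalar_endo M \<tau> a j p (base_coord z) * scalar_endo M (\<lambda>_. 1) a i q (base_coord z))) / 2
      = t * (fibre_coord z i * fibre_coord z j)" for i j
  proof -
    have one: "local_rep M (\<lambda>_. 1) a x = 1" for x by (simp add: local_rep_def)
    show ?thesis
      using idx2_cases[of i] idx2_cases[of j]
      by (elim disjE; hypsubst) (simp_all add: scalar_endo_def one t_def[symmetric] sum_2 algebra_simps)
  qed
  then show "modified_extension \<Gamma> \<Phi> (scalar_endo M \<tau>) (scalar_endo M (\<lambda>_. 1)) a r s z =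
      2 * (\<Sum>i\<in>UNIV. dd (base_idx i) (fibre_idx i) r s) +
      (\<Sum>i\<in>UNIV. \<Sum>j\<in>UNIV. (local_rep M \<tau> a (base_coord z) * (fibre_coord z i * fibre_coord z j)
        - 2 * (\<Sum>k\<in>UNIV. fibre_coord z k * \<Gamma> a i j k (base_coord z)) + \<Phi> a i j (base_coord z))
        * dd (base_idx i) (base_idx j) r s)"
    by (simp add: modified_extension_def t_def)
qed

theorem theorem10:
  fixes M :: "('i, 'a, 2) atlas" and \<Gamma> :: "'i \<Rightarrow> 2 christoffel" and fh :: "'a \<Rightarrow> real"
  assumes "affine_surface M \<Gamma>"
    and "smooth_fun M fh"
    and "differential_nowhere_zero M fh"
  shows
    "(\<forall>\<Phi> \<mu>. sym_tensor02 M \<Phi> \<longrightarrow>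
        (\<forall>a\<in>Idx M. \<forall>x\<in>img M a. \<forall>i j. qe_tensor M \<Gamma> fh \<mu> a i j x = 0) \<longrightarrow>
        (let g = deformed_extension \<Gamma> \<Phi> in
          self_dual_walker (cotangent M) g vertical \<and>
          isotropic (cotangent M) g (fh \<circ> fst) \<and>
          quasi_einstein (cotangent M) g (fh \<circ> fst) \<mu> 0)) \<and>
     (\<forall>\<mu> C :: real. C \<noteq> 0 \<longrightarrow>
        (let \<Phi> = (\<lambda>a i j x. 2 / C * exp (local_rep M fh a x) * qe_tensor M \<Gamma> fh \<mu> a i j x);
             T = scalar_endo M (\<lambda>p. C * exp (- fh p));
             g = modified_extension \<Gamma> \<Phi> T (scalar_endo M (\<lambda>_. 1)) in
          self_dual_walker (cotangent M) g vertical \<and>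
          isotropic (cotangent M) g (fh \<circ> fst) \<and>
          generalized_quasi_einstein (cotangent M) g (fh \<circ> fst) \<mu>
            (\<lambda>q. 3 / 2 * C * exp (- (fh \<circ> fst) q))))"
proof (intro conjI allI impI)
  have M: "smooth_atlas M" and conn: "connection M \<Gamma>" and tf: "torsion_free M \<Gamma>"
    using assms(1) by (auto simp: affine_surface_def smooth_manifold_iff)
  {
    fix \<Phi> \<mu>
    assume \<Phi>: "sym_tensor02 M \<Phi>"
      and qe: "\<forall>a\<in>Idx M. \<forall>x\<in>img M a. \<forall>i j. qe_tensor M \<Gamma> fh \<mu> a i j x = 0"
    interpret extension_metric M \<Gamma> \<Phi> "\<lambda>_. 0" "deformed_extension \<Gamma> \<Phi>"
      by (rule deformed_extension_metric[OF assms(1) \<Phi>])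
    have zero: "local_rep M (\<lambda>_. 0) a = (\<lambda>_. 0)" for a
      by (simp add: local_rep_def fun_eq_iff)
    have "generalized_quasi_einstein (cotangent M) (deformed_extension \<Gamma> \<Phi>) (fh \<circ> fst) \<mu> (\<lambda>q. 3 / 2 * 0)"
      using qe by (intro generalized_quasi_einstein assms(2)) (simp_all add: differential_def zero)
    then show "let g = deformed_extension \<Gamma> \<Phi> in
          self_dual_walker (cotangent M) g vertical \<and>
          isotropic (cotangent M) g (fh \<circ> fst) \<and>
          quasi_einstein (cotangent M) g (fh \<circ> fst) \<mu> 0"
      using self_dual_walker isotropic[OF assms(2,3)] by (simp add: quasi_einstein_def)
  next
    fix \<mu> C :: real
    assume C: "C \<noteq> 0"
    define \<Phi> where "\<Phi> = (\<lambda>a i j x. 2 / C * exp (local_rep M fh a x) * qe_tensor M \<Gamma> fh \<mu> a i j x)"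
    define \<tau> where "\<tau> = (\<lambda>p. C * exp (- fh p))"
    have smooth_\<tau>: "smooth_fun M \<tau>"
      using smooth_fun_scaled_exp[OF M assms(2), of C "-1"] by (simp add: \<tau>_def)
    have "sym_tensor02 M \<Phi>"
      using sym_tensor02_qe_tensor[OF M conn tf assms(2) smooth_fun_scaled_exp[OF M assms(2), of "2 / C" 1], of \<mu>]
      by (simp add: \<Phi>_def local_rep_def)
    then interpret extension_metric M \<Gamma> \<Phi> \<tau> "modified_extension \<Gamma> \<Phi> (scalar_endo M \<tau>) (scalar_endo M (\<lambda>_. 1))"
      by (intro modified_extension_metric assms(1) smooth_\<tau>)
    have \<tau>_rep: "local_rep M \<tau> a = (\<lambda>x. C * exp (- local_rep M fh a x))" for a
      by (simp add: local_rep_def \<tau>_def fun_eq_iff)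
    have "generalized_quasi_einstein (cotangent M) (modified_extension \<Gamma> \<Phi> (scalar_endo M \<tau>) (scalar_endo M (\<lambda>_. 1)))
        (fh \<circ> fst) \<mu> (\<lambda>q. 3 / 2 * \<tau> (fst q))"
    proof (intro generalized_quasi_einstein assms(2))
      fix a x i j assume a: "a \<in> Idx M" and x: "x \<in> img M a"
      have "local_rep M fh a differentiable (at x)"
        using assms(2) a x smooth_on_imp_differentiable by (auto simp: smooth_fun_def)
      then show "differential M \<tau> a i x = - local_rep M \<tau> a x * differential M fh a i x"
        by (simp add: differential_def \<tau>_rep partial_mult partial_exp partial_minus differentiable_exp_real)
      show "qe_tensor M \<Gamma> fh \<mu> a i j x = local_rep M \<tau> a x / 2 * \<Phi> a i j x"
        using C by (simp add: \<tau>_rep \<Phi>_def exp_minus field_simps)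
    qed
    then show "let \<Phi> = (\<lambda>a i j x. 2 / C * exp (local_rep M fh a x) * qe_tensor M \<Gamma> fh \<mu> a i j x);
             T = scalar_endo M (\<lambda>p. C * exp (- fh p));
             g = modified_extension \<Gamma> \<Phi> T (scalar_endo M (\<lambda>_. 1)) in
          self_dual_walker (cotangent M) g vertical \<and>
          isotropic (cotangent M) g (fh \<circ> fst) \<and>
          generalized_quasi_einstein (cotangent M) g (fh \<circ> fst) \<mu>
            (\<lambda>q. 3 / 2 * C * exp (- (fh \<circ> fst) q))"
      using self_dual_walker isotropic[OF assms(2,3)]
      unfolding Let_def \<Phi>_def[symmetric] \<tau>_def[symmetric]
      by (simp add: \<tau>_def mult.assoc)
  }
qed

end
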